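(* Let $x>0$ and assume that $\gamma:[0,\infty)\to(1,\infty)$ is continuous. Suppose that $a^*(x):=\inf\{s\in[x,\infty):\bar\gamma(s)<0\}<\infty$. Then $U$ exhibits type II creeping under $\mathbb{P}_x$ if and only if $X$ is of bounded variation.
   Context: $X=\{X_t:t\ge0\}$ is a spectrally negative Lévy process: a real-valued process with stationary independent increments and càdlàg paths having only negative discontinuities, whose paths are not monotone. It is defined on a filtered probability space satisfying the natural conditions. For $x\in\mathbb{R}$, $\mathbb{P}_x$ is the law under which $X_0=x$. "$X$ is of bounded variation" means that its paths are almost surely of bounded variation on compact time intervals; equivalently $X_t-X_0=\mathtt{d}t-\eta_t$ with $\mathtt{d}>0$ and $\eta$ a driftless subordinator. Running supremum: $S_t=\sup_{s\le t}X_s$. Perturbed process: $U_t=X_t-\int_{(0,t]}\gamma(S_u)\,\mathrm{d}S_u$, $t\ge0$. For the starting point $x$ of $X$, put $\bar\gamma(s)=s-\int_x^s\gamma(y)\,\mathrm{d}y$ for $s\ge x$. Stopping times: $\sigma_a=\inf\{t>0:S_t=a\}$ and $T_0^-=\inf\{t>0:U_t<0\}$, with $\inf\emptyset=\infty$. Type II creeping: $U$ exhibits type II creeping under $\mathbb{P}_x$ if $a^*(x)<\infty$ and $\mathbb{P}_x[\sigma_{a^*(x)}=T_0^-]>0$. *)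

theory Defs
  imports "HOL-Probability.Probability"
begin

text \<open>
  Processes are functions \<open>real \<Rightarrow> 'w \<Rightarrow> real\<close> and filtrations functions
  \<open>real \<Rightarrow> 'w measure\<close>; only their values at times \<open>t \<ge> 0\<close> are used.
\<close>

subsection \<open>Spectrally negative Levy processes\<close>

text \<open>
  The ``natural conditions'' (Bichteler): the filtration is right-continuous and contains every
  nearly empty set, i.e. every subset of a countable union of null sets each of which belongs to
  some \<open>F t\<close> with \<open>t\<close> finite. This asks for less than the ``usual conditions'', which add
  all null sets of the whole \<open>\<sigma>\<close>-algebra.
\<close>

definition nearly_empty :: "'w measure \<Rightarrow> (real \<Rightarrow> 'w measure) \<Rightarrow> 'w set \<Rightarrow> bool" where
  "nearly_empty M F A \<longleftrightarrow>
     (\<exists>N :: nat \<Rightarrow> 'w set.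
        A \<subseteq> (\<Union>n. N n) \<and> (\<forall>n. N n \<in> null_sets M \<and> (\<exists>t\<ge>0. N n \<in> sets (F t))))"

definition natural_conditions :: "'w measure \<Rightarrow> (real \<Rightarrow> 'w measure) \<Rightarrow> bool" where
  "natural_conditions M F \<longleftrightarrow>
     (\<forall>t\<ge>0. (\<Inter>s\<in>{t<..}. sets (F s)) \<subseteq> sets (F t)) \<and>
     (\<forall>t\<ge>0. \<forall>A. nearly_empty M F A \<longrightarrow> A \<in> sets (F t))"

text \<open>Since the library's locale \<open>filtration\<close> quantifies over the whole index type, the
  filtration is extended to negative times by \<open>F 0\<close>.\<close>

locale filtered_prob_space = prob_space M for M :: "'w measure" +
  fixes F :: "real \<Rightarrow> 'w measure"
  assumes filtration: "filtration (space M) (\<lambda>t. F (max 0 t))"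
    and sets_F_subset: "\<And>t. 0 \<le> t \<Longrightarrow> sets (F t) \<subseteq> sets M"
    and natural_conditions: "natural_conditions M F"

definition cadlag_no_positive_jumps :: "(real \<Rightarrow> real) \<Rightarrow> bool" where
  "cadlag_no_positive_jumps f \<longleftrightarrow>
     (\<forall>t\<ge>0. (f \<longlongrightarrow> f t) (at_right t)) \<and>
     (\<forall>t>0. \<exists>l. (f \<longlongrightarrow> l) (at_left t) \<and> f t \<le> l)"

text \<open>\<open>M\<close> plays the role of \<open>\<P>\<^sub>x\<close>, the law under which the process starts at \<open>x\<close>.\<close>

locale spectrally_negative_levy_process = filtered_prob_space M F
  for M :: "'w measure" and F :: "real \<Rightarrow> 'w measure" +
  fixes X :: "real \<Rightarrow> 'w \<Rightarrow> real" and x :: real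
  assumes adapted: "\<And>t. 0 \<le> t \<Longrightarrow> X t \<in> borel_measurable (F t)"
    and start: "AE \<omega> in M. X 0 \<omega> = x"
    and independent_increments:
      "\<And>(\<tau> :: nat \<Rightarrow> real) n. 0 \<le> \<tau> 0 \<Longrightarrow> strict_mono \<tau> \<Longrightarrow>
         indep_vars (\<lambda>_. borel) (\<lambda>i \<omega>. X (\<tau> (Suc i)) \<omega> - X (\<tau> i) \<omega>) {..<n}"
    and stationary_increments:
      "\<And>s t. 0 \<le> s \<Longrightarrow> s \<le> t \<Longrightarrow>
         distr M borel (\<lambda>\<omega>. X t \<omega> - X s \<omega>) = distr M borel (\<lambda>\<omega>. X (t - s) \<omega> - X 0 \<omega>)"
    and paths: "\<And>\<omega>. \<omega> \<in> space M \<Longrightarrow> cadlag_no_positive_jumps (\<lambda>t. X t \<omega>)"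
    and not_monotone:
      "AE \<omega> in M. \<not> mono_on {0..} (\<lambda>t. X t \<omega>) \<and> \<not> antimono_on {0..} (\<lambda>t. X t \<omega>)"

definition bounded_variation_on_Icc :: "real \<Rightarrow> real \<Rightarrow> (real \<Rightarrow> real) \<Rightarrow> bool" where
  "bounded_variation_on_Icc a b f \<longleftrightarrow>
     (\<exists>K. \<forall>(n :: nat) (\<tau> :: nat \<Rightarrow> real).
        mono_on {..n} \<tau> \<and> \<tau> ` {..n} \<subseteq> {a..b} \<longrightarrow> (\<Sum>i<n. \<bar>f (\<tau> (Suc i)) - f (\<tau> i)\<bar>) \<le> K)"

definition of_bounded_variation :: "'w measure \<Rightarrow> (real \<Rightarrow> 'w \<Rightarrow> real) \<Rightarrow> bool" where
  "of_bounded_variation M X \<longleftrightarrow>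
     (AE \<omega> in M. \<forall>a b. 0 \<le> a \<and> a \<le> b \<longrightarrow> bounded_variation_on_Icc a b (\<lambda>t. X t \<omega>))"

subsection \<open>The perturbed process\<close>

definition running_sup :: "(real \<Rightarrow> 'w \<Rightarrow> real) \<Rightarrow> real \<Rightarrow> 'w \<Rightarrow> real" where
  "running_sup X t \<omega> = (SUP s\<in>{0..t}. X s \<omega>)"

text \<open>The integral against \<open>dS\<close> is the pathwise Lebesgue--Stieltjes integral. The integrator is
  extended to negative times by its value at 0 because \<open>interval_measure\<close> expects a
  nondecreasing right-continuous function on the whole line.\<close>

definition perturbed :: "(real \<Rightarrow> real) \<Rightarrow> (real \<Rightarrow> 'w \<Rightarrow> real) \<Rightarrow> real \<Rightarrow> 'w \<Rightarrow> real" where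
  "perturbed \<gamma> X t \<omega> =
     X t \<omega> - (LINT u:{0<..t}|interval_measure (\<lambda>u. running_sup X (max 0 u) \<omega>).
                \<gamma> (running_sup X u \<omega>))"

definition gamma_bar :: "(real \<Rightarrow> real) \<Rightarrow> real \<Rightarrow> real \<Rightarrow> real" where
  "gamma_bar \<gamma> x s = s - integral {x..s} \<gamma>"

text \<open>Infima that may be over the empty set are taken in \<open>ereal\<close>, so that \<open>inf \<emptyset> = \<infinity>\<close>.\<close>

definition a_star :: "(real \<Rightarrow> real) \<Rightarrow> real \<Rightarrow> ereal" where
  "a_star \<gamma> x = Inf (ereal ` {s \<in> {x..}. gamma_bar \<gamma> x s < 0})"

definition sigma_time :: "(real \<Rightarrow> 'w \<Rightarrow> real) \<Rightarrow> ereal \<Rightarrow> 'w \<Rightarrow> ereal" where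
  "sigma_time X a \<omega> = Inf (ereal ` {t. 0 < t \<and> ereal (running_sup X t \<omega>) = a})"

definition ruin_time :: "(real \<Rightarrow> real) \<Rightarrow> (real \<Rightarrow> 'w \<Rightarrow> real) \<Rightarrow> 'w \<Rightarrow> ereal" where
  "ruin_time \<gamma> X \<omega> = Inf (ereal ` {t. 0 < t \<and> perturbed \<gamma> X t \<omega> < 0})"

definition type_II_creeping ::
  "'w measure \<Rightarrow> (real \<Rightarrow> real) \<Rightarrow> (real \<Rightarrow> 'w \<Rightarrow> real) \<Rightarrow> real \<Rightarrow> bool" where
  "type_II_creeping M \<gamma> X x \<longleftrightarrow>
     a_star \<gamma> x < \<infinity> \<and>
     measure M {\<omega> \<in> space M. sigma_time X (a_star \<gamma> x) \<omega> = ruin_time \<gamma> X \<omega>} > 0"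

end

(* Since X has no positive jumps, S is continuous and U_t = gamma_bar(S_t) - (S_t - X_t), where
   gamma_bar decreases through 0 at a = a*(x) with slope bounded away from 0 and from infinity.
   Hence type II creeping means that, with positive probability, X reaches a while the drawdown
   S - X stays of the order of the distance a - S.

   If this happens, split the way to a at the points of distance L / 2^k from a.  The strong Markov
   property and the rescaling in good_hit_imp_reach show that the probability of reaching a fixed
   level before falling by y stays bounded away from 0 as y tends to 0, so X stays above its
   starting point on a time interval with positive probability q.  Then the expected number of
   upcrossings of any level in such an interval is at most 1/q, and integrating over the levels
   (Banach's indicatrix) bounds the upward variation.

   Conversely, if X is of bounded variation, then its upward variation is deterministic, because
   its summands along a grid become uniformly small.  So there is a least d with
   X_t - X_s <= d (t - s), and D_t = d t - (X_t - X_0) is increasing.  The probabilities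
   P(D_t > delta t) are summable along t = t0 / 2^k by a telescoping variance estimate.  One then
   approaches a in stages of geometrically decreasing length, whose durations are chosen
   adaptively, and D stays small on all of them with positive probability.

   All probabilities are estimated for the random walks obtained by sampling X along grids, where
   the strong Markov property is elementary. *)

theory Submission
  imports Defs
begin

section \<open>Paths without positive jumps\<close>

text \<open>Three obstacles shape the argument. The two times also agree when both are infinite;
  this case has to be excluded separately, which works because such a path stays in a bounded band,
  whereas a nontrivial random walk leaves every band. No moments of \<open>X\<close> are available,
  so variances are taken of negative exponentials, of the upward variation and of the excess
  \<open>D\<close>: these are bounded, and independence turns their means into powers. In the staged
  approach, stages of fixed duration would be unstable, because an error in the remaining distance,
  measured in the next and halved time unit, doubles from stage to stage. Letting each stage last a
  whole number of units computed from the past keeps that measure in \<open>[4, 7)\<close>, and the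
  resulting bound on the probability of a stage does not depend on the past. The bounds that matter
  are uniform in the mesh, so they survive the limit along the grids.\<close>

lemma cadlag_local:
  assumes f: "cadlag_no_positive_jumps f" and e: "0 < e" and u: "0 \<le> u"
  shows "\<exists>r>0. (\<forall>s t. 0 \<le> s \<and> s \<le> t \<and> \<bar>s - u\<bar> < r \<and> \<bar>t - u\<bar> < r \<longrightarrow> f t - f s \<le> e)
             \<and> (\<exists>B. \<forall>s. 0 \<le> s \<and> \<bar>s - u\<bar> < r \<longrightarrow> \<bar>f s\<bar> \<le> B)"
proof -
  have "(f \<longlongrightarrow> f u) (at_right u)"
    using f u by (auto simp: cadlag_no_positive_jumps_def)
  then have "eventually (\<lambda>v. dist (f v) (f u) < e/2) (at_right u)"
    using e by (intro tendstoD) auto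
  then obtain b where b: "u < b" "\<And>v. u < v \<Longrightarrow> v < b \<Longrightarrow> \<bar>f v - f u\<bar> < e/2"
    unfolding eventually_at_right_field dist_real_def by blast
  obtain a l where a: "a < u" "\<And>v. 0 \<le> v \<Longrightarrow> a < v \<Longrightarrow> v < u \<Longrightarrow> \<bar>f v - l\<bar> < e/2" "u > 0 \<Longrightarrow> f u \<le> l"
  proof (cases "u = 0")
    case True
    \<comment> \<open>At \<open>u = 0\<close> there is no left side: no admissible time lies
      strictly between \<open>-1\<close> and \<open>0\<close>, so both values are dummies.\<close>
    show thesis by (rule that[of "-1" 0]) (auto simp: True)
  next
    case False
    then obtain l where l: "(f \<longlongrightarrow> l) (at_left u)" "f u \<le> l"
      using f u unfolding cadlag_no_positive_jumps_def by (metis order_le_less)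
    have "eventually (\<lambda>v. dist (f v) l < e/2) (at_left u)"
      using l e by (intro tendstoD) auto
    then obtain a where "a < u" "\<And>v. a < v \<Longrightarrow> v < u \<Longrightarrow> \<bar>f v - l\<bar> < e/2"
      unfolding eventually_at_left_field dist_real_def by blast
    with l show thesis by (intro that[of a l]) auto
  qed
  define r where "r = min (b - u) (u - a)"
  have "f t - f s \<le> e" if "0 \<le> s" "s \<le> t" "\<bar>s - u\<bar> < r" "\<bar>t - u\<bar> < r" for s t
  proof -
    have 1: "t < b" "a < s" using that by (auto simp: r_def)
    \<comment> \<open>On either side of \<open>u\<close> the values lie within \<open>e/2\<close> of
      a single number, \<open>l\<close> or \<open>f u\<close>. Passing from left to right adds only
      \<open>f u - l\<close>, which is at most 0.\<close>
    consider "u \<le> s" | "s < u" "t < u" | "s < u" "u \<le> t" by linarith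
    then show ?thesis
    proof cases
      case 1
      have "\<bar>f s - f u\<bar> < e/2" using b(2)[of s] 1 \<open>t < b\<close> \<open>s \<le> t\<close> e by (cases "s = u") auto
      moreover have "\<bar>f t - f u\<bar> < e/2" using b(2)[of t] 1 \<open>t < b\<close> \<open>s \<le> t\<close> e by (cases "t = u") auto
      ultimately show ?thesis by linarith
    next
      case 2
      have "\<bar>f s - l\<bar> < e/2" "\<bar>f t - l\<bar> < e/2" using a(2)[of s] a(2)[of t] 2 that 1 by auto
      then show ?thesis by linarith
    next
      case 3
      have "\<bar>f s - l\<bar> < e/2" using a(2)[of s] 3 that 1 by auto
      moreover have "\<bar>f t - f u\<bar> < e/2" using b(2)[of t] 3 1 e by (cases "t = u") auto
      moreover have "f u \<le> l" using a(3) 3 that by auto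
      ultimately show ?thesis by linarith
    qed
  qed
  moreover have "\<bar>f s\<bar> \<le> \<bar>f u\<bar> + \<bar>l\<bar> + e" if "0 \<le> s" "\<bar>s - u\<bar> < r" for s
  proof -
    have 1: "s < b" "a < s" using that by (auto simp: r_def)
    have "s = u \<or> \<bar>f s - f u\<bar> < e/2 \<or> \<bar>f s - l\<bar> < e/2"
      using b(2)[of s] a(2)[of s] 1 that by linarith
    then show ?thesis using e by (elim disjE, simp, linarith+)
  qed
  moreover have "r > 0" using a b by (auto simp: r_def)
  ultimately show ?thesis by blast
qed

text \<open>One-sided uniform continuity: falls may be jumps, rises may not. \<open>d\<close> is a
  Lebesgue number of the cover by the balls from \<open>cadlag_local\<close>.\<close>

lemma cadlag_small_rise:
  assumes f: "cadlag_no_positive_jumps f" and e: "0 < e"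
  shows "\<exists>d>0. \<forall>s t. 0 \<le> s \<and> s \<le> t \<and> t \<le> T \<and> t - s < d \<longrightarrow> f t - f s \<le> e"
proof -
  obtain r where r: "\<And>u. 0 \<le> u \<Longrightarrow> r u > 0"
    "\<And>u s t. \<lbrakk>0 \<le> u; 0 \<le> s; s \<le> t; \<bar>s - u\<bar> < r u; \<bar>t - u\<bar> < r u\<rbrakk> \<Longrightarrow> f t - f s \<le> e"
    using cadlag_local[OF f e] by metis
  have "{0..T} \<subseteq> \<Union>((\<lambda>u. ball u (r u)) ` {0..T})"
    using r(1) by force
  then obtain d where d: "d > 0" "\<And>x. x \<in> {0..T} \<Longrightarrow> \<exists>G\<in>(\<lambda>u. ball u (r u)) ` {0..T}. ball x d \<subseteq> G"
    by (rule Heine_Borel_lemma[OF compact_Icc]) auto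
  have "f t - f s \<le> e" if st: "0 \<le> s" "s \<le> t" "t \<le> T" "t - s < d" for s t
  proof -
    obtain u where u: "u \<in> {0..T}" "ball s d \<subseteq> ball u (r u)" using d(2)[of s] st by auto
    have "s \<in> ball s d" "t \<in> ball s d" using d st by (auto simp: dist_real_def)
    then have "s \<in> ball u (r u)" "t \<in> ball u (r u)" using u by blast+
    then show ?thesis using r(2)[of u s t] u st by (auto simp: dist_real_def abs_minus_commute)
  qed
  then show ?thesis using d by blast
qed

lemma cadlag_bounded:
  assumes f: "cadlag_no_positive_jumps f"
  shows "\<exists>B. \<forall>s\<in>{0..T}. \<bar>f s\<bar> \<le> B"
proof (cases "0 \<le> T")
  case False
  then show ?thesis by auto
next
  case T: True
  define P where "P a b \<longleftrightarrow> (\<exists>B. \<forall>s. 0 \<le> s \<and> a \<le> s \<and> s \<le> b \<longrightarrow> \<bar>f s\<bar> \<le> B)" for a b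
  have "P 0 T"
  proof (rule Bolzano[OF T])
    fix a b c :: real assume "P a b" "P b c"
    then obtain B C where "\<And>s. 0 \<le> s \<and> a \<le> s \<and> s \<le> b \<Longrightarrow> \<bar>f s\<bar> \<le> B"
      "\<And>s. 0 \<le> s \<and> b \<le> s \<and> s \<le> c \<Longrightarrow> \<bar>f s\<bar> \<le> C" unfolding P_def by blast
    then show "P a c" unfolding P_def by (intro exI[of _ "max B C"]) (metis linorder_le_cases max.coboundedI1 max.coboundedI2)
  next
    fix u :: real assume "0 \<le> u"
    then obtain r B where "r > 0" "\<And>s. 0 \<le> s \<and> \<bar>s - u\<bar> < r \<Longrightarrow> \<bar>f s\<bar> \<le> B"
      using cadlag_local[OF f zero_less_one, of u] by blast
    then show "\<exists>d>0. \<forall>a b. a \<le> u \<and> u \<le> b \<and> b - a < d \<longrightarrow> P a b"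
      unfolding P_def by (intro exI[of _ r]) (auto intro!: exI[of _ B])
  qed
  then show ?thesis unfolding P_def by (metis atLeastAtMost_iff)
qed

lemma cadlag_right_tendsto:
  assumes f: "cadlag_no_positive_jumps f" and u: "0 \<le> u"
    and v: "v \<longlonglongrightarrow> u" "\<And>n. u \<le> v n"
  shows "(\<lambda>n. f (v n)) \<longlonglongrightarrow> f u"
proof -
  have "(f \<longlongrightarrow> f u) (at_right u)"
    using f u by (auto simp: cadlag_no_positive_jumps_def)
  then have "continuous (at_right u) f" by (simp add: continuous_within)
  then have "continuous (at u within {u..}) f"
    by (simp add: continuous_within at_within_Ici_at_right)
  then show ?thesis
    by (rule continuous_within_tendsto_compose') (use v in auto)
qed

section \<open>The running supremum of a path\<close>

definition path_sup :: "(real \<Rightarrow> real) \<Rightarrow> real \<Rightarrow> real" where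
  "path_sup f t = (SUP s\<in>{0..t}. f s)"

lemma running_sup_eq: "running_sup X t \<omega> = path_sup (\<lambda>s. X s \<omega>) t"
  by (simp add: running_sup_def path_sup_def)

context
  fixes f :: "real \<Rightarrow> real"
  assumes f: "cadlag_no_positive_jumps f"
begin

lemma path_sup_bdd: "bdd_above (f ` {0..t})"
  using cadlag_bounded[OF f, of t] by (auto simp: bdd_above_def abs_le_iff)

lemma path_le_sup: "0 \<le> s \<Longrightarrow> s \<le> t \<Longrightarrow> f s \<le> path_sup f t"
  unfolding path_sup_def by (rule cSUP_upper[OF _ path_sup_bdd]) auto

lemma path_sup_le_iff: "0 \<le> t \<Longrightarrow> path_sup f t \<le> c \<longleftrightarrow> (\<forall>s\<in>{0..t}. f s \<le> c)"
  unfolding path_sup_def by (subst cSUP_le_iff) (auto simp: path_sup_bdd)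

lemma path_sup_mono: "0 \<le> s \<Longrightarrow> s \<le> t \<Longrightarrow> path_sup f s \<le> path_sup f t"
  by (subst path_sup_le_iff) (auto intro: path_le_sup)

lemma path_sup_0: "path_sup f 0 = f 0"
  by (simp add: path_sup_def)

text \<open>The supremum grows only where \<open>f\<close> rises above its earlier values, so the
  uniform bound on the rises of \<open>f\<close> is a modulus of continuity for the
  supremum.\<close>

lemma path_sup_continuous: "continuous_on {0..} (path_sup f)"
  unfolding continuous_on_iff
proof (intro ballI allI impI)
  fix u e :: real assume u: "u \<in> {0..}" and e: "e > 0"
  obtain d where d: "d > 0" "\<And>s t. 0 \<le> s \<and> s \<le> t \<and> t \<le> u + 1 \<and> t - s < d \<Longrightarrow> f t - f s \<le> e/2"
    using cadlag_small_rise[OF f, of "e/2" "u+1"] e by (metis half_gt_zero)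
  have rise: "path_sup f t - path_sup f s \<le> e/2" if "0 \<le> s" "s \<le> t" "t \<le> u + 1" "t - s < d" for s t
  proof -
    have "path_sup f t \<le> path_sup f s + e/2"
    proof (subst path_sup_le_iff, use that in simp, intro ballI)
      fix r assume r: "r \<in> {0..t}"
      show "f r \<le> path_sup f s + e/2"
      proof (cases "r \<le> s")
        case True
        then show ?thesis using path_le_sup[of r s] r e by auto
      next
        case False
        then have "f r - f s \<le> e/2" using r that by (intro d(2)) auto
        then show ?thesis using path_le_sup[of s s] that by auto
      qed
    qed
    then show ?thesis by simp
  qed
  show "\<exists>d>0. \<forall>v\<in>{0..}. dist v u < d \<longrightarrow> dist (path_sup f v) (path_sup f u) < e"
  proof (intro exI[of _ "min d 1"] conjI ballI impI)
    fix v assume v: "v \<in> {0..}" "dist v u < min d 1"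
    show "dist (path_sup f v) (path_sup f u) < e"
    proof (cases "v \<le> u")
      case True
      then show ?thesis using rise[of v u] path_sup_mono[of v u] v u e by (auto simp: dist_real_def)
    next
      case False
      then show ?thesis using rise[of u v] path_sup_mono[of u v] v u e by (auto simp: dist_real_def)
    qed
  qed (use d in auto)
qed

end

section \<open>The perturbed process as a function of the running supremum\<close>

lemma stieltjes_continuous_substitution:
  fixes g \<phi> :: "real \<Rightarrow> real"
  assumes g: "continuous_on {0..} g" and mono: "\<And>s t. 0 \<le> s \<Longrightarrow> s \<le> t \<Longrightarrow> g s \<le> g t"
    and \<phi>: "continuous_on {g 0..} \<phi>" and t: "0 \<le> t"
  shows "(LINT u:{0<..t}|interval_measure (\<lambda>u. g (max 0 u)). \<phi> (g u)) = integral {g 0..g t} \<phi>"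
proof -
  define G where "G u = g (max 0 u)" for u
  \<comment> \<open>Clamping the argument at \<open>g 0\<close> extends \<open>\<phi>\<close>
    continuously to the whole line.\<close>
  define \<psi> where "\<psi> y = \<phi> (max (g 0) y)" for y
  have contG: "continuous_on UNIV G"
    unfolding G_def by (intro continuous_on_compose2[OF g] continuous_intros) auto
  have cont\<psi>: "continuous_on UNIV \<psi>"
    unfolding \<psi>_def by (intro continuous_on_compose2[OF \<phi>] continuous_intros) auto
  have monoG: "G u \<le> G v" if "u \<le> v" for u v
    unfolding G_def using that by (intro mono) auto
  have rcG: "continuous (at_right a) G" for a
    using contG by (auto simp: continuous_on_eq_continuous_at intro: continuous_at_imp_continuous_at_within)
  let ?\<mu> = "interval_measure G"
  have Ioc: "emeasure ?\<mu> {a<..b} = ennreal (G b - G a)" if "a \<le> b" for a b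
    by (rule emeasure_interval_measure_Ioc[OF that monoG rcG])
  have [measurable]: "G \<in> borel_measurable borel" "\<psi> \<in> borel_measurable borel"
    using contG cont\<psi> by (auto intro: borel_measurable_continuous_onI)
  \<comment> \<open>The image of \<open>dG\<close> on \<open>{0<..t}\<close> under \<open>G\<close>
    is Lebesgue measure on \<open>{G 0<..G t}\<close>: stretches where \<open>G\<close> is constant
    carry no mass, and continuity of \<open>G\<close> leaves no gaps. Both measures are compared on
    the half-lines \<open>{x<..}\<close>.\<close>
  define N1 where "N1 = distr (density ?\<mu> (indicator {0<..t})) borel G"
  define N2 where "N2 = density lborel (indicator {G 0<..G t})"
  have N1: "emeasure N1 {x<..} = emeasure ?\<mu> {u\<in>{0<..t}. x < G u}" for x
  proof -
    have [measurable]: "G -` {x<..} \<in> sets borel"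
      using measurable_sets[of G borel borel "{x<..}"] by simp
    have "emeasure N1 {x<..} = emeasure (density ?\<mu> (indicator {0<..t})) (G -` {x<..})"
      unfolding N1_def by (subst emeasure_distr) auto
    also have "\<dots> = (\<integral>\<^sup>+u. indicator {u\<in>{0<..t}. x < G u} u \<partial>?\<mu>)"
      by (subst emeasure_density) (auto simp del: nn_integral_indicator simp: indicator_def intro!: nn_integral_cong)
    also have "\<dots> = emeasure ?\<mu> {u\<in>{0<..t}. x < G u}"
      by (rule nn_integral_indicator) simp
    finally show ?thesis .
  qed
  have N2: "emeasure N2 {x<..} = ennreal (max 0 (G t - max (G 0) x))" for x
  proof -
    have "emeasure N2 {x<..} = (\<integral>\<^sup>+u. indicator ({max (G 0) x<..G t}) u \<partial>lborel)"
      unfolding N2_def by (subst emeasure_density) (auto simp del: nn_integral_indicator simp: indicator_def intro!: nn_integral_cong)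
    also have "\<dots> = emeasure lborel {max (G 0) x<..G t}"
      by (rule nn_integral_indicator) simp
    also have "\<dots> = ennreal (max 0 (G t - max (G 0) x))"
      by (cases "max (G 0) x \<le> G t") (auto simp: max_def)
    finally show ?thesis .
  qed
  have eq: "emeasure N1 {x<..} = emeasure N2 {x<..}" for x
  proof -
    consider "x < G 0" | "G t \<le> x" | "G 0 \<le> x" "x < G t" by linarith
    then show ?thesis
    proof cases
      case 1
      have "{u\<in>{0<..t}. x < G u} = {0<..t}"
        using 1 monoG[of 0] by (force intro: less_le_trans)
      then show ?thesis using 1 t monoG[of 0 t] unfolding N1 N2 by (simp add: Ioc max_def)
    next
      case 2
      have s: "{u\<in>{0<..t}. x < G u} = {}"
        using 2 monoG[of _ t] by (force simp: not_less intro: order_trans)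
      show ?thesis using 2 monoG[of 0 t] t unfolding N1 N2 s by (simp add: max_def)
    next
      case 3
      \<comment> \<open>\<open>Sup K\<close> is the last time at which \<open>G\<close> is at most
        \<open>x\<close>. There \<open>G\<close> equals \<open>x\<close> by the intermediate value
        theorem and maximality, so the mass beyond it is exactly \<open>G t - x\<close>.\<close>
      define K where "K = {u\<in>{0..t}. G u \<le> x}"
      have "K = {0..t} \<inter> {u. G u \<le> x}" by (auto simp: K_def)
      then have "closed K" by (auto intro: closed_Collect_le[OF contG continuous_on_const])
      moreover have "0 \<in> K" "bdd_above K" using 3 t by (auto simp: K_def)
      ultimately have u1: "Sup K \<in> K" by (intro closed_contains_Sup) auto
      define w where "w = Sup K"
      have w: "0 \<le> w" "w \<le> t" "G w \<le> x" using u1 by (auto simp: K_def w_def)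
      have wmax: "v \<le> w" if "v \<in> K" for v unfolding w_def
        by (rule cSup_upper[OF that]) (use \<open>bdd_above K\<close> in simp)
      have "G w = x"
      proof (rule ccontr)
        assume "G w \<noteq> x"
        obtain v where v: "w \<le> v" "v \<le> t" "G v = x"
          using IVT'[of G w x t] w 3 contG by (auto intro: continuous_on_subset)
        then have "v \<in> K" using w by (auto simp: K_def)
        then have "v = w" using wmax v by force
        with v \<open>G w \<noteq> x\<close> show False by simp
      qed
      have "{u\<in>{0<..t}. x < G u} = {w<..t}"
      proof (intro set_eqI iffI)
        fix u assume "u \<in> {u\<in>{0<..t}. x < G u}"
        then show "u \<in> {w<..t}" using monoG[of u w] \<open>G w = x\<close> by (auto simp: not_le[symmetric])
      next
        fix u assume u: "u \<in> {w<..t}"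
        have "\<not> G u \<le> x" using wmax[of u] u w by (auto simp: K_def)
        then show "u \<in> {u\<in>{0<..t}. x < G u}" using u w by auto
      qed
      then show ?thesis using 3 w \<open>G w = x\<close> unfolding N1 N2 by (simp add: Ioc max_def)
    qed
  qed
  have "N1 = N2"
  proof (rule measure_eqI_lessThan)
    fix x show "emeasure N1 {x<..} < \<infinity>" unfolding eq N2 by simp
    show "emeasure N1 {x<..} = emeasure N2 {x<..}" by (rule eq)
  qed (simp_all add: N1_def N2_def)
  have "(LINT u:{0<..t}|?\<mu>. \<phi> (g u)) = (LINT u|?\<mu>. indicator {0<..t} u *\<^sub>R \<psi> (G u))"
    unfolding set_lebesgue_integral_def
    by (intro Bochner_Integration.integral_cong) (auto simp: indicator_def G_def \<psi>_def mono max_absorb2)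
  also have "\<dots> = (LINT u|density ?\<mu> (\<lambda>u. ennreal (indicator {0<..t} u)). \<psi> (G u))"
    by (rule integral_density[symmetric]) auto
  also have "(\<lambda>u. ennreal (indicator {0<..t} u)) = indicator {0<..t}"
    by (auto simp: fun_eq_iff indicator_def)
  also have "(LINT u|density ?\<mu> (indicator {0<..t}). \<psi> (G u)) = (LINT y|N1. \<psi> y)"
    unfolding N1_def by (subst integral_distr) auto
  also have "\<dots> = (LINT y|density lborel (\<lambda>y. ennreal (indicator {G 0<..G t} y)). \<psi> y)"
    unfolding \<open>N1 = N2\<close> N2_def by (intro arg_cong2[of _ _ _ _ lebesgue_integral] refl arg_cong2[of _ _ _ _ density]) (auto simp: fun_eq_iff indicator_def)
  also have "\<dots> = (LINT y|lborel. indicator {G 0<..G t} y *\<^sub>R \<psi> y)"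
    by (rule integral_density) auto
  also have "\<dots> = (LINT y:{G 0..G t}|lborel. \<psi> y)"
    unfolding set_lebesgue_integral_def
  proof (rule integral_cong_AE)
    show "AE y in lborel. indicat_real {G 0<..G t} y *\<^sub>R \<psi> y = indicat_real {G 0..G t} y *\<^sub>R \<psi> y"
      using AE_lborel_singleton[of "G 0"] by eventually_elim (auto simp: indicator_def)
  qed auto
  also have "\<dots> = integral {G 0..G t} \<psi>"
    by (rule set_borel_integral_eq_integral(2)) (auto intro!: borel_integrable_atLeastAtMost' continuous_on_subset[OF cont\<psi>])
  also have "\<dots> = integral {G 0..G t} \<phi>"
    by (rule Henstock_Kurzweil_Integration.integral_cong) (auto simp: G_def \<psi>_def max_absorb2)
  also have "\<dots> = integral {g 0..g t} \<phi>"
    using t by (simp add: G_def max_absorb2)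
  finally show ?thesis unfolding G_def .
qed

text \<open>The substitution yields an integral over the levels from \<open>S 0\<close> on, whereas
  \<open>gamma_bar\<close> integrates from \<open>x\<close>; this is why the path has to start at
  \<open>x\<close>.\<close>

lemma perturbed_eq:
  assumes f: "cadlag_no_positive_jumps (\<lambda>t. X t \<omega>)" and x: "0 < x" "X 0 \<omega> = x"
    and \<gamma>: "continuous_on {0..} \<gamma>" and t: "0 \<le> t"
  shows "perturbed \<gamma> X t \<omega> = gamma_bar \<gamma> x (running_sup X t \<omega>) - (running_sup X t \<omega> - X t \<omega>)"
proof -
  define g where "g = path_sup (\<lambda>t. X t \<omega>)"
  have g0: "g 0 = x" using x by (simp add: g_def path_sup_0[OF f])
  have "(LINT u:{0<..t}|interval_measure (\<lambda>u. g (max 0 u)). \<gamma> (g u)) = integral {g 0..g t} \<gamma>"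
    using path_sup_continuous[OF f] path_sup_mono[OF f] t x g0 unfolding g_def
    by (intro stieltjes_continuous_substitution) (auto intro: continuous_on_subset[OF \<gamma>])
  then show ?thesis using g0
    unfolding perturbed_def gamma_bar_def running_sup_eq g_def[symmetric] by simp
qed

text \<open>\<open>gamma_bar\<close> has derivative \<open>1 - \<gamma>\<close>, and on the compact
  interval from \<open>x\<close> to \<open>a\<close> the function \<open>\<gamma> - 1\<close> has a
  positive minimum \<open>c\<close> and a maximum \<open>C\<close>. The bound with \<open>C\<close>
  limits the drawdown of a path that is not yet ruined; the bound with \<open>c\<close> tells which
  drawdowns are certainly free of ruin.\<close>

lemma gamma_bar_props:
  assumes x: "0 < x" and \<gamma>: "continuous_on {0..} \<gamma>" and \<gamma>1: "\<gamma> ` {0..} \<subseteq> {1<..}"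
    and fin: "a_star \<gamma> x < \<infinity>"
  obtains a c C where "a_star \<gamma> x = ereal a" "x < a" "0 < c" "c \<le> C"
    "\<And>s. x \<le> s \<Longrightarrow> s \<le> a \<Longrightarrow> c * (a - s) \<le> gamma_bar \<gamma> x s \<and> gamma_bar \<gamma> x s \<le> C * (a - s)"
    "\<And>s. a \<le> s \<Longrightarrow> gamma_bar \<gamma> x s \<le> 0"
    "\<And>s. a < s \<Longrightarrow> gamma_bar \<gamma> x s < 0"
    "continuous_on {x..} (gamma_bar \<gamma> x)"
proof -
  let ?g = "gamma_bar \<gamma> x"
  have int: "\<gamma> integrable_on {s..t}" if "x \<le> s" for s t
    using that x by (intro integrable_continuous_interval continuous_on_subset[OF \<gamma>]) auto
  have diff: "?g s - ?g t = integral {s..t} \<gamma> - (t - s)" if "x \<le> s" "s \<le> t" for s t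
    using Henstock_Kurzweil_Integration.integral_combine[of x s t \<gamma>] int[of x t] that
    by (auto simp: gamma_bar_def)
  have gbounds: "\<exists>c C. 0 < c \<and> c \<le> C \<and> (\<forall>u v. s \<le> u \<and> u \<le> v \<and> v \<le> t \<longrightarrow>
      c * (v - u) \<le> ?g u - ?g v \<and> ?g u - ?g v \<le> C * (v - u))" if st: "x \<le> s" "s \<le> t" for s t
  proof -
    have cont: "continuous_on {s..t} \<gamma>" using st x by (intro continuous_on_subset[OF \<gamma>]) auto
    obtain p where p: "p \<in> {s..t}" "\<And>y. y \<in> {s..t} \<Longrightarrow> \<gamma> p \<le> \<gamma> y"
      using continuous_attains_inf[OF compact_Icc _ cont] st by auto
    obtain q where q: "q \<in> {s..t}" "\<And>y. y \<in> {s..t} \<Longrightarrow> \<gamma> y \<le> \<gamma> q"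
      using continuous_attains_sup[OF compact_Icc _ cont] st by auto
    have "(\<gamma> p - 1) * (v - u) \<le> ?g u - ?g v \<and> ?g u - ?g v \<le> (\<gamma> q - 1) * (v - u)"
      if uv: "s \<le> u" "u \<le> v" "v \<le> t" for u v
    proof -
      have "integral {u..v} (\<lambda>_. \<gamma> p) \<le> integral {u..v} \<gamma>"
        using uv st by (intro integral_le int p) auto
      moreover have "integral {u..v} \<gamma> \<le> integral {u..v} (\<lambda>_. \<gamma> q)"
        using uv st by (intro integral_le int q) auto
      ultimately show ?thesis using diff[of u v] uv st by (simp add: algebra_simps)
    qed
    moreover have "\<gamma> p > 1" using p(1) \<gamma>1 st x by (auto simp: subset_eq)
    ultimately show ?thesis using q(2)[OF p(1)]
      by (intro exI[of _ "\<gamma> p - 1"] exI[of _ "\<gamma> q - 1"]) auto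
  qed
  have strict: "?g t < ?g s" if st: "x \<le> s" "s < t" for s t
  proof -
    obtain c C where "0 < c" "\<forall>u v. s \<le> u \<and> u \<le> v \<and> v \<le> t \<longrightarrow>
      c * (v - u) \<le> ?g u - ?g v \<and> ?g u - ?g v \<le> C * (v - u)"
      using gbounds[of s t] st by auto
    then have "c * (t - s) \<le> ?g s - ?g t" "0 < c * (t - s)" using st by auto
    then show ?thesis by linarith
  qed
  have cont': "continuous_on {x..t} ?g" for t
    unfolding gamma_bar_def by (intro continuous_intros indefinite_integral_continuous_1 int) auto
  have cont: "continuous_on {x..} ?g"
    unfolding continuous_on_eq_continuous_within
  proof
    fix s assume s: "s \<in> {x..}"
    have "continuous (at s within {x..s+1}) ?g"
      using cont'[of "s+1"] s unfolding continuous_on_eq_continuous_within by auto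
    moreover have "at s within {x..s+1} = at s within {x..}"
      by (rule at_within_nhd[of _ "{..<s+1}"]) (use s in auto)
    ultimately show "continuous (at s within {x..}) ?g" by (simp add: continuous_within)
  qed
  have gx: "?g x = x" by (simp add: gamma_bar_def)
  have "{s \<in> {x..}. ?g s < 0} \<noteq> {}"
  proof
    assume e: "{s \<in> {x..}. ?g s < 0} = {}"
    have "a_star \<gamma> x = \<infinity>" unfolding a_star_def e by (simp add: top_ereal_def)
    with fin show False by simp
  qed
  then obtain b where b: "x \<le> b" "?g b < 0" by auto
  \<comment> \<open>\<open>gamma_bar\<close> equals \<open>x > 0\<close> at \<open>x\<close> and is
    negative at \<open>b\<close>, so it vanishes in between; being strictly decreasing, it is
    negative exactly beyond this zero.\<close>
  obtain a where a: "x \<le> a" "a \<le> b" "?g a = 0"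
    using IVT2'[of ?g b 0 x] b cont' gx x by auto
  have xa: "x < a" using a gx x by (cases "x = a") auto
  have "{s \<in> {x..}. ?g s < 0} = {a<..}"
  proof (intro set_eqI iffI)
    fix s assume "s \<in> {s \<in> {x..}. ?g s < 0}"
    then have "x \<le> s" "?g s < 0" by auto
    then show "s \<in> {a<..}" using strict[of s a] a by (cases "s = a") force+
  next
    fix s assume "s \<in> {a<..}"
    then show "s \<in> {s \<in> {x..}. ?g s < 0}" using strict[of a s] a by auto
  qed
  then have "a_star \<gamma> x = Inf (ereal ` {a<..})" by (simp add: a_star_def)
  also have "\<dots> = ereal a"
  proof (rule antisym)
    show "ereal a \<le> Inf (ereal ` {a<..})" by (intro Inf_greatest) auto
    show "Inf (ereal ` {a<..}) \<le> ereal a"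
    proof (rule dense_ge)
      fix y assume "ereal a < y"
      then obtain z where z: "a < z" "ereal z \<le> y"
        by (cases y) (auto intro: that[of "a+1"])
      then show "Inf (ereal ` {a<..}) \<le> y" by (intro Inf_lower2[of "ereal z"]) auto
    qed
  qed
  finally have as: "a_star \<gamma> x = ereal a" .
  obtain c C where cC: "0 < c" "c \<le> C" "\<forall>u v. x \<le> u \<and> u \<le> v \<and> v \<le> a \<longrightarrow>
      c * (v - u) \<le> ?g u - ?g v \<and> ?g u - ?g v \<le> C * (v - u)"
    using gbounds[of x a] a by auto
  show thesis
  proof (rule that[OF as xa cC(1,2) _ _ _ cont])
    fix s assume "x \<le> s" "s \<le> a"
    then show "c * (a - s) \<le> ?g s \<and> ?g s \<le> C * (a - s)" using cC(3) a by force
  next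
    fix s assume "a \<le> s"
    then show "?g s \<le> 0" using strict[of a s] a by (cases "s = a") auto
  next
    fix s assume "a < s"
    then show "?g s < 0" using strict[of a s] a by auto
  qed
qed

section \<open>Approximation along dyadic grids\<close>

lemma grid_above:
  fixes s h :: real
  assumes "0 \<le> s" "0 < h"
  defines "v \<equiv> \<lambda>K. nat \<lceil>s * 2^K / h\<rceil>"
  shows "s \<le> real (v K) * (h / 2^K)" "real (v K) * (h / 2^K) < s + h / 2^K"
    "(\<lambda>K. real (v K) * (h / 2^K)) \<longlonglongrightarrow> s"
proof -
  have v: "real (v K) = of_int \<lceil>s * 2^K / h\<rceil>" for K
    unfolding v_def using assms(1,2) by simp
  have "s * 2^K / h \<le> real (v K)" "real (v K) < s * 2^K / h + 1" for K
    unfolding v by linarith+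
  then show 1: "s \<le> real (v K) * (h / 2^K)" and 2: "real (v K) * (h / 2^K) < s + h / 2^K" for K
    using assms(2) by (auto simp: field_simps)
  have "(\<lambda>K. s + h / 2^K) \<longlonglongrightarrow> s + 0"
    by (intro tendsto_add tendsto_const LIMSEQ_divide_realpow_zero) simp
  then show "(\<lambda>K. real (v K) * (h / 2^K)) \<longlonglongrightarrow> s"
    using tendsto_sandwich[OF always_eventually[OF allI] always_eventually[OF allI], of "\<lambda>_. s"
        "\<lambda>K. real (v K) * (h / 2^K)" "\<lambda>K. s + h / 2^K" s sequentially, OF 1 less_imp_le[OF 2] tendsto_const] by simp
qed

text \<open>Upward variation suffices because \<open>|y| = 2 * max 0 y - y\<close> and the terms
  \<open>y\<close> telescope. An arbitrary partition is moved to the grid by rounding its points up,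
  and right-continuity lets the mesh tend to 0.\<close>

lemma grid_variation_imp_bounded_variation:
  assumes f: "cadlag_no_positive_jumps f"
    and C: "\<And>T::nat. \<exists>C. \<forall>K. (\<Sum>i<T * 2^K. max 0 (f (real (Suc i) / 2^K) - f (real i / 2^K))) \<le> C"
    and ab: "0 \<le> a" "a \<le> b"
  shows "bounded_variation_on_Icc a b f"
proof -
  define T where "T = nat \<lceil>b\<rceil>"
  obtain C where C: "\<And>K. (\<Sum>i<T * 2^K. max 0 (f (real (Suc i) / 2^K) - f (real i / 2^K))) \<le> C"
    using assms(2)[of T] by auto
  have abs: "(\<Sum>i<T * 2^K. \<bar>f (real (Suc i) / 2^K) - f (real i / 2^K)\<bar>) \<le> 2 * C - (f T - f 0)" for K
  proof -
    have "(\<Sum>i<T * 2^K. \<bar>f (real (Suc i) / 2^K) - f (real i / 2^K)\<bar>)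
        = (\<Sum>i<T * 2^K. 2 * max 0 (f (real (Suc i) / 2^K) - f (real i / 2^K)) - (f (real (Suc i) / 2^K) - f (real i / 2^K)))"
      by (intro sum.cong) (auto simp: max_def)
    also have "\<dots> = 2 * (\<Sum>i<T * 2^K. max 0 (f (real (Suc i) / 2^K) - f (real i / 2^K))) - (f (real (T * 2^K) / 2^K) - f (real 0 / 2^K))"
      by (subst sum_subtractf) (simp only: sum_distrib_left sum_lessThan_telescope[of "\<lambda>i. f (real i / 2^K)"])
    also have "\<dots> \<le> 2 * C - (f T - f 0)" using C[of K] by simp
    finally show ?thesis .
  qed
  have "(\<Sum>i<n. \<bar>f (\<tau> (Suc i)) - f (\<tau> i)\<bar>) \<le> 2 * C - (f T - f 0)"
    if \<tau>: "mono_on {..n} \<tau>" "\<tau> ` {..n} \<subseteq> {a..b}" for n \<tau>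
  proof -
    define j where "j K i = nat \<lceil>\<tau> i * 2^K\<rceil>" for K i
    have ti: "0 \<le> \<tau> i" "\<tau> i \<le> T" if "i \<le> n" for i
    proof -
      have "\<tau> i \<in> {a..b}" using \<tau>(2) that by blast
      then show "0 \<le> \<tau> i" "\<tau> i \<le> T" using ab real_nat_ceiling_ge[of b] unfolding T_def atLeastAtMost_iff by linarith+
    qed
    have jT: "j K i \<le> T * 2^K" if "i \<le> n" for K i
      unfolding j_def using ti(2)[OF that] by (simp add: nat_le_iff ceiling_le_iff)
    have jmono: "j K i \<le> j K (Suc i)" if "i < n" for K i
      unfolding j_def using mono_onD[OF \<tau>(1), of i "Suc i"] that by (intro nat_mono ceiling_mono) auto
    have lim: "(\<lambda>K. f (real (j K i) / 2^K)) \<longlonglongrightarrow> f (\<tau> i)" if "i \<le> n" for i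
    proof -
      have jg: "nat \<lceil>\<tau> i * 2^K / 1\<rceil> = j K i" "real (j K i) * (1 / 2^K) = real (j K i) / 2^K" for K
        by (simp_all add: j_def)
      show ?thesis
        using grid_above[OF ti(1)[OF that] zero_less_one] unfolding jg by (intro cadlag_right_tendsto[OF f ti(1)[OF that]])
    qed
    have "(\<lambda>K. \<Sum>i<n. \<bar>f (real (j K (Suc i)) / 2^K) - f (real (j K i) / 2^K)\<bar>)
        \<longlonglongrightarrow> (\<Sum>i<n. \<bar>f (\<tau> (Suc i)) - f (\<tau> i)\<bar>)"
      by (intro tendsto_sum tendsto_rabs tendsto_diff lim) auto
    moreover have "(\<Sum>i<n. \<bar>f (real (j K (Suc i)) / 2^K) - f (real (j K i) / 2^K)\<bar>) \<le> 2 * C - (f T - f 0)" for K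
    proof -
      define \<Delta> where "\<Delta> i = f (real (Suc i) / 2^K) - f (real i / 2^K)" for i
      \<comment> \<open>The variation along the grid up to the index \<open>m\<close>. Each
        increment over the partition is dominated by an increment of the monotone \<open>v\<close>,
        and those telescope.\<close>
      define v where "v m = (\<Sum>i<m. \<bar>\<Delta> i\<bar>)" for m
      have fv: "\<bar>f (real q / 2^K) - f (real p / 2^K)\<bar> \<le> v q - v p" if "p \<le> q" for p q
      proof -
        have "f (real q / 2^K) - f (real p / 2^K) = (\<Sum>i=p..<q. \<Delta> i)"
          unfolding \<Delta>_def using sum_Suc_diff'[OF that, of "\<lambda>i. f (real i / 2^K)"] by simp
        also have "\<bar>\<dots>\<bar> \<le> (\<Sum>i=p..<q. \<bar>\<Delta> i\<bar>)" by (rule sum_abs)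
        also have "\<dots> = v q - v p" unfolding v_def lessThan_atLeast0
          using sum_diff_nat_ivl[of 0 p q "\<lambda>i. \<bar>\<Delta> i\<bar>"] that by simp
        finally show ?thesis by simp
      qed
      have v0: "0 \<le> v p" for p by (simp add: v_def sum_nonneg)
      have vmono: "v p \<le> v q" if "p \<le> q" for p q
        using fv[OF that] by linarith
      have "(\<Sum>i<n. \<bar>f (real (j K (Suc i)) / 2^K) - f (real (j K i) / 2^K)\<bar>) \<le> (\<Sum>i<n. v (j K (Suc i)) - v (j K i))"
        by (intro sum_mono fv jmono) auto
      also have "\<dots> = v (j K n) - v (j K 0)" by (rule sum_lessThan_telescope)
      also have "\<dots> \<le> v (T * 2^K)" using vmono[OF jT[of n K]] v0[of "j K 0"] by simp
      also have "\<dots> \<le> 2 * C - (f T - f 0)" unfolding v_def \<Delta>_def by (rule abs)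
      finally show ?thesis .
    qed
    ultimately show ?thesis by (intro LIMSEQ_le_const2) auto
  qed
  then show ?thesis unfolding bounded_variation_on_Icc_def by blast
qed

section \<open>Reduction to rational times and measurability of the creeping event\<close>

lemma rat_seq_above:
  fixes s t :: real
  assumes "s < t"
  obtains q where "\<And>n. q n \<in> \<rat>" "\<And>n. s < q n" "\<And>n. q n < t" "q \<longlonglongrightarrow> s"
proof -
  have "\<exists>q\<in>\<rat>. s < q \<and> q < min t (s + 1 / Suc n)" for n
    using Rats_dense_in_real[of s "min t (s + 1 / Suc n)"] assms by auto
  then obtain q where q: "\<And>n. q n \<in> \<rat>" "\<And>n. s < q n" "\<And>n. q n < min t (s + 1 / Suc n)" by metis
  have "(\<lambda>n. s + 1 / Suc n) \<longlonglongrightarrow> s + 0"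
    by (intro tendsto_intros LIMSEQ_Suc[OF lim_1_over_n])
  then have "q \<longlonglongrightarrow> s"
    using q by (intro tendsto_sandwich[OF _ _ tendsto_const, of s q _ "\<lambda>n. s + 1 / Suc n"])
       (auto intro!: always_eventually less_imp_le)
  with q show thesis by (intro that) auto
qed

text \<open>Every \<open>s < t\<close> is a limit of rational times to its right within the
  interval, where right-continuity applies. The endpoint \<open>t\<close> has no such times and is
  listed separately.\<close>

lemma path_sup_le_dense_iff:
  assumes f: "cadlag_no_positive_jumps f" and t: "0 \<le> t"
  shows "path_sup f t \<le> c \<longleftrightarrow> (\<forall>q\<in>\<rat>. 0 \<le> q \<and> q \<le> t \<longrightarrow> f q \<le> c) \<and> f t \<le> c"
proof
  assume "path_sup f t \<le> c"
  then show "(\<forall>q\<in>\<rat>. 0 \<le> q \<and> q \<le> t \<longrightarrow> f q \<le> c) \<and> f t \<le> c"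
    using t by (auto simp: path_sup_le_iff[OF f t])
next
  assume *: "(\<forall>q\<in>\<rat>. 0 \<le> q \<and> q \<le> t \<longrightarrow> f q \<le> c) \<and> f t \<le> c"
  show "path_sup f t \<le> c"
    unfolding path_sup_le_iff[OF f t]
  proof
    fix s assume s: "s \<in> {0..t}"
    show "f s \<le> c"
    proof (cases "s = t")
      case False
      with s have "s < t" by auto
      obtain q where q: "\<And>n. q n \<in> \<rat>" "\<And>n. s < q n" "\<And>n. q n < t" "q \<longlonglongrightarrow> s"
        by (rule rat_seq_above[OF \<open>s < t\<close>]) blast
      then have "(\<lambda>n. f (q n)) \<longlonglongrightarrow> f s"
        using q s by (intro cadlag_right_tendsto[OF f]) (auto intro: less_imp_le)
      moreover have "f (q n) \<le> c" for n
        using * q(1)[of n] q(2)[of n] q(3)[of n] s by auto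
      ultimately show ?thesis by (intro LIMSEQ_le_const2) auto
    qed (use * in simp)
  qed
qed

lemma pred_countable_Ball:
  assumes "countable A" "\<And>i. i \<in> A \<Longrightarrow> Measurable.pred M (P i)"
  shows "Measurable.pred M (\<lambda>x. \<forall>i\<in>A. P i x)"
proof (cases "A = {}")
  case False
  have "(\<forall>i\<in>A. P i x) \<longleftrightarrow> (\<forall>n. P (from_nat_into A n) x)" for x
    using from_nat_into[OF False] from_nat_into_surj[OF assms(1)] by metis
  then show ?thesis using assms(2)[OF from_nat_into[OF False]] by (simp only:) measurable
qed simp

lemma pred_countable_Bex:
  assumes "countable A" "\<And>i. i \<in> A \<Longrightarrow> Measurable.pred M (P i)"
  shows "Measurable.pred M (\<lambda>x. \<exists>i\<in>A. P i x)"
proof -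
  have "Measurable.pred M (\<lambda>x. \<not> (\<forall>i\<in>A. \<not> P i x))"
    by (intro pred_intros_logic pred_countable_Ball assms)
  then show ?thesis by simp
qed

context spectrally_negative_levy_process
begin

lemma X_measurable [measurable]: "0 \<le> t \<Longrightarrow> X t \<in> borel_measurable M"
proof -
  assume t: "0 \<le> t"
  interpret filtration "space M" "\<lambda>t. F (max 0 t)" by (rule filtration)
  have "space (F t) = space M" using space_F[of t] t by (simp add: max_absorb2)
  then show ?thesis
    using adapted[OF t] sets_F_subset[OF t] by (auto simp: measurable_def)
qed

lemma running_sup_measurable [measurable]:
  assumes t: "0 \<le> t" shows "running_sup X t \<in> borel_measurable M"
proof (rule borel_measurable_iff_le[THEN iffD2], intro allI)
  fix c
  have "{\<omega> \<in> space M. running_sup X t \<omega> \<le> c}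
      = {\<omega> \<in> space M. (\<forall>q\<in>\<rat>. 0 \<le> q \<and> q \<le> t \<longrightarrow> X q \<omega> \<le> c) \<and> X t \<omega> \<le> c}"
    using t paths by (auto simp: running_sup_eq path_sup_le_dense_iff)
  also have "\<dots> = {\<omega> \<in> space M. (\<forall>q\<in>\<rat> \<inter> {0..t}. X q \<omega> \<le> c) \<and> X t \<omega> \<le> c}"
    by auto
  also have "\<dots> \<in> sets M"
  proof -
    have "Measurable.pred M (\<lambda>\<omega>. (\<forall>q\<in>\<rat> \<inter> {0..t}. X q \<omega> \<le> c) \<and> X t \<omega> \<le> c)"
      using t by (intro pred_intros_logic pred_countable_Ball countable_Int1 countable_rat) auto
    then show ?thesis by (simp add: pred_def)
  qed
  finally show "{\<omega> \<in> space M. running_sup X t \<omega> \<le> c} \<in> sets M" .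
qed

text \<open>The natural conditions are what makes the event measurable off \<open>{X 0 = x}\<close>.\<close>

lemma creeping_event_measurable:
  assumes x: "0 < x" and \<gamma>: "continuous_on {0..} \<gamma>" and \<gamma>1: "\<gamma> ` {0..} \<subseteq> {1<..}"
    and fin: "a_star \<gamma> x < \<infinity>"
  shows "{\<omega> \<in> space M. sigma_time X (a_star \<gamma> x) \<omega> = ruin_time \<gamma> X \<omega>} \<in> sets M"
proof -
  obtain a where a: "a_star \<gamma> x = ereal a" "x < a" and cont: "continuous_on {x..} (gamma_bar \<gamma> x)"
    by (rule gamma_bar_props[OF x \<gamma> \<gamma>1 fin])
  \<comment> \<open>Freezing \<open>gamma_bar\<close> below \<open>x\<close> gives a continuous
    function on the whole line, so \<open>U t\<close> is measurable on all of \<open>M\<close>; on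
    the paths that start at \<open>x\<close> it is the perturbed process.\<close>
  let ?g = "\<lambda>s. gamma_bar \<gamma> x (max x s)"
  have contg: "continuous_on UNIV ?g"
    by (intro continuous_on_compose2[OF cont] continuous_intros) auto
  then have [measurable]: "?g \<in> borel_measurable borel" by (rule borel_measurable_continuous_onI)
  define U where "U t \<omega> = ?g (running_sup X t \<omega>) - running_sup X t \<omega> + X t \<omega>" for t \<omega>
  have U[measurable]: "U t \<in> borel_measurable M" if "0 \<le> t" for t
    unfolding U_def using that by measurable
  let ?O = "{\<omega> \<in> space M. X 0 \<omega> = x}"
  have O[measurable]: "?O \<in> sets M" by measurable
  have supx: "x \<le> running_sup X t \<omega>" if "\<omega> \<in> ?O" "0 \<le> t" for t \<omega>
    using path_le_sup[OF paths, of \<omega> 0 t] that by (auto simp: running_sup_eq)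
  have pert: "perturbed \<gamma> X t \<omega> = U t \<omega>" if "\<omega> \<in> ?O" "0 \<le> t" for t \<omega>
    using perturbed_eq[of X \<omega> x \<gamma> t] supx[OF that] that paths x \<gamma> by (auto simp: U_def max_absorb2)
  \<comment> \<open>\<open>U\<close> is right-continuous and the condition
    \<open>U t \<omega> < 0\<close> is open, so a negative value persists at rational times just to
    the right.\<close>
  have Urat: "(\<exists>t. 0 < t \<and> t < r \<and> U t \<omega> < 0) \<longleftrightarrow> (\<exists>q\<in>\<rat>. 0 < q \<and> q < r \<and> U q \<omega> < 0)"
    if \<omega>: "\<omega> \<in> ?O" for r \<omega>
  proof
    assume "\<exists>t. 0 < t \<and> t < r \<and> U t \<omega> < 0"
    then obtain t where t: "0 < t" "t < r" "U t \<omega> < 0" by blast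
    have f: "cadlag_no_positive_jumps (\<lambda>t. X t \<omega>)" using \<omega> paths by auto
    obtain q where q: "\<And>n. q n \<in> \<rat>" "\<And>n. t < q n" "\<And>n. q n < r" and qlim: "q \<longlonglongrightarrow> t"
      by (rule rat_seq_above[OF t(2)]) blast
    have X: "(\<lambda>n. X (q n) \<omega>) \<longlonglongrightarrow> X t \<omega>"
      using q t qlim by (intro cadlag_right_tendsto[OF f]) (auto intro: less_imp_le)
    have S: "(\<lambda>n. running_sup X (q n) \<omega>) \<longlonglongrightarrow> running_sup X t \<omega>"
      unfolding running_sup_eq
      using q t qlim less_imp_le[OF order.strict_trans[OF t(1) q(2)]]
      by (intro continuous_on_tendsto_compose[OF path_sup_continuous[OF f]]) auto
    have "(\<lambda>n. ?g (running_sup X (q n) \<omega>)) \<longlonglongrightarrow> ?g (running_sup X t \<omega>)"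
      using S by (intro continuous_on_tendsto_compose[OF contg]) auto
    with X S have "(\<lambda>n. U (q n) \<omega>) \<longlonglongrightarrow> U t \<omega>" unfolding U_def by (intro tendsto_intros)
    then have "eventually (\<lambda>n. U (q n) \<omega> < 0) sequentially"
      using t by (intro order_tendstoD)
    then obtain n where "U (q n) \<omega> < 0" by (auto simp: eventually_sequentially)
    then show "\<exists>q\<in>\<rat>. 0 < q \<and> q < r \<and> U q \<omega> < 0"
      using q[of n] t by (intro bexI[of _ "q n"]) auto
  qed auto
  \<comment> \<open>The supremum is continuous, increasing and starts below \<open>a\<close>; hence
    it takes the value \<open>a\<close> before \<open>r\<close> exactly if it is at least
    \<open>a\<close> at some rational time before \<open>r\<close>.\<close>
  have Srat: "(\<exists>t. 0 < t \<and> t < r \<and> running_sup X t \<omega> = a) \<longleftrightarrow> (\<exists>q\<in>\<rat>. 0 < q \<and> q < r \<and> a \<le> running_sup X q \<omega>)"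
    if \<omega>: "\<omega> \<in> ?O" for r \<omega>
  proof safe
    have f: "cadlag_no_positive_jumps (\<lambda>t. X t \<omega>)" using \<omega> paths by auto
    { fix t assume t: "0 < t" "t < r" "a = running_sup X t \<omega>"
      obtain q where "q \<in> \<rat>" "t < q" "q < r" using Rats_dense_in_real[OF t(2)] by auto
      then show "\<exists>q\<in>\<rat>. 0 < q \<and> q < r \<and> running_sup X t \<omega> \<le> running_sup X q \<omega>"
        using path_sup_mono[OF f, of t q] t by (intro bexI[of _ q]) (auto simp: running_sup_eq)
    }
    fix q assume q: "0 < q" "q < r" "a \<le> running_sup X q \<omega>"
    have "running_sup X 0 \<omega> = x" using \<omega> path_sup_0[OF f] by (auto simp: running_sup_eq)
    then obtain t where "0 \<le> t" "t \<le> q" "running_sup X t \<omega> = a"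
      using IVT'[of "\<lambda>t. running_sup X t \<omega>" 0 a q] q a(2)
        continuous_on_subset[OF path_sup_continuous[OF f], of "{0..q}"] by (auto simp: running_sup_eq)
    moreover have "t \<noteq> 0" using calculation \<open>running_sup X 0 \<omega> = x\<close> a(2) by auto
    ultimately show "\<exists>t>0. t < r \<and> running_sup X t \<omega> = a" using q by (intro exI[of _ t]) auto
  qed
  have sig: "sigma_time X (a_star \<gamma> x) \<omega> < ereal r \<longleftrightarrow> (\<exists>q\<in>\<rat> \<inter> {0<..<r}. a \<le> running_sup X q \<omega>)"
    if "\<omega> \<in> ?O" for r \<omega>
    unfolding sigma_time_def Inf_less_iff a using Srat[OF that, of r] by auto
  have rui: "ruin_time \<gamma> X \<omega> < ereal r \<longleftrightarrow> (\<exists>q\<in>\<rat> \<inter> {0<..<r}. U q \<omega> < 0)"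
    if "\<omega> \<in> ?O" for r \<omega>
    unfolding ruin_time_def Inf_less_iff using Urat[OF that, of r] pert[OF that] by auto
  \<comment> \<open>An extended real is determined by the rationals above it, which turns equality
    of the two times into countably many conditions.\<close>
  have eq_iff: "s = t \<longleftrightarrow> (\<forall>r\<in>\<rat>. s < ereal r \<longleftrightarrow> t < ereal r)" for s t :: ereal
  proof (rule iffI)
    assume *: "\<forall>r\<in>\<rat>. s < ereal r \<longleftrightarrow> t < ereal r"
    show "s = t"
    proof (rule ccontr)
      assume "s \<noteq> t"
      then have "s < t \<or> t < s" by auto
      then obtain r where r: "s < ereal (real_of_rat r) \<and> ereal (real_of_rat r) < t \<or> t < ereal (real_of_rat r) \<and> ereal (real_of_rat r) < s"
        using ereal_dense3[of s t] ereal_dense3[of t s] by blast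
      moreover have "s < ereal (real_of_rat r) \<longleftrightarrow> t < ereal (real_of_rat r)" using * by simp
      ultimately show False using less_asym by blast
    qed
  qed simp
  let ?E = "{\<omega> \<in> space M. sigma_time X (a_star \<gamma> x) \<omega> = ruin_time \<gamma> X \<omega>}"
  have "?E \<inter> ?O = {\<omega> \<in> space M. X 0 \<omega> = x \<and> (\<forall>r\<in>\<rat>. (\<exists>q\<in>\<rat> \<inter> {0<..<r}. a \<le> running_sup X q \<omega>) \<longleftrightarrow> (\<exists>q\<in>\<rat> \<inter> {0<..<r}. U q \<omega> < 0))}"
    (is "_ = {\<omega> \<in> space M. _ \<and> ?R \<omega>}")
  proof -
    have "sigma_time X (a_star \<gamma> x) \<omega> = ruin_time \<gamma> X \<omega> \<longleftrightarrow> ?R \<omega>" if "\<omega> \<in> ?O" for \<omega>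
      by (subst eq_iff) (simp only: sig[OF that] rui[OF that])
    then show ?thesis by blast
  qed
  also have "\<dots> \<in> sets M"
  proof -
    have "Measurable.pred M (\<lambda>\<omega>. X 0 \<omega> = x \<and> (\<forall>r\<in>\<rat>. (\<exists>q\<in>\<rat> \<inter> {0<..<r}. a \<le> running_sup X q \<omega>) \<longleftrightarrow> (\<exists>q\<in>\<rat> \<inter> {0<..<r}. U q \<omega> < 0)))"
    proof -
      have S[measurable]: "Measurable.pred M (\<lambda>\<omega>. \<exists>q\<in>\<rat> \<inter> {0<..<r}. a \<le> running_sup X q \<omega>)" for r
        by (intro pred_countable_Bex countable_Int1 countable_rat) auto
      have T[measurable]: "Measurable.pred M (\<lambda>\<omega>. \<exists>q\<in>\<rat> \<inter> {0<..<r}. U q \<omega> < 0)" for r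
        by (intro pred_countable_Bex countable_Int1 countable_rat) auto
      have [measurable]: "Measurable.pred M (\<lambda>\<omega>. \<forall>r\<in>\<rat>. (\<exists>q\<in>\<rat> \<inter> {0<..<r}. a \<le> running_sup X q \<omega>) \<longleftrightarrow> (\<exists>q\<in>\<rat> \<inter> {0<..<r}. U q \<omega> < 0))"
        by (intro pred_countable_Ball countable_rat) (rule pred_intros_logic(6)[OF S T])
      show ?thesis by measurable
    qed
    then show ?thesis by (simp add: pred_def)
  qed
  finally have 1: "?E \<inter> ?O \<in> sets M" .
  have "?E - ?O \<in> sets (F 0)"
  proof -
    interpret filtration "space M" "\<lambda>t. F (max 0 t)" by (rule filtration)
    have sp: "space (F 0) = space M" using space_F[of 0] by simp
    let ?N = "{\<omega> \<in> space M. X 0 \<omega> \<noteq> x}"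
    have "?N \<in> sets (F 0)" using adapted[of 0] unfolding sp[symmetric] by measurable
    moreover have "?N \<in> null_sets M" using start by (subst AE_iff_null_sets) (auto elim!: eventually_mono)
    ultimately have "nearly_empty M F (?E - ?O)"
      unfolding nearly_empty_def by (intro exI[of _ "\<lambda>_. ?N"]) auto
    then show ?thesis using natural_conditions unfolding natural_conditions_def by auto
  qed
  then have "?E - ?O \<in> sets M" using sets_F_subset[of 0] by auto
  with 1 have "(?E \<inter> ?O) \<union> (?E - ?O) \<in> sets M" by (intro sets.Un)
  also have "(?E \<inter> ?O) \<union> (?E - ?O) = ?E" by auto
  finally show ?thesis .
qed

end

section \<open>Random walks\<close>

definition drop_steps :: "nat \<Rightarrow> (nat \<Rightarrow> real) \<Rightarrow> nat \<Rightarrow> real" where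
  "drop_steps j s = (\<lambda>i. s (j + i))"

definition psum :: "(nat \<Rightarrow> real) \<Rightarrow> nat \<Rightarrow> real" where
  "psum s n = (\<Sum>i<n. s i)"

definition reach :: "real \<Rightarrow> real \<Rightarrow> (nat \<Rightarrow> real) \<Rightarrow> bool" where
  "reach y a s \<longleftrightarrow> (\<exists>j. a \<le> psum s j \<and> (\<forall>i\<le>j. - y \<le> psum s i))"

text \<open>The last conjunct says that the drawdown has never exceeded \<open>C\<close> times the distance from the
  running maximum to \<open>L\<close>.\<close>

definition good_hit :: "real \<Rightarrow> real \<Rightarrow> real \<Rightarrow> nat \<Rightarrow> nat \<Rightarrow> (nat \<Rightarrow> real) \<Rightarrow> bool" where
  "good_hit L C \<eta> n j s \<longleftrightarrow>
     L - L / 2^n \<le> psum s j \<and> (\<forall>i<j. psum s i < L - L / 2^n) \<and> (\<forall>i<j. s i \<le> \<eta>) \<and>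
     (\<forall>i\<le>j. \<forall>i'\<le>i. L - psum s i \<le> (1 + C) * (L - psum s i'))"

lemma psum_0 [simp]: "psum s 0 = 0"
  by (simp add: psum_def)

lemma psum_Suc: "psum s (Suc n) = psum s n + s n"
  by (simp add: psum_def)

lemma psum_add: "psum s (j + k) = psum s j + psum (drop_steps j s) k"
  by (induction k) (auto simp: psum_Suc drop_steps_def)

lemma psum_comb_seq: "i \<le> j \<Longrightarrow> psum (comb_seq j s s') i = psum s i"
  unfolding psum_def by (intro sum.cong) (auto simp: comb_seq_def)

lemma drop_steps_comb_seq [simp]: "drop_steps j (comb_seq j s s') = s'"
  by (auto simp: drop_steps_def comb_seq_def)

lemma drop_steps_shift: "drop_steps j (drop_steps k s) = drop_steps (j + k) s"
  by (auto simp: drop_steps_def fun_eq_iff add_ac)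

lemma drop_steps_0 [simp]: "drop_steps 0 s = s"
  by (simp add: drop_steps_def)

lemma reach_mono: "reach y a s \<Longrightarrow> y \<le> y' \<Longrightarrow> a' \<le> a \<Longrightarrow> reach y' a' s"
  unfolding reach_def by (meson neg_le_iff_le order_trans)

text \<open>At index \<open>j\<close> the walk stands at least \<open>y + a\<close> above the floor
  \<open>- y\<close>, so the continuation may fall by \<open>y + a\<close>. This gain in room drives
  the estimates of \<open>reach_prob\<close>.\<close>

lemma reach_shift:
  assumes "a \<le> psum s j" "\<forall>i\<le>j. - y \<le> psum s i" "reach (y + a) b (drop_steps j s)"
  shows "reach y (a + b) s"
proof -
  obtain k where k: "b \<le> psum (drop_steps j s) k" "\<forall>i\<le>k. - (y + a) \<le> psum (drop_steps j s) i"
    using assms(3) by (auto simp: reach_def)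
  have "- y \<le> psum s i" if "i \<le> j + k" for i
  proof (cases "i \<le> j")
    case False
    then have "psum s i = psum s j + psum (drop_steps j s) (i - j)" using psum_add[of s j "i - j"] by simp
    moreover have "- (y + a) \<le> psum (drop_steps j s) (i - j)" using k(2) that by auto
    ultimately show ?thesis using assms(1) by linarith
  qed (use assms in simp)
  then show ?thesis unfolding reach_def
    using k(1) assms(1) by (intro exI[of _ "j + k"]) (auto simp: psum_add)
qed

text \<open>With \<open>l = L / 2^n\<close>, stop at the first passage over \<open>L - l\<close>.
  The overshoot is at most \<open>l / 4\<close>, so at least \<open>l / 4\<close> of the way to the
  next level \<open>L - l / 2\<close> remains. The drawdown bound at this passage keeps the later
  distance to \<open>L\<close> within \<open>(1 + C) * l\<close>, so the fall from there is no more
  than \<open>(C + 1) * l\<close>.\<close>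

lemma good_hit_Suc:
  assumes L: "0 < L" and C: "0 \<le> C" and \<eta>: "\<eta> \<le> L / 2^n / 4" and hit: "good_hit L C \<eta> (Suc n) j s"
  shows "\<exists>j'. good_hit L C \<eta> n j' s \<and> reach ((C + 1) * (L / 2^n)) (L / 2^n / 4) (drop_steps j' s)"
proof -
  define l where "l = L / 2^n"
  have l2: "L / 2^Suc n = l / 2" by (simp add: l_def)
  have lpos: "l > 0" using L by (simp add: l_def)
  have le: "L - l \<le> L - l / 2" using lpos by simp
  have \<eta>': "\<eta> \<le> l / 4" using \<eta> by (simp add: l_def)
  have h: "L - l / 2 \<le> psum s j" "\<forall>i<j. s i \<le> \<eta>"
    "\<forall>i\<le>j. \<forall>i'\<le>i. L - psum s i \<le> (1 + C) * (L - psum s i')"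
    using hit unfolding good_hit_def l2 by auto
  define j' where "j' = (LEAST k. L - l \<le> psum s k)"
  have j': "L - l \<le> psum s j'" unfolding j'_def by (rule LeastI[of _ j]) (use h le in linarith)
  have below: "psum s i < L - l" if "i < j'" for i
    using not_less_Least[of i "\<lambda>k. L - l \<le> psum s k"] that unfolding j'_def by auto
  have j'j: "j' \<le> j" unfolding j'_def by (rule Least_le) (use h le in linarith)
  have over: "psum s j' \<le> L - l + l / 4"
  proof (cases j')
    \<comment> \<open>The start is already at the level only if \<open>l = L\<close>, and then there
      is no overshoot.\<close>
    case 0
    then have "L - l \<le> 0" using j' by simp
    have "psum s j' = 0" using 0 by simp
    moreover have "l \<le> L" using L by (simp add: l_def field_simps)
    ultimately show ?thesis using lpos by simp
  next
    case (Suc i)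
    have "psum s i < L - l" using below Suc by simp
    moreover have "s i \<le> \<eta>" using h(2) Suc j'j by simp
    ultimately show ?thesis unfolding Suc psum_Suc using \<eta>' by linarith
  qed
  have "good_hit L C \<eta> n j' s"
    unfolding good_hit_def l_def[symmetric] using j' below h j'j by auto
  moreover have "reach ((C + 1) * l) (l / 4) (drop_steps j' s)"
    unfolding reach_def
  proof (intro exI[of _ "j - j'"] conjI allI impI)
    have "psum s j = psum s j' + psum (drop_steps j' s) (j - j')" using psum_add[of s j' "j - j'"] j'j by simp
    then show "l / 4 \<le> psum (drop_steps j' s) (j - j')" using over h(1) lpos by linarith
    fix i assume i: "i \<le> j - j'"
    have "psum s (j' + i) = psum s j' + psum (drop_steps j' s) i" by (rule psum_add)
    moreover have "L - psum s (j' + i) \<le> (1 + C) * (L - psum s j')" using h(3) i j'j by auto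
    moreover have "(1 + C) * (L - psum s j') \<le> (1 + C) * l" using j' C by (intro mult_left_mono) auto
    ultimately show "- ((C + 1) * l) \<le> psum (drop_steps j' s) i" using over lpos
      by (simp add: algebra_simps)
  qed
  ultimately show ?thesis unfolding l_def by blast
qed

lemma psum_measurable_borel [measurable]: "(\<lambda>s. psum s n) \<in> borel_measurable (Pi\<^sub>M UNIV (\<lambda>_. borel))"
  unfolding psum_def by measurable

lemma drop_steps_measurable_borel [measurable]: "drop_steps j \<in> Pi\<^sub>M UNIV (\<lambda>_. borel) \<rightarrow>\<^sub>M Pi\<^sub>M UNIV (\<lambda>_. borel)"
  unfolding drop_steps_def[abs_def] by (intro measurable_PiM_single') (auto simp: space_PiM)

lemma reach_measurable_borel [measurable]: "Measurable.pred (Pi\<^sub>M UNIV (\<lambda>_. borel)) (reach y a)"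
  unfolding reach_def[abs_def] by measurable

lemma good_hit_measurable_borel [measurable]: "Measurable.pred (Pi\<^sub>M UNIV (\<lambda>_. borel)) (good_hit L C \<eta> n j)"
proof -
  let ?S = "Pi\<^sub>M UNIV (\<lambda>_. borel)"
  have d: "Measurable.pred ?S (\<lambda>s. L - psum s i \<le> (1 + C) * (L - psum s i'))" for i i'
    unfolding pred_def
    by (intro borel_measurable_le borel_measurable_times borel_measurable_diff borel_measurable_const psum_measurable_borel)
  have e: "Measurable.pred ?S (\<lambda>s. \<forall>i<j. psum s i < L - L / 2^n)"
    by (intro pred_intros_countable(1) pred_intros_imp') measurable
  have f: "Measurable.pred ?S (\<lambda>s. \<forall>i<j. s i \<le> \<eta>)"
    by (intro pred_intros_countable(1) pred_intros_imp') measurable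
  have g: "Measurable.pred ?S (\<lambda>s. \<forall>i\<le>j. \<forall>i'\<le>i. L - psum s i \<le> (1 + C) * (L - psum s i'))"
    by (intro pred_intros_countable(1) pred_intros_imp' d)
  show ?thesis unfolding good_hit_def[abs_def]
    by (intro pred_intros_logic(3) e f g) measurable
qed

section \<open>The Markov property of walks with independent, identically distributed steps\<close>

locale iid_steps =
  fixes \<mu> :: "real measure"
  assumes prob_mu: "prob_space \<mu>" and sets_mu [measurable_cong]: "sets \<mu> = sets borel"
begin

sublocale sequence_space \<mu>
  by (simp add: sequence_space_def product_prob_space_def product_prob_space_axioms_def
      product_sigma_finite_def prob_mu prob_space_imp_sigma_finite)

lemma space_S [simp]: "space S = UNIV"
  using sets_eq_imp_space_eq[OF sets_mu] by (simp add: space_PiM)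

lemma sets_S [measurable_cong]: "sets S = sets (Pi\<^sub>M UNIV (\<lambda>_. borel))"
  by (intro sets_PiM_cong refl sets_mu)

lemma component_measurable [measurable]: "(\<lambda>s. s i) \<in> borel_measurable S"
  by measurable

lemma Collect_sets: "Measurable.pred S A \<Longrightarrow> {s. A s} \<in> sets S"
  by (simp add: pred_def)

text \<open>The Markov property at a fixed index. \<open>comb_seq j s s'\<close> consists of the
  first \<open>j\<close> steps of \<open>s\<close> followed by \<open>s'\<close>, so invariance
  under it says that a predicate depends on the first \<open>j\<close> steps only; \<open>S\<close>
  is the image of its own square under this gluing. \<open>B\<close> may depend on the past, as is
  needed for stages whose parameters are computed from earlier steps.\<close>

lemma emeasure_split:
  assumes [measurable]: "Measurable.pred S A" "Measurable.pred (S \<Otimes>\<^sub>M S) (\<lambda>(s, s'). B s s')"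
    and A: "\<And>s s'. A (comb_seq j s s') \<longleftrightarrow> A s"
    and B: "\<And>s s' s''. B (comb_seq j s s') s'' \<longleftrightarrow> B s s''"
  shows "emeasure S {s. A s \<and> B s (drop_steps j s)} = (\<integral>\<^sup>+s. indicator {s. A s} s * emeasure S {s'. B s s'} \<partial>S)"
proof -
  let ?E = "{s. A s \<and> B s (drop_steps j s)}"
  have [measurable]: "(\<lambda>s. (s, drop_steps j s)) \<in> S \<rightarrow>\<^sub>M S \<Otimes>\<^sub>M S" by measurable
  have [measurable]: "Measurable.pred S (\<lambda>s. B s (drop_steps j s))"
    using measurable_compose[of "\<lambda>s. (s, drop_steps j s)" S "S \<Otimes>\<^sub>M S" "\<lambda>(s, s'). B s s'"] by simp
  have [measurable]: "?E \<in> sets S" by (rule Collect_sets) measurable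
  have "emeasure S ?E = emeasure (distr (S \<Otimes>\<^sub>M S) S (\<lambda>(\<omega>, \<omega>'). comb_seq j \<omega> \<omega>')) ?E"
    by (simp add: PiM_comb_seq)
  also have "\<dots> = emeasure (S \<Otimes>\<^sub>M S) ((\<lambda>(\<omega>, \<omega>'). comb_seq j \<omega> \<omega>') -` ?E \<inter> space (S \<Otimes>\<^sub>M S))"
    by (rule emeasure_distr) measurable
  also have "\<dots> = (\<integral>\<^sup>+s. emeasure S (Pair s -` ((\<lambda>(\<omega>, \<omega>'). comb_seq j \<omega> \<omega>') -` ?E \<inter> space (S \<Otimes>\<^sub>M S))) \<partial>S)"
    by (rule P.emeasure_pair_measure_alt) measurable
  also have "\<dots> = (\<integral>\<^sup>+s. indicator {s. A s} s * emeasure S {s'. B s s'} \<partial>S)"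
  proof (rule nn_integral_cong)
    fix s
    have "Pair s -` ((\<lambda>(\<omega>, \<omega>'). comb_seq j \<omega> \<omega>') -` ?E \<inter> space (S \<Otimes>\<^sub>M S)) = (if A s then {s'. B s s'} else {})"
      by (auto simp: space_pair_measure A B)
    then show "emeasure S (Pair s -` ((\<lambda>(\<omega>, \<omega>'). comb_seq j \<omega> \<omega>') -` ?E \<inter> space (S \<Otimes>\<^sub>M S)))
        = indicator {s. A s} s * emeasure S {s'. B s s'}" by simp
  qed
  finally show ?thesis .
qed

lemma prob_split_ge:
  assumes [measurable]: "Measurable.pred S A" "Measurable.pred (S \<Otimes>\<^sub>M S) (\<lambda>(s, s'). B s s')"
    and A: "\<And>s s'. A (comb_seq j s s') \<longleftrightarrow> A s"
    and B: "\<And>s s' s''. B (comb_seq j s s') s'' \<longleftrightarrow> B s s''"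
    and c: "0 \<le> c" "\<And>s. A s \<Longrightarrow> c \<le> measure S {s'. B s s'}"
  shows "measure S {s. A s} * c \<le> measure S {s. A s \<and> B s (drop_steps j s)}"
proof -
  have "ennreal (measure S {s. A s} * c) = (\<integral>\<^sup>+s. indicator {s. A s} s * ennreal c \<partial>S)"
    using c(1) by (simp add: nn_integral_multc ennreal_mult Collect_sets P.emeasure_eq_measure)
  also have "\<dots> \<le> (\<integral>\<^sup>+s. indicator {s. A s} s * emeasure S {s'. B s s'} \<partial>S)"
    using c(2) by (intro nn_integral_mono) (auto simp: indicator_def P.emeasure_eq_measure intro!: ennreal_leI)
  also have "\<dots> = emeasure S {s. A s \<and> B s (drop_steps j s)}"
    by (rule emeasure_split[symmetric]) (use A B in auto)
  also have "\<dots> = ennreal (measure S {s. A s \<and> B s (drop_steps j s)})" by (rule P.emeasure_eq_measure)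
  finally show ?thesis by (simp add: ennreal_le_iff)
qed

lemma prob_split:
  assumes [measurable]: "Measurable.pred S A" "Measurable.pred S B"
    and A: "\<And>s s'. A (comb_seq j s s') \<longleftrightarrow> A s"
  shows "measure S {s. A s \<and> B (drop_steps j s)} = measure S {s. A s} * measure S {s. B s}"
proof -
  have "emeasure S {s. A s \<and> B (drop_steps j s)} = (\<integral>\<^sup>+s. indicator {s. A s} s * emeasure S {s'. B s'} \<partial>S)"
    by (rule emeasure_split[where B = "\<lambda>_. B"]) (use A in auto)
  also have "\<dots> = emeasure S {s. A s} * emeasure S {s'. B s'}"
    by (simp add: nn_integral_multc Collect_sets)
  finally show ?thesis by (simp add: P.emeasure_eq_measure ennreal_mult[symmetric] del: ennreal_mult'')
qed

lemma prob_shift: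
  assumes [measurable]: "Measurable.pred S B"
  shows "measure S {s. B (drop_steps j s)} = measure S {s. B s}"
  using prob_split[of "\<lambda>_. True" B j] P.prob_space by simp

lemma prob_all_steps:
  assumes Q: "Measurable.pred borel Q"
  shows "measure S {s. \<forall>i<n. Q (s i)} = measure S {s. Q (s 0)} ^ n"
proof (induction n)
  case 0
  then show ?case using P.prob_space by simp
next
  case (Suc n)
  have Q': "Measurable.pred S (\<lambda>s. Q (s i))" for i
    by (rule measurable_compose[OF component_measurable Q])
  have "{s. \<forall>i<Suc n. Q (s i)} = {s. Q (s 0) \<and> (\<forall>i<n. Q (drop_steps 1 s i))}"
    by (auto simp: drop_steps_def All_less_Suc2)
  also have "measure S \<dots> = measure S {s. Q (s 0)} * measure S {s. \<forall>i<n. Q (s i)}"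
  proof (rule prob_split[OF Q'])
    show "Measurable.pred S (\<lambda>s. \<forall>i<n. Q (s i))" by (intro pred_intros_countable(1) pred_intros_imp' Q')
  qed (simp add: comb_seq_def)
  finally show ?case using Suc by simp
qed

text \<open>The strong Markov property at the random index \<open>j\<close> singled out by \<open>A j\<close>.\<close>

lemma prob_stopping:
  assumes A[measurable]: "\<And>j. Measurable.pred S (A j)" and [measurable]: "Measurable.pred S B"
    and dep: "\<And>j s s'. A j (comb_seq j s s') \<longleftrightarrow> A j s"
    and disj: "\<And>i j s. A i s \<Longrightarrow> A j s \<Longrightarrow> i = j"
  shows "measure S {s. \<exists>j. A j s \<and> B (drop_steps j s)} = measure S {s. \<exists>j. A j s} * measure S {s. B s}"
proof -
  have *: "(\<lambda>j. measure S (E j)) sums measure S (\<Union>j. E j)"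
    if "\<And>j. E j \<in> sets S" "\<And>j. E j \<subseteq> {s. A j s}" for E
    using that disj by (intro P.finite_measure_UNION) (auto simp: disjoint_family_on_def, blast)
  have "(\<lambda>j. measure S {s. A j s \<and> B (drop_steps j s)}) sums measure S (\<Union>j. {s. A j s \<and> B (drop_steps j s)})"
    by (rule *) (auto intro!: Collect_sets)
  moreover have "measure S {s. A j s \<and> B (drop_steps j s)} = measure S {s. A j s} * measure S {s. B s}" for j
    by (rule prob_split) (auto simp: dep)
  moreover have "(\<lambda>j. measure S {s. A j s}) sums measure S (\<Union>j. {s. A j s})"
    by (rule *) (auto intro!: Collect_sets)
  then have "(\<lambda>j. measure S {s. A j s} * measure S {s. B s}) sums (measure S (\<Union>j. {s. A j s}) * measure S {s. B s})"
    by (rule sums_mult2)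
  ultimately have "measure S (\<Union>j. {s. A j s \<and> B (drop_steps j s)}) = measure S (\<Union>j. {s. A j s}) * measure S {s. B s}"
    using sums_unique2 by auto
  then show ?thesis by (simp add: Collect_ex_eq)
qed

section \<open>The probability of a rise before a fall\<close>

definition reach_prob :: "real \<Rightarrow> real \<Rightarrow> real" where
  "reach_prob y a = measure S {s. reach y a s}"

lemma reach_prob_nonneg: "0 \<le> reach_prob y a"
  by (simp add: reach_prob_def)

lemma reach_prob_le_1: "reach_prob y a \<le> 1"
  by (simp add: reach_prob_def)

lemma reach_prob_mono: "y \<le> y' \<Longrightarrow> a' \<le> a \<Longrightarrow> reach_prob y a \<le> reach_prob y' a'"
  unfolding reach_prob_def
  by (intro P.finite_measure_mono Collect_mono Collect_sets impI) (auto intro: reach_mono)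

text \<open>The strong Markov property at the first passage over \<open>a\<close>, singled out by
  \<open>A\<close>. Equality is lost because the overshoot, which only helps, is ignored.\<close>

lemma reach_prob_add: "reach_prob y a * reach_prob (y + a) b \<le> reach_prob y (a + b)"
proof -
  define A where "A j s \<longleftrightarrow> a \<le> psum s j \<and> (\<forall>i<j. psum s i < a) \<and> (\<forall>i\<le>j. - y \<le> psum s i)" for j s
  have [measurable]: "Measurable.pred S (A j)" for j unfolding A_def[abs_def] by measurable
  have ex: "reach y a s \<longleftrightarrow> (\<exists>j. A j s)" for s
  proof
    assume "reach y a s"
    then obtain j where j: "a \<le> psum s j" "\<forall>i\<le>j. - y \<le> psum s i" by (auto simp: reach_def)
    define k where "k = (LEAST k. a \<le> psum s k)"
    have "a \<le> psum s k" unfolding k_def by (rule LeastI[of _ j]) (rule j)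
    moreover have "k \<le> j" unfolding k_def by (rule Least_le) (rule j)
    moreover have "\<forall>i<k. psum s i < a" unfolding k_def using not_less_Least not_le_imp_less by blast
    ultimately show "\<exists>j. A j s" using j by (auto simp: A_def intro!: exI[of _ k])
  qed (auto simp: A_def reach_def)
  have "reach_prob y a * reach_prob (y + a) b = measure S {s. \<exists>j. A j s \<and> reach (y + a) b (drop_steps j s)}"
    unfolding reach_prob_def ex
    by (rule prob_stopping[symmetric])
       (auto simp: A_def psum_comb_seq not_less[symmetric], metis linorder_neqE_nat not_less)
  also have "\<dots> \<le> reach_prob y (a + b)"
    unfolding reach_prob_def
    by (intro P.finite_measure_mono Collect_mono Collect_sets impI) (auto simp: A_def intro: reach_shift)
  finally show ?thesis .
qed

text \<open>The room gained by earlier rises is given away: each of the \<open>m\<close> rises is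
  allowed to fall by \<open>y\<close> only.\<close>

lemma reach_prob_power:
  assumes "0 \<le> y" "0 \<le> a" shows "reach_prob y a ^ m \<le> reach_prob y (real m * a)"
proof (induction m)
  case 0
  have "{s. reach y 0 s} = UNIV" using assms by (auto simp: reach_def intro!: exI[of _ 0])
  then show ?case using P.prob_space by (simp add: reach_prob_def)
next
  case (Suc m)
  have "reach_prob y a ^ Suc m \<le> reach_prob y (real m * a) * reach_prob (y + real m * a) a"
    using Suc assms reach_prob_mono[of y "y + real m * a" a a]
    by (simp add: mult.commute[of "reach_prob y a"] mult_mono reach_prob_nonneg)
  also have "\<dots> \<le> reach_prob y (real m * a + a)" by (rule reach_prob_add)
  finally show ?case by (simp add: algebra_simps)
qed

text \<open>A rise by \<open>z\<close> before a fall by \<open>z\<close> doubles the distance to the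
  floor. The induction puts the smallest stage in front; after it the floor is
  \<open>y / 2^n\<close> away, which is the case already treated.\<close>

lemma reach_prob_chain:
  "(\<Prod>k<n. reach_prob (y / 2^Suc k) (y / 2^Suc k)) \<le> reach_prob (y / 2^n) (y - y / 2^n)" if "0 \<le> y"
proof (induction n)
  case 0
  have "{s. reach y 0 s} = UNIV" using that by (auto simp: reach_def intro!: exI[of _ 0])
  then show ?case using P.prob_space by (simp add: reach_prob_def)
next
  case (Suc n)
  let ?z = "y / 2^Suc n"
  have "(\<Prod>k<Suc n. reach_prob (y / 2^Suc k) (y / 2^Suc k)) \<le> reach_prob (y / 2^n) (y - y / 2^n) * reach_prob ?z ?z"
    unfolding prod.lessThan_Suc by (intro mult_right_mono Suc reach_prob_nonneg)
  also have "\<dots> = reach_prob ?z ?z * reach_prob (?z + ?z) (y - y / 2^n)" by (simp add: mult.commute)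
  also have "\<dots> \<le> reach_prob ?z (?z + (y - y / 2^n))" by (rule reach_prob_add)
  also have "?z + (y - y / 2^n) = y - ?z" by (simp add: field_simps)
  finally show ?case .
qed

lemma good_hit_prob_Suc:
  assumes "0 < L" "0 \<le> C" "\<eta> \<le> L / 2^n / 4"
  shows "measure S {s. \<exists>j. good_hit L C \<eta> (Suc n) j s}
       \<le> measure S {s. \<exists>j. good_hit L C \<eta> n j s} * reach_prob ((C + 1) * (L / 2^n)) (L / 2^n / 4)"
proof -
  have "measure S {s. \<exists>j. good_hit L C \<eta> (Suc n) j s}
     \<le> measure S {s. \<exists>j. good_hit L C \<eta> n j s \<and> reach ((C + 1) * (L / 2^n)) (L / 2^n / 4) (drop_steps j s)}"
    using good_hit_Suc[OF assms] by (intro P.finite_measure_mono Collect_mono Collect_sets impI) auto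
  also have "\<dots> = measure S {s. \<exists>j. good_hit L C \<eta> n j s} * reach_prob ((C + 1) * (L / 2^n)) (L / 2^n / 4)"
    unfolding reach_prob_def
  proof (rule prob_stopping)
    show "good_hit L C \<eta> n j (comb_seq j s s') \<longleftrightarrow> good_hit L C \<eta> n j s" for j s s'
      by (auto simp: good_hit_def psum_comb_seq comb_seq_def)
    show "i = j" if "good_hit L C \<eta> n i s" "good_hit L C \<eta> n j s" for i j s
      using that unfolding good_hit_def by (metis linorder_neqE_nat not_less)
  qed auto
  finally show ?thesis .
qed

lemma good_hit_prob_le:
  assumes "0 < L" "0 \<le> C" "\<eta> \<le> L / 2^n / 4"
  shows "measure S {s. \<exists>j. good_hit L C \<eta> (Suc n) j s}
       \<le> (\<Prod>k<Suc n. reach_prob ((C + 1) * (L / 2^k)) (L / 2^k / 4))"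
  using assms(3)
proof (induction n)
  case 0
  have "measure S {s. \<exists>j. good_hit L C \<eta> (Suc 0) j s} \<le> 1 * reach_prob ((C + 1) * (L / 2^0)) (L / 2^0 / 4)"
    using assms 0
    by (intro order_trans[OF good_hit_prob_Suc] mult_right_mono reach_prob_nonneg) auto
  then show ?case by simp
next
  case (Suc n)
  have "L / 2^Suc n / 4 \<le> L / 2^n / 4" using assms by (simp add: field_simps)
  then have "measure S {s. \<exists>j. good_hit L C \<eta> (Suc n) j s}
       \<le> (\<Prod>k<Suc n. reach_prob ((C + 1) * (L / 2^k)) (L / 2^k / 4))" using Suc by auto
  then have "measure S {s. \<exists>j. good_hit L C \<eta> (Suc n) j s} * reach_prob ((C + 1) * (L / 2^Suc n)) (L / 2^Suc n / 4)
      \<le> (\<Prod>k<Suc n. reach_prob ((C + 1) * (L / 2^k)) (L / 2^k / 4)) * reach_prob ((C + 1) * (L / 2^Suc n)) (L / 2^Suc n / 4)"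
    by (intro mult_right_mono reach_prob_nonneg)
  also have "\<dots> = (\<Prod>k<Suc (Suc n). reach_prob ((C + 1) * (L / 2^k)) (L / 2^k / 4))"
    by (rule prod.lessThan_Suc[symmetric])
  finally show ?case by (rule order_trans[OF good_hit_prob_Suc[OF assms(1,2) Suc.prems]])
qed

text \<open>The exponent \<open>m\<close> makes up for \<open>C\<close>: with \<open>l = L / 2^k\<close>, \<open>m\<close> rises by \<open>l / 4\<close>, each
  completed before a fall by \<open>(C + 1) * l\<close>, make up one rise by \<open>(C + 1) * l\<close>.\<close>

lemma good_hit_imp_reach:
  assumes L: "0 < L" and C: "0 \<le> C" and \<eta>: "\<eta> \<le> L / 2^n / 4" and m: "4 * (C + 1) \<le> real m"
  shows "measure S {s. \<exists>j. good_hit L C \<eta> (Suc n) j s} ^ m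
       \<le> reach_prob ((C + 1) * L / 2^n) ((C + 1) * L - (C + 1) * L / 2^n)"
proof -
  let ?r = "\<lambda>k. reach_prob ((C + 1) * (L / 2^k)) (L / 2^k / 4)"
  have "measure S {s. \<exists>j. good_hit L C \<eta> (Suc n) j s} \<le> (\<Prod>k<Suc n. ?r k)"
    by (rule good_hit_prob_le[OF L C \<eta>])
  also have "\<dots> = ?r 0 * (\<Prod>k<n. ?r (Suc k))" by (rule prod.lessThan_Suc_shift)
  \<comment> \<open>The factor for \<open>k = 0\<close> is dropped, since the chain of doublings
    ends with a rise by half of \<open>(C + 1) * L\<close>.\<close>
  also have "\<dots> \<le> 1 * (\<Prod>k<n. ?r (Suc k))"
    by (intro mult_right_mono reach_prob_le_1 prod_nonneg) (simp add: reach_prob_nonneg)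
  finally have "measure S {s. \<exists>j. good_hit L C \<eta> (Suc n) j s} ^ m \<le> (\<Prod>k<n. ?r (Suc k)) ^ m"
    by (intro power_mono) auto
  also have "\<dots> = (\<Prod>k<n. ?r (Suc k) ^ m)" by (rule prod_power_distrib)
  also have "\<dots> \<le> (\<Prod>k<n. reach_prob ((C + 1) * L / 2^Suc k) ((C + 1) * L / 2^Suc k))"
  proof (intro prod_mono conjI)
    fix k
    let ?l = "L / 2^Suc k"
    have "?r (Suc k) ^ m \<le> reach_prob ((C + 1) * ?l) (real m * (?l / 4))"
      using L C by (intro reach_prob_power) auto
    also have "\<dots> \<le> reach_prob ((C + 1) * ?l) ((C + 1) * ?l)"
    proof (rule reach_prob_mono)
      have "4 * (C + 1) * (?l / 4) \<le> real m * (?l / 4)" using m L by (intro mult_right_mono) auto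
      moreover have "4 * (C + 1) * (?l / 4) = (C + 1) * ?l" by (simp add: field_simps)
      ultimately show "(C + 1) * ?l \<le> real m * (?l / 4)" by (simp only:)
    qed simp
    finally show "?r (Suc k) ^ m \<le> reach_prob ((C + 1) * L / 2^Suc k) ((C + 1) * L / 2^Suc k)" by simp
  qed (simp add: reach_prob_nonneg)
  also have "\<dots> \<le> reach_prob ((C + 1) * L / 2^n) ((C + 1) * L - (C + 1) * L / 2^n)"
    using L C by (intro reach_prob_chain) auto
  finally show ?thesis .
qed

text \<open>A range bounded by \<open>K\<close> is inherited by the walk after \<open>m\<close>
  steps, and it excludes \<open>m\<close> large steps in a row, an event of probability
  \<open>p ^ m > 0\<close>. Independence gives \<open>b \<le> (1 - p ^ m) * b\<close> for the
  probability \<open>b\<close> in question, hence \<open>b = 0\<close>. The factor \<open>e\<close>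
  picks the sign of the large steps.\<close>

lemma walk_unbounded:
  assumes e: "e = 1 \<or> e = -1" and \<delta>: "0 < \<delta>" and pos: "0 < measure S {s. \<delta> < e * s 0}"
  shows "measure S {s. \<forall>i j. \<bar>psum s i - psum s j\<bar> \<le> K} = 0"
proof -
  obtain m where m: "K < real m * \<delta>" using \<delta> ex_less_of_nat_mult by blast
  let ?B = "\<lambda>s. \<forall>i j. \<bar>psum s i - psum s j\<bar> \<le> K"
  have imp: "\<not> (\<forall>i<m. \<delta> < e * s i) \<and> ?B (drop_steps m s)" if B: "?B s" for s
  proof
    show "\<not> (\<forall>i<m. \<delta> < e * s i)"
    proof
      assume "\<forall>i<m. \<delta> < e * s i"
      then have "(\<Sum>i<m. \<delta>) \<le> (\<Sum>i<m. e * s i)" by (intro sum_mono) (auto intro: less_imp_le)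
      then have "real m * \<delta> \<le> e * psum s m" by (simp add: psum_def sum_distrib_left)
      also have "\<dots> \<le> \<bar>psum s m - psum s 0\<bar>" using e by auto
      also have "\<dots> \<le> K" using B by blast
      finally show False using m by simp
    qed
    show "?B (drop_steps m s)"
    proof (intro allI)
      fix i j
      have "\<bar>psum s (m + i) - psum s (m + j)\<bar> \<le> K" using B by blast
      then show "\<bar>psum (drop_steps m s) i - psum (drop_steps m s) j\<bar> \<le> K" by (simp add: psum_add)
    qed
  qed
  let ?p = "measure S {s. \<delta> < e * s 0}" and ?b = "measure S {s. ?B s}"
  have "?b \<le> measure S {s. \<not> (\<forall>i<m. \<delta> < e * s i) \<and> ?B (drop_steps m s)}"
    using imp by (intro P.finite_measure_mono Collect_mono Collect_sets impI) auto
  also have "\<dots> = measure S {s. \<not> (\<forall>i<m. \<delta> < e * s i)} * ?b"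
    by (rule prob_split) (auto simp: comb_seq_def)
  also have "measure S {s. \<not> (\<forall>i<m. \<delta> < e * s i)} = 1 - measure S {s. \<forall>i<m. \<delta> < e * s i}"
    using P.prob_compl[of "{s. \<forall>i<m. \<delta> < e * s i}"] by (simp add: Collect_sets Collect_neg_eq[symmetric] Compl_eq_Diff_UNIV[symmetric])
  also have "measure S {s. \<forall>i<m. \<delta> < e * s i} = ?p ^ m"
    by (rule prob_all_steps) simp
  finally have "?b * ?p ^ m \<le> 0" by (simp add: algebra_simps)
  moreover have "0 < ?p ^ m" using pos by simp
  ultimately have "?b \<le> 0" by (simp add: mult_le_0_iff)
  then show ?thesis by (simp add: order.antisym)
qed

text \<open>For each \<open>j\<close> the event that the level is crossed upwards at step \<open>j\<close> and the walk stays above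
  afterwards singles out the last upcrossing, so these events are disjoint.\<close>

lemma sum_upcrossing_le:
  "(\<Sum>j<n. measure S {s. psum s j < y \<and> y \<le> psum s (Suc j)}) * measure S {s. \<forall>i\<le>n. 0 \<le> psum s i} \<le> 1"
proof -
  let ?q = "\<lambda>s. \<forall>i\<le>n. 0 \<le> psum s i"
  define G where "G j = {s. (psum s j < y \<and> y \<le> psum s (Suc j)) \<and> ?q (drop_steps (Suc j) s)}" for j
  have G: "G j \<in> sets S" for j unfolding G_def by (rule Collect_sets) measurable
  have no: False if "s \<in> G j" "s \<in> G j'" "j < j'" "j' < n" for s j j'
  proof -
    have "psum s j' = psum s (Suc j) + psum (drop_steps (Suc j) s) (j' - Suc j)"
      using psum_add[of s "Suc j" "j' - Suc j"] that by simp
    moreover have "0 \<le> psum (drop_steps (Suc j) s) (j' - Suc j)" using that by (auto simp: G_def)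
    ultimately show False using that by (auto simp: G_def)
  qed
  have "disjoint_family_on G {..<n}"
    unfolding disjoint_family_on_def using no by (metis disjoint_iff lessThan_iff linorder_neqE_nat)
  then have "(\<Sum>j<n. measure S (G j)) = measure S (\<Union>j<n. G j)"
    using G by (intro P.finite_measure_finite_Union[symmetric]) auto
  also have "\<dots> \<le> 1" by simp
  also have "(\<Sum>j<n. measure S (G j)) = (\<Sum>j<n. measure S {s. psum s j < y \<and> y \<le> psum s (Suc j)} * measure S {s. ?q s})"
    unfolding G_def by (intro sum.cong refl prob_split) (auto simp: psum_comb_seq)
  finally show ?thesis by (simp add: sum_distrib_right)
qed

end

section \<open>Increments along a grid\<close>

lemma grid_slope_imp_slope:
  assumes f: "cadlag_no_positive_jumps f" and h: "0 < h"
    and slope: "\<And>K i. f (real (Suc i) * (h / 2^K)) - f (real i * (h / 2^K)) \<le> c * (h / 2^K)"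
    and st: "0 \<le> s" "s \<le> t"
  shows "f t - f s \<le> c * (t - s)"
proof -
  define v where "v s K = nat \<lceil>s * 2^K / h\<rceil>" for s :: real and K :: nat
  have lim: "(\<lambda>K. f (real (v s K) * (h / 2^K))) \<longlonglongrightarrow> f s" "(\<lambda>K. real (v s K) * (h / 2^K)) \<longlonglongrightarrow> s"
    if "0 \<le> s" for s
  proof -
    show 1: "(\<lambda>K. real (v s K) * (h / 2^K)) \<longlonglongrightarrow> s"
      unfolding v_def by (rule grid_above[OF that h])
    show "(\<lambda>K. f (real (v s K) * (h / 2^K))) \<longlonglongrightarrow> f s"
      using grid_above(1)[OF that h] unfolding v_def[symmetric] by (rule cadlag_right_tendsto[OF f that 1])
  qed
  have t: "0 \<le> t" using st by simp
  have ge: "f (real j * (h / 2^K)) - f (real i * (h / 2^K)) \<le> c * (real j * (h / 2^K) - real i * (h / 2^K))"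
    if "i \<le> j" for i j K
    using that
  proof (induction j rule: dec_induct)
    case (step j)
    have "c * (real (Suc j) * (h / 2^K) - real i * (h / 2^K))
        = c * (real j * (h / 2^K) - real i * (h / 2^K)) + c * (h / 2^K)"
      by (simp add: algebra_simps add_divide_distrib)
    then show ?case using step slope[of j K] by linarith
  qed simp
  have "v s K \<le> v t K" for K
    unfolding v_def using st h by (intro nat_mono ceiling_mono divide_right_mono mult_right_mono) auto
  then have "f (real (v t K) * (h / 2^K)) - f (real (v s K) * (h / 2^K))
      \<le> c * (real (v t K) * (h / 2^K) - real (v s K) * (h / 2^K))" for K by (rule ge)
  then show ?thesis
    using LIMSEQ_le[OF tendsto_diff[OF lim(1)[OF t] lim(1)[OF st(1)]]
        tendsto_mult_left[OF tendsto_diff[OF lim(2)[OF t] lim(2)[OF st(1)]]]] by auto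
qed

section \<open>The process sampled along a grid\<close>

definition path_steps :: "(real \<Rightarrow> real) \<Rightarrow> real \<Rightarrow> nat \<Rightarrow> real" where
  "path_steps f h = (\<lambda>i. f (real (Suc i) * h) - f (real i * h))"

lemma psum_path_steps: "psum (drop_steps w (path_steps f h)) n = f (real (w + n) * h) - f (real w * h)"
  by (induction n) (auto simp: psum_Suc path_steps_def drop_steps_def)

lemma psum_path_steps_0: "psum (path_steps f h) n = f (real n * h) - f 0"
  using psum_path_steps[of 0 f h n] by simp

context spectrally_negative_levy_process
begin

definition steps :: "real \<Rightarrow> 'w \<Rightarrow> nat \<Rightarrow> real" where
  "steps h \<omega> = path_steps (\<lambda>t. X t \<omega>) h"

definition law :: "real \<Rightarrow> real measure" where
  "law h = distr M borel (\<lambda>\<omega>. X h \<omega> - X 0 \<omega>)"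

lemma step_measurable [measurable]: "0 < h \<Longrightarrow> (\<lambda>\<omega>. steps h \<omega> i) \<in> borel_measurable M"
  unfolding steps_def path_steps_def by (intro borel_measurable_diff X_measurable) auto

lemma iid_steps_law: "0 < h \<Longrightarrow> iid_steps (law h)"
  unfolding law_def by (intro iid_steps.intro prob_space_distr borel_measurable_diff X_measurable) auto

lemma step_distr: assumes "0 < h" shows "distr M borel (\<lambda>\<omega>. steps h \<omega> i) = law h"
proof -
  have "real (Suc i) * h - real i * h = h" by (simp add: algebra_simps)
  then show ?thesis
    using stationary_increments[of "real i * h" "real (Suc i) * h"] assms
    by (simp add: steps_def path_steps_def law_def)
qed

lemma steps_indep:
  assumes h: "0 < h"
  shows "indep_vars (\<lambda>_. borel) (\<lambda>i \<omega>. steps h \<omega> i) UNIV"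
proof -
  have ind: "indep_vars (\<lambda>_. borel) (\<lambda>i \<omega>. steps h \<omega> i) {..<n}" for n
    using independent_increments[of "\<lambda>i. real i * h" n] h
    by (simp add: steps_def path_steps_def strict_mono_def)
  show ?thesis
    unfolding indep_vars_def2
  proof (intro conjI ballI)
    show "random_variable borel (\<lambda>\<omega>. steps h \<omega> i)" for i using h by measurable
    show "indep_sets (\<lambda>i. {(\<lambda>\<omega>. steps h \<omega> i) -` A \<inter> space M |A. A \<in> sets borel}) UNIV"
    proof (subst indep_sets_finite_index_sets, intro allI impI)
      fix J :: "nat set" assume "finite J"
      then obtain n where "J \<subseteq> {..<n}" using finite_nat_iff_bounded by auto
      then show "indep_sets (\<lambda>i. {(\<lambda>\<omega>. steps h \<omega> i) -` A \<inter> space M |A. A \<in> sets borel}) J"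
        by (rule indep_sets_mono_index[OF _ ind[of n, unfolded indep_vars_def2, THEN conjunct2]])
    qed
  qed
qed

lemma steps_distr:
  assumes h: "0 < h"
  shows "distr M (Pi\<^sub>M UNIV (\<lambda>_. borel)) (steps h) = Pi\<^sub>M UNIV (\<lambda>_. law h)"
proof -
  note steps_indep[OF h]
  then have "distr M (Pi\<^sub>M UNIV (\<lambda>_. borel)) (\<lambda>\<omega>. \<lambda>i\<in>UNIV. steps h \<omega> i)
      = Pi\<^sub>M UNIV (\<lambda>i. distr M borel (\<lambda>\<omega>. steps h \<omega> i))"
    by (subst (asm) indep_vars_iff_distr_eq_PiM) (use h in auto)
  then show ?thesis by (simp add: step_distr[OF h] restrict_UNIV)
qed

lemma steps_measurable [measurable]: "0 < h \<Longrightarrow> steps h \<in> M \<rightarrow>\<^sub>M Pi\<^sub>M UNIV (\<lambda>_. borel)"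
  by (rule measurable_PiM_single') (auto simp: space_PiM)

text \<open>The passage from the process to the product measure, on which the Markov property is
  available; since the steps are independent with a common law, the sampling may start at any index
  \<open>w\<close>.\<close>

lemma steps_prob:
  assumes h: "0 < h" and A: "Measurable.pred (Pi\<^sub>M UNIV (\<lambda>_. borel)) A"
  shows "prob {\<omega> \<in> space M. A (drop_steps w (steps h \<omega>))} = measure (Pi\<^sub>M UNIV (\<lambda>_. law h)) {s. A s}"
proof -
  interpret W: iid_steps "law h" by (rule iid_steps_law[OF h])
  have A': "Measurable.pred W.S A" using A by (simp cong: measurable_cong_sets add: W.sets_S)
  have B: "Measurable.pred (Pi\<^sub>M UNIV (\<lambda>_. borel)) (\<lambda>s. A (drop_steps w s))"
    by (rule measurable_compose[OF drop_steps_measurable_borel A])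
  have "measure W.S {s. A s} = measure W.S {s. A (drop_steps w s)}" using W.prob_shift[OF A'] by simp
  also have "\<dots> = measure (distr M (Pi\<^sub>M UNIV (\<lambda>_. borel)) (steps h)) {s. A (drop_steps w s)}"
    by (simp add: steps_distr[OF h])
  also have "\<dots> = prob (steps h -` {s. A (drop_steps w s)} \<inter> space M)"
    using B h by (intro measure_distr) (auto simp: pred_def space_PiM)
  also have "steps h -` {s. A (drop_steps w s)} \<inter> space M = {\<omega> \<in> space M. A (drop_steps w (steps h \<omega>))}" by auto
  finally show ?thesis ..
qed

lemma steps_prob_0:
  "0 < h \<Longrightarrow> Measurable.pred (Pi\<^sub>M UNIV (\<lambda>_. borel)) A \<Longrightarrow>
    prob {\<omega> \<in> space M. A (steps h \<omega>)} = measure (Pi\<^sub>M UNIV (\<lambda>_. law h)) {s. A s}"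
  using steps_prob[of h A 0] by simp

lemma step_prob:
  assumes h: "0 < h" and Q: "Measurable.pred borel Q"
  shows "prob {\<omega> \<in> space M. Q (steps h \<omega> i)} = prob {\<omega> \<in> space M. Q (X h \<omega> - X 0 \<omega>)}"
proof -
  have Q': "{y. Q y} \<in> sets borel" using Q by (simp add: pred_def)
  have "prob {\<omega> \<in> space M. Q (steps h \<omega> i)} = measure (distr M borel (\<lambda>\<omega>. steps h \<omega> i)) {y. Q y}"
    using Q' h by (subst measure_distr) (auto intro!: arg_cong[of _ _ prob])
  also have "\<dots> = prob {\<omega> \<in> space M. Q (X h \<omega> - X 0 \<omega>)}"
    unfolding step_distr[OF h] law_def using Q' h by (subst measure_distr) (auto intro!: arg_cong[of _ _ prob])
  finally show ?thesis .
qed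

text \<open>Stationarity carries the null event to every grid interval. The exceptional sets are
  countably many, and right-continuity extends the slope bound from the grids to all times.\<close>

lemma AE_slope:
  assumes h: "0 < h" and "\<And>K. prob {\<omega> \<in> space M. c * (h / 2^K) < X (h / 2^K) \<omega> - X 0 \<omega>} = 0"
  shows "AE \<omega> in M. \<forall>s t. 0 \<le> s \<and> s \<le> t \<longrightarrow> X t \<omega> - X s \<omega> \<le> c * (t - s)"
proof -
  have hK: "0 < h / 2^K" for K :: nat using h by simp
  have "AE \<omega> in M. steps (h / 2^K) \<omega> i \<le> c * (h / 2^K)" for K i
  proof -
    have "prob {\<omega> \<in> space M. c * (h / 2^K) < steps (h / 2^K) \<omega> i} = 0"
      using assms(2)[of K] step_prob[OF hK, of "\<lambda>y. c * (h / 2^K) < y" K i] by simp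
    then have "{\<omega> \<in> space M. c * (h / 2^K) < steps (h / 2^K) \<omega> i} \<in> null_sets M"
      using hK by (intro null_setsI) (auto simp: emeasure_eq_measure)
    then show ?thesis by (rule AE_I') auto
  qed
  then have "AE \<omega> in M. \<forall>K i. steps (h / 2^K) \<omega> i \<le> c * (h / 2^K)" by (simp add: AE_all_countable)
  then show ?thesis
    using AE_space
  proof (eventually_elim, intro impI allI)
    fix \<omega> assume \<omega>: "\<forall>K i. steps (h / 2^K) \<omega> i \<le> c * (h / 2^K)" "\<omega> \<in> space M"
    fix s t :: real assume "0 \<le> s \<and> s \<le> t"
    then show "X t \<omega> - X s \<omega> \<le> c * (t - s)"
      using \<omega>(1) by (intro grid_slope_imp_slope[OF paths[OF \<omega>(2)] h]) (auto simp: steps_def path_steps_def)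
  qed
qed

lemma not_AE_antimono:
  assumes "AE \<omega> in M. \<forall>s t. 0 \<le> s \<and> s \<le> t \<longrightarrow> X t \<omega> - X s \<omega> \<le> c * (t - s)"
  shows "0 < c"
proof (rule ccontr)
  assume c: "\<not> 0 < c"
  have "AE \<omega> in M. False"
    using assms not_monotone
  proof eventually_elim
    case (elim \<omega>)
    have "antimono_on {0..} (\<lambda>t. X t \<omega>)"
    proof (rule monotone_onI)
      fix s t :: real assume "s \<in> {0..}" "t \<in> {0..}" "s \<le> t"
      then have "X t \<omega> - X s \<omega> \<le> c * (t - s)" "c * (t - s) \<le> 0"
        using elim c by (auto intro: mult_nonpos_nonneg)
      then show "X s \<omega> \<ge> X t \<omega>" by linarith
    qed
    with elim show ?case by simp
  qed
  then show False by simp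
qed

text \<open>Otherwise 0 would be a slope bound, and almost every path would be decreasing.\<close>

lemma step_nonzero:
  obtains h where "0 < h" "0 < prob {\<omega> \<in> space M. X h \<omega> - X 0 \<omega> \<noteq> 0}"
proof (rule ccontr)
  assume "\<not> thesis"
  with that have *: "prob {\<omega> \<in> space M. X h \<omega> - X 0 \<omega> \<noteq> 0} = 0" if "0 < h" for h
    by (metis \<open>0 < h\<close> zero_less_measure_iff)
  have pos: "(0::real) < 1 / 2^K" for K :: nat by simp
  have "prob {\<omega> \<in> space M. 0 * (1 / 2^K) < X (1 / 2^K) \<omega> - X 0 \<omega>} \<le> prob {\<omega> \<in> space M. X (1 / 2^K) \<omega> - X 0 \<omega> \<noteq> 0}" for K :: nat
    by (intro finite_measure_mono) auto
  then have "prob {\<omega> \<in> space M. 0 * (1 / 2^K) < X (1 / 2^K) \<omega> - X 0 \<omega>} \<le> 0" for K :: nat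
    unfolding *[OF pos] .
  then have "prob {\<omega> \<in> space M. 0 * (1 / 2^K) < X (1 / 2^K) \<omega> - X 0 \<omega>} = 0" for K :: nat
    by (rule order.antisym[OF _ measure_nonneg])
  then have "(0::real) < 0" by (rule not_AE_antimono[OF AE_slope[OF zero_less_one]])
  then show False by simp
qed

text \<open>A nonzero increment exceeds some \<open>\<delta>\<close> in one of the two directions
  with positive probability, because the events for \<open>\<delta> = 1 / Suc n\<close> exhaust it;
  then \<open>walk_unbounded\<close> applies.\<close>

lemma grid_unbounded:
  obtains h where "0 < h" "prob {\<omega> \<in> space M. \<forall>i j. \<bar>psum (steps h \<omega>) i - psum (steps h \<omega>) j\<bar> \<le> K} = 0"
proof -
  obtain h where h: "0 < h" and pos: "0 < prob {\<omega> \<in> space M. X h \<omega> - X 0 \<omega> \<noteq> 0}" by (rule step_nonzero)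
  interpret W: iid_steps "law h" by (rule iid_steps_law[OF h])
  have "\<exists>\<delta>>0. \<exists>e\<in>{1,-1}. 0 < prob {\<omega> \<in> space M. \<delta> < e * (X h \<omega> - X 0 \<omega>)}"
  proof (rule ccontr)
    assume no: "\<not> ?thesis"
    have 0: "prob {\<omega> \<in> space M. \<delta> < e * (X h \<omega> - X 0 \<omega>)} = 0" if "0 < \<delta>" "e \<in> {1,-1}" for \<delta> e
      using no that by (auto simp: zero_less_measure_iff)
    have N: "{\<omega> \<in> space M. \<delta> < e * (X h \<omega> - X 0 \<omega>)} \<in> null_sets M" if "0 < \<delta>" "e \<in> {1,-1}" for \<delta> e
      using 0[OF that] h by (intro null_setsI) (auto simp: emeasure_eq_measure)
    have sub: "{\<omega> \<in> space M. X h \<omega> - X 0 \<omega> \<noteq> 0} \<subseteq> (\<Union>n::nat. {\<omega> \<in> space M. 1 / real (Suc n) < 1 * (X h \<omega> - X 0 \<omega>)}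
        \<union> {\<omega> \<in> space M. 1 / real (Suc n) < -1 * (X h \<omega> - X 0 \<omega>)})" (is "?A \<subseteq> ?B")
    proof
      fix \<omega> assume \<omega>: "\<omega> \<in> ?A"
      then have "0 < \<bar>X h \<omega> - X 0 \<omega>\<bar>" by auto
      then obtain n where "1 / real (Suc n) < \<bar>X h \<omega> - X 0 \<omega>\<bar>" using nat_approx_posE by blast
      then have "1 / real (Suc n) < 1 * (X h \<omega> - X 0 \<omega>) \<or> 1 / real (Suc n) < -1 * (X h \<omega> - X 0 \<omega>)"
        unfolding abs_if by (simp split: if_splits)
      then show "\<omega> \<in> ?B" using \<omega> by blast
    qed
    have "?B \<in> null_sets M" by (intro null_sets_UN null_sets.Un N) auto
    then have "?A \<in> null_sets M" by (rule null_sets_subset) (use h sub in auto)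
    then have "prob ?A = 0" by (simp add: measure_eq_0_null_sets)
    then show False using pos by simp
  qed
  then obtain \<delta> e where \<delta>: "0 < \<delta>" and e: "e = 1 \<or> e = -1"
    and pos': "0 < prob {\<omega> \<in> space M. \<delta> < e * (X h \<omega> - X 0 \<omega>)}" by blast
  have "prob {\<omega> \<in> space M. \<delta> < e * (X h \<omega> - X 0 \<omega>)} = prob {\<omega> \<in> space M. \<delta> < e * steps h \<omega> 0}"
    using step_prob[OF h, of "\<lambda>y. \<delta> < e * y" 0] by simp
  also have "\<dots> = measure W.S {s. \<delta> < e * s 0}" by (rule steps_prob_0[OF h]) measurable
  finally have "measure W.S {s. \<forall>i j. \<bar>psum s i - psum s j\<bar> \<le> K} = 0"
    using pos' by (intro W.walk_unbounded[OF e \<delta>]) simp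
  then have "prob {\<omega> \<in> space M. \<forall>i j. \<bar>psum (steps h \<omega>) i - psum (steps h \<omega>) j\<bar> \<le> K} = 0"
    by (subst steps_prob_0[OF h]) auto
  then show thesis using that h by blast
qed

end

section \<open>Creeping forces bounded variation\<close>

text \<open>Before the common time there is no ruin, so the perturbed process is nonnegative and the
  drawdown is at most \<open>C * (a - g t)\<close>. The first alternative is the case of two
  infinite times: this bound and \<open>g t < a\<close> then confine the path to a band around
  \<open>x\<close>.\<close>

lemma creeping_path:
  assumes f: "cadlag_no_positive_jumps (\<lambda>t. X t \<omega>)" and X0: "X 0 \<omega> = x" and x: "0 < x"
    and \<gamma>: "continuous_on {0..} \<gamma>" and a: "x < a" and C: "0 \<le> C"
    and up: "\<And>s. x \<le> s \<Longrightarrow> s \<le> a \<Longrightarrow> gamma_bar \<gamma> x s \<le> C * (a - s)"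
    and eq: "sigma_time X (ereal a) \<omega> = ruin_time \<gamma> X \<omega>"
  shows "(\<forall>t\<ge>0. \<bar>X t \<omega> - x\<bar> \<le> (C + 1) * (a - x)) \<or>
    (\<exists>s>0. (\<forall>r t. 0 \<le> r \<and> r \<le> t \<and> t < s \<longrightarrow> a - X t \<omega> \<le> (1 + C) * (a - X r \<omega>)) \<and>
       (\<forall>e>0. \<exists>r\<ge>0. r < s \<and> a - e < X r \<omega>))"
proof -
  define g where "g = path_sup (\<lambda>t. X t \<omega>)"
  have S: "running_sup X t \<omega> = g t" for t by (simp add: g_def running_sup_eq)
  have g0: "g 0 = x" using path_sup_0[OF f] X0 by (simp add: g_def)
  have gc: "continuous_on {0..} g" unfolding g_def by (rule path_sup_continuous[OF f])
  have gmono: "g s \<le> g t" if "0 \<le> s" "s \<le> t" for s t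
    unfolding g_def using path_sup_mono[OF f] that by simp
  have Xg: "X r \<omega> \<le> g t" if "0 \<le> r" "r \<le> t" for r t
    unfolding g_def using path_le_sup[OF f] that by simp
  have IVT: "\<exists>r>0. r \<le> t \<and> g r = a" if "0 \<le> t" "a \<le> g t" for t
  proof -
    have "\<exists>r\<ge>0. r \<le> t \<and> g r = a"
      by (rule IVT') (use that g0 a in \<open>auto intro: continuous_on_subset[OF gc]\<close>)
    then obtain r where "0 \<le> r" "r \<le> t" "g r = a" by blast
    then show ?thesis using g0 a by (intro exI[of _ r]) (cases "r = 0", auto)
  qed
  let ?\<sigma> = "sigma_time X (ereal a) \<omega>"
  have \<sigma>_def: "?\<sigma> = Inf (ereal ` {t. 0 < t \<and> g t = a})" by (simp add: sigma_time_def S)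
  have before: "g t < a \<and> a - X t \<omega> \<le> (1 + C) * (a - g t)" if t: "0 \<le> t" "ereal t < ?\<sigma>" for t
  proof
    show lt: "g t < a"
    proof (rule ccontr)
      assume "\<not> g t < a"
      then obtain r where "0 < r" "r \<le> t" "g r = a" using IVT[of t] t by auto
      then have "?\<sigma> \<le> ereal t" unfolding \<sigma>_def by (intro Inf_lower2[of "ereal r"]) auto
      with t show False by simp
    qed
    show "a - X t \<omega> \<le> (1 + C) * (a - g t)"
    proof (cases "t = 0")
      case True
      then show ?thesis using g0 X0 a C by (simp add: algebra_simps mult_left_mono)
    next
      case False
      have "\<not> perturbed \<gamma> X t \<omega> < 0"
      proof
        assume "perturbed \<gamma> X t \<omega> < 0"
        then have "ruin_time \<gamma> X \<omega> \<le> ereal t"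
          unfolding ruin_time_def using False t by (intro Inf_lower) auto
        with t eq show False by simp
      qed
      then have "g t - X t \<omega> \<le> gamma_bar \<gamma> x (g t)"
        using perturbed_eq[of X \<omega> x \<gamma> t] f x X0 \<gamma> t(1) by (simp add: S)
      also have "\<dots> \<le> C * (a - g t)" using lt gmono[of 0 t] g0 t by (intro up) auto
      finally show ?thesis by (simp add: algebra_simps)
    qed
  qed
  have \<sigma>0: "0 \<le> ?\<sigma>" unfolding \<sigma>_def by (intro Inf_greatest) auto
  show ?thesis
  proof (cases "?\<sigma> = \<infinity>")
    case True
    have "\<bar>X t \<omega> - x\<bar> \<le> (C + 1) * (a - x)" if t: "0 \<le> t" for t
    proof -
      have b: "g t < a" "a - X t \<omega> \<le> (1 + C) * (a - g t)" using before[OF t] True by auto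
      have "(1 + C) * (a - g t) \<le> (1 + C) * (a - x)"
        using gmono[of 0 t] g0 t C by (intro mult_left_mono) auto
      moreover have "X t \<omega> < a" using Xg[of t t] b t by simp
      moreover have "a - x \<le> (C + 1) * (a - x)" using C a mult_nonneg_nonneg[of C "a - x"] by (simp add: algebra_simps)
      ultimately show ?thesis using b a by (simp add: abs_le_iff algebra_simps)
    qed
    then show ?thesis by blast
  next
    case False
    then obtain s where s: "?\<sigma> = ereal s" using \<sigma>0 by (cases ?\<sigma>) auto
    have s0: "0 \<le> s" using \<sigma>0 s by simp
    \<comment> \<open>Times at level \<open>a\<close> converge to the infimum \<open>s\<close>, and
      continuity of \<open>g\<close> gives \<open>g s = a\<close>.\<close>
    have "\<exists>t. 0 < t \<and> g t = a \<and> t < s + 1 / Suc n" for n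
    proof -
      have "?\<sigma> < ereal (s + 1 / Suc n)" using s by simp
      then show ?thesis unfolding \<sigma>_def Inf_less_iff by auto
    qed
    then obtain t where t: "\<And>n. 0 < t n" "\<And>n. g (t n) = a" "\<And>n. t n < s + 1 / Suc n" by metis
    have ts: "s \<le> t n" for n
    proof -
      have "?\<sigma> \<le> ereal (t n)" unfolding \<sigma>_def using t by (intro Inf_lower) auto
      then show ?thesis using s by simp
    qed
    have "(\<lambda>n. s + 1 / Suc n) \<longlonglongrightarrow> s + 0" by (intro tendsto_add tendsto_const LIMSEQ_Suc[OF lim_1_over_n])
    then have "t \<longlonglongrightarrow> s"
      using tendsto_sandwich[OF always_eventually[OF allI] always_eventually[OF allI], of "\<lambda>_. s" t
          "\<lambda>n. s + 1 / Suc n" s sequentially, OF ts less_imp_le[OF t(3)] tendsto_const] by simp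
    then have "(\<lambda>n. g (t n)) \<longlonglongrightarrow> g s"
      using s0 t(1) by (intro continuous_on_tendsto_compose[OF gc]) (auto intro!: always_eventually less_imp_le)
    then have gs: "g s = a" using t(2) by (simp add: LIMSEQ_const_iff)
    then have spos: "0 < s" using s0 g0 a by (cases "s = 0") auto
    have "a - X t \<omega> \<le> (1 + C) * (a - X r \<omega>)" if "0 \<le> r" "r \<le> t" "t < s" for r t
    proof -
      have "a - X t \<omega> \<le> (1 + C) * (a - g t)" using before[of t] that s by auto
      also have "\<dots> \<le> (1 + C) * (a - X r \<omega>)" using Xg[of r t] that C by (intro mult_left_mono) auto
      finally show ?thesis .
    qed
    \<comment> \<open>If \<open>X\<close> stayed at or below \<open>a - e\<close> until
      \<open>s\<close>, so would \<open>g\<close>, and by continuity \<open>g s\<close> could not be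
      \<open>a\<close>.\<close>
    moreover have "\<exists>r\<ge>0. r < s \<and> a - e < X r \<omega>" if e: "0 < e" for e
    proof (rule ccontr)
      assume no: "\<not> ?thesis"
      have le: "g u \<le> a - e" if "0 \<le> u" "u < s" for u
      proof -
        have "X r \<omega> \<le> a - e" if "r \<in> {0..u}" for r using no that \<open>u < s\<close> by (meson atLeastAtMost_iff le_less_trans not_le)
        then show ?thesis unfolding g_def using that by (subst path_sup_le_iff[OF f]) auto
      qed
      define u where "u n = s - s / Suc n" for n
      have u: "0 \<le> u n" "u n < s" for n using spos by (auto simp: u_def field_simps)
      have "(\<lambda>n. s - s * (1 / Suc n)) \<longlonglongrightarrow> s - s * 0"
        by (intro tendsto_diff tendsto_mult tendsto_const LIMSEQ_Suc[OF lim_1_over_n])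
      then have "u \<longlonglongrightarrow> s" by (simp add: u_def[abs_def])
      then have "(\<lambda>n. g (u n)) \<longlonglongrightarrow> g s"
        using s0 u by (intro continuous_on_tendsto_compose[OF gc]) auto
      then have "g s \<le> a - e" using le u by (intro LIMSEQ_le_const2) auto
      then show False using gs e by simp
    qed
    ultimately show ?thesis using spos by blast
  qed
qed

lemma good_path_imp_good_hit:
  assumes f: "cadlag_no_positive_jumps f" and L: "L = a - f 0" "0 < L"
    and good: "\<And>r t. 0 \<le> r \<Longrightarrow> r \<le> t \<Longrightarrow> t < s \<Longrightarrow> a - f t \<le> (1 + C) * (a - f r)"
    and app: "\<And>e. 0 < e \<Longrightarrow> \<exists>r\<ge>0. r < s \<and> a - e < f r" and \<eta>: "0 < \<eta>"
  shows "\<exists>K1. \<forall>K\<ge>K1. \<exists>j. good_hit L C \<eta> n j (path_steps f (1 / 2^K))"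
proof -
  obtain r where r: "0 \<le> r" "r < s" "a - L / 2^n < f r" using app[of "L / 2^n"] L by auto
  have "(f \<longlongrightarrow> f r) (at_right r)" using f r by (auto simp: cadlag_no_positive_jumps_def)
  then have "eventually (\<lambda>v. a - L / 2^n < f v) (at_right r)" using r by (intro order_tendstoD)
  then obtain b where b: "r < b" "\<And>v. r < v \<Longrightarrow> v < b \<Longrightarrow> a - L / 2^n < f v"
    unfolding eventually_at_right_field by blast
  obtain d where d: "d > 0" "\<And>u v. 0 \<le> u \<and> u \<le> v \<and> v \<le> s \<and> v - u < d \<Longrightarrow> f v - f u \<le> \<eta>"
    using cadlag_small_rise[OF f \<eta>, of s] by blast
  \<comment> \<open>A mesh below \<open>m\<close> puts the first grid point from \<open>r\<close> on
    where the path is still above \<open>a - L / 2^n\<close> (first term) and before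
    \<open>s\<close> (second term), and it keeps every rise over one grid step within
    \<open>\<eta>\<close> (third term).\<close>
  define m where "m = min (min (b - r) (s - r)) d"
  have m: "0 < m" using b r d by (simp add: m_def)
  obtain K1 where K1: "(1/2::real)^K1 < m" using real_arch_pow_inv[OF m, of "1/2"] by auto
  show ?thesis
  proof (rule exI[of _ K1], intro allI impI)
    fix K assume K: "K1 \<le> K"
    let ?h = "1 / 2^K :: real"
    have h: "?h < m"
    proof -
      have "?h = (1/2)^K" by (simp add: power_one_over)
      also have "\<dots> \<le> (1/2)^K1" using K by (intro power_decreasing) auto
      finally show ?thesis using K1 by simp
    qed
    define i where "i = nat \<lceil>r * 2^K / 1\<rceil>"
    have i: "r \<le> real i * ?h" "real i * ?h < r + ?h"
      using grid_above(1,2)[OF r(1) zero_less_one, of K] unfolding i_def by auto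
    have his: "real i * ?h < s" using i(2) h by (simp add: m_def)
    have fi: "a - L / 2^n < f (real i * ?h)"
      using b(2)[of "real i * ?h"] r(3) i h by (cases "real i * ?h = r") (auto simp: m_def)
    let ?s = "path_steps f ?h"
    have P: "psum ?s k = f (real k * ?h) - f 0" for k by (rule psum_path_steps_0)
    define j where "j = (LEAST k. L - L / 2^n \<le> psum ?s k)"
    have Pi: "L - L / 2^n \<le> psum ?s i" unfolding P using fi L by linarith
    have j: "L - L / 2^n \<le> psum ?s j" unfolding j_def by (rule LeastI[of _ i]) (rule Pi)
    have ji: "j \<le> i" unfolding j_def by (rule Least_le) (rule Pi)
    have below: "psum ?s k < L - L / 2^n" if "k < j" for k
      using not_less_Least[of k "\<lambda>k. L - L / 2^n \<le> psum ?s k"] that unfolding j_def by auto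
    have time: "real k * ?h < s" if "k \<le> j" for k
    proof -
      have "real k * ?h \<le> real i * ?h" using that ji by (intro mult_right_mono) auto
      then show ?thesis using his by linarith
    qed
    have step: "?s k \<le> \<eta>" if "k < j" for k
    proof -
      have eq: "real (Suc k) * ?h - real k * ?h = ?h" by (simp add: field_simps)
      have "real (Suc k) * ?h < s" by (rule time) (use that in simp)
      moreover have "real k * ?h \<le> real (Suc k) * ?h" by (intro mult_right_mono) auto
      ultimately show ?thesis unfolding path_steps_def using eq h
        by (intro d(2)) (auto simp: m_def)
    qed
    have "L - psum ?s k \<le> (1 + C) * (L - psum ?s k')" if "k \<le> j" "k' \<le> k" for k k'
    proof -
      have "real k' * ?h \<le> real k * ?h" using that by (intro mult_right_mono) auto
      then have "a - f (real k * ?h) \<le> (1 + C) * (a - f (real k' * ?h))"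
        using time[OF that(1)] by (intro good) auto
      then show ?thesis unfolding P L(1) by simp
    qed
    then show "\<exists>j. good_hit L C \<eta> n j ?s"
      unfolding good_hit_def using j below step by blast
  qed
qed

section \<open>Upward variation and upcrossings\<close>

lemma upward_variation_refine:
  fixes g :: "nat \<Rightarrow> real"
  shows "(\<Sum>i<n. max 0 (g (2 * Suc i) - g (2 * i))) \<le> (\<Sum>i<2 * n. max 0 (g (Suc i) - g i))"
proof (induction n)
  case (Suc n)
  have "2 * Suc n = Suc (Suc (2 * n))" by simp
  then show ?case using Suc by (simp add: max_def)
qed simp

lemma upward_variation_halving:
  fixes \<phi> :: "real \<Rightarrow> real"
  shows "(\<Sum>i<n. max 0 (\<phi> (real (u + Suc i) * h) - \<phi> (real (u + i) * h)))
       \<le> (\<Sum>i<2 * n. max 0 (\<phi> (real (2 * u + Suc i) * (h / 2)) - \<phi> (real (2 * u + i) * (h / 2))))"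
  using upward_variation_refine[of "\<lambda>i. \<phi> (real (2 * u + i) * (h / 2))" n] by (simp add: algebra_simps)

text \<open>Truncation confines the levels to \<open>{-R<..R}\<close>, so that integrating the
  upcrossing bound over them gives a finite value. Paths are bounded on bounded time intervals, so
  there a large \<open>R\<close> changes nothing.\<close>

definition trunc :: "real \<Rightarrow> real \<Rightarrow> real" where
  "trunc R y = max (- R) (min R y)"

lemma trunc_measurable [measurable]: "trunc R \<in> borel_measurable borel"
  unfolding trunc_def[abs_def] by measurable

lemma trunc_id: "\<bar>y\<bar> \<le> R \<Longrightarrow> trunc R y = y"
  by (auto simp: trunc_def)

lemma trunc_rise_eq_nn_integral:
  assumes "0 \<le> R"
  shows "ennreal (max 0 (trunc R v - trunc R u)) = (\<integral>\<^sup>+y. indicator {-R<..R} y * indicator {u<..v} y \<partial>lborel)"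
proof -
  have "(\<integral>\<^sup>+y. indicator {-R<..R} y * indicator {u<..v} y \<partial>lborel) = (\<integral>\<^sup>+y. indicator {max (-R) u<..min R v} y \<partial>lborel)"
    by (intro nn_integral_cong) (auto simp: indicator_def)
  also have "\<dots> = emeasure lborel {max (-R) u<..min R v}" by (rule nn_integral_indicator) simp
  also have "\<dots> = ennreal (max 0 (min R v - max (-R) u))"
    by (cases "max (-R) u \<le> min R v") (auto simp: max_def)
  also have "max 0 (min R v - max (-R) u) = max 0 (trunc R v - trunc R u)"
    using assms by (auto simp: trunc_def max_def min_def)
  finally show ?thesis ..
qed

context iid_steps
begin

lemma truncated_variation_le:
  assumes R: "0 \<le> R" and q: "0 < q" "q \<le> measure S {s. \<forall>i\<le>n. 0 \<le> psum s i}"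
  shows "(\<integral>\<^sup>+s. ennreal (\<Sum>j<n. max 0 (trunc R (psum s (Suc j)) - trunc R (psum s j))) \<partial>S) \<le> ennreal (2 * R / q)"
proof -
  interpret pair_sigma_finite lborel S
    by (intro pair_sigma_finite.intro sigma_finite_lborel P.sigma_finite_measure_axioms)
  have "(\<integral>\<^sup>+s. ennreal (\<Sum>j<n. max 0 (trunc R (psum s (Suc j)) - trunc R (psum s j))) \<partial>S)
      = (\<integral>\<^sup>+s. (\<Sum>j<n. \<integral>\<^sup>+y. indicator {-R<..R} y * indicator {psum s j<..psum s (Suc j)} y \<partial>lborel) \<partial>S)"
    by (intro nn_integral_cong) (subst sum_ennreal[symmetric], simp, simp only: trunc_rise_eq_nn_integral[OF R])
  also have "\<dots> = (\<Sum>j<n. \<integral>\<^sup>+s. \<integral>\<^sup>+y. indicator {-R<..R} y * indicator {psum s j<..psum s (Suc j)} y \<partial>lborel \<partial>S)"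
    by (intro nn_integral_sum) (simp add: trunc_rise_eq_nn_integral[OF R, symmetric])
  also have "\<dots> = (\<Sum>j<n. \<integral>\<^sup>+y. \<integral>\<^sup>+s. indicator {-R<..R} y * indicator {psum s j<..psum s (Suc j)} y \<partial>S \<partial>lborel)"
  proof (intro sum.cong refl Fubini')
    fix j
    have "(\<lambda>(y, s). indicator {-R<..R} y * indicator {(y, s). psum s j < y \<and> y \<le> psum s (Suc j)} (y, s) :: ennreal)
        \<in> borel_measurable (lborel \<Otimes>\<^sub>M S)" by measurable
    then show "(\<lambda>(y, s). indicator {-R<..R} y * indicator {psum s j<..psum s (Suc j)} y :: ennreal)
        \<in> borel_measurable (lborel \<Otimes>\<^sub>M S)"
      by (rule measurable_cong[THEN iffD1, rotated]) (auto simp: indicator_def)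
  qed
  also have "\<dots> = (\<Sum>j<n. \<integral>\<^sup>+y. indicator {-R<..R} y * ennreal (measure S {s. psum s j < y \<and> y \<le> psum s (Suc j)}) \<partial>lborel)"
  proof (intro sum.cong refl nn_integral_cong)
    fix j y
    have "(\<integral>\<^sup>+s. indicator {-R<..R} y * indicator {psum s j<..psum s (Suc j)} y \<partial>S)
        = (\<integral>\<^sup>+s. indicator {-R<..R} y * indicator {s. psum s j < y \<and> y \<le> psum s (Suc j)} s \<partial>S)"
      by (intro nn_integral_cong) (auto simp: indicator_def)
    also have "\<dots> = indicator {-R<..R} y * emeasure S {s. psum s j < y \<and> y \<le> psum s (Suc j)}"
      by (rule nn_integral_cmult_indicator) (rule Collect_sets, measurable)
    finally show "(\<integral>\<^sup>+s. indicator {-R<..R} y * indicator {psum s j<..psum s (Suc j)} y \<partial>S)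
        = indicator {-R<..R} y * ennreal (measure S {s. psum s j < y \<and> y \<le> psum s (Suc j)})"
      by (simp add: P.emeasure_eq_measure)
  qed
  also have "\<dots> = (\<integral>\<^sup>+y. (\<Sum>j<n. indicator {-R<..R} y * ennreal (measure S {s. psum s j < y \<and> y \<le> psum s (Suc j)})) \<partial>lborel)"
  proof (intro nn_integral_sum[symmetric])
    fix j
    have "(\<lambda>y. emeasure S (Pair y -` {(y, s). psum s j < y \<and> y \<le> psum s (Suc j)})) \<in> borel_measurable lborel"
    proof (rule measurable_emeasure_Pair1)
      have "Measurable.pred (lborel \<Otimes>\<^sub>M S) (\<lambda>(y, s). psum s j < y \<and> y \<le> psum s (Suc j))" by measurable
      then show "{(y, s). psum s j < y \<and> y \<le> psum s (Suc j)} \<in> sets (lborel \<Otimes>\<^sub>M S)"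
        by (simp add: pred_def space_pair_measure)
    qed
    then have [measurable]: "(\<lambda>y. ennreal (measure S {s. psum s j < y \<and> y \<le> psum s (Suc j)})) \<in> borel_measurable lborel"
      by (simp add: P.emeasure_eq_measure)
    show "(\<lambda>y. indicator {-R<..R} y * ennreal (measure S {s. psum s j < y \<and> y \<le> psum s (Suc j)})) \<in> borel_measurable lborel"
      by measurable
  qed
  also have "\<dots> \<le> (\<integral>\<^sup>+y. ennreal (1 / q) * indicator {-R<..R} y \<partial>lborel)"
  proof (rule nn_integral_mono)
    fix y
    let ?m = "\<Sum>j<n. measure S {s. psum s j < y \<and> y \<le> psum s (Suc j)}"
    have "?m * q \<le> ?m * measure S {s. \<forall>i\<le>n. 0 \<le> psum s i}"
      by (intro mult_left_mono q sum_nonneg) simp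
    also have "\<dots> \<le> 1" by (rule sum_upcrossing_le)
    finally have "?m \<le> 1 / q" using q by (simp add: field_simps)
    then show "(\<Sum>j<n. indicator {-R<..R} y * ennreal (measure S {s. psum s j < y \<and> y \<le> psum s (Suc j)}))
        \<le> ennreal (1 / q) * indicator {-R<..R} y"
      unfolding sum_distrib_left[symmetric] by (auto simp: indicator_def intro!: ennreal_leI)
  qed
  also have "\<dots> = ennreal (1 / q) * emeasure lborel {-R<..R}"
    by (rule nn_integral_cmult_indicator) simp
  also have "\<dots> = ennreal (2 * R / q)"
    using R q by (simp add: ennreal_mult[symmetric])
  finally show ?thesis .
qed

end

section \<open>From creeping to bounded variation\<close>

context spectrally_negative_levy_process
begin

lemma creeping_imp_stays_above:
  assumes x: "0 < x" and \<gamma>: "continuous_on {0..} \<gamma>" and \<gamma>1: "\<gamma> ` {0..} \<subseteq> {1<..}"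
    and fin: "a_star \<gamma> x < \<infinity>"
    and pos: "0 < measure M {\<omega> \<in> space M. sigma_time X (a_star \<gamma> x) \<omega> = ruin_time \<gamma> X \<omega>}"
  obtains e q where "0 < q"
    "\<And>K. prob {\<omega> \<in> space M. \<forall>i\<le>2^K. 0 \<le> psum (steps (1 / 2^(e + K)) \<omega>) i} \<ge> q"
proof -
  obtain a c C where a: "a_star \<gamma> x = ereal a" "x < a" and cC: "0 < c" "c \<le> C"
    and up: "\<And>s. x \<le> s \<Longrightarrow> s \<le> a \<Longrightarrow> c * (a - s) \<le> gamma_bar \<gamma> x s \<and> gamma_bar \<gamma> x s \<le> C * (a - s)"
    by (rule gamma_bar_props[OF x \<gamma> \<gamma>1 fin]) blast
  have C: "0 \<le> C" using cC by simp
  define L where "L = a - x"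
  have L: "0 < L" using a by (simp add: L_def)
  have hpos: "(0::real) < 1 / 2^K" for K :: nat by simp
  let ?E = "{\<omega> \<in> space M. sigma_time X (a_star \<gamma> x) \<omega> = ruin_time \<gamma> X \<omega>}"
  have E: "?E \<in> events" by (rule creeping_event_measurable[OF x \<gamma> \<gamma>1 fin])
  obtain h where h: "0 < h" and N0: "prob {\<omega> \<in> space M. \<forall>i j. \<bar>psum (steps h \<omega>) i - psum (steps h \<omega>) j\<bar> \<le> 2 * ((C + 1) * L)} = 0"
    by (rule grid_unbounded)
  let ?N = "{\<omega> \<in> space M. \<forall>i j. \<bar>psum (steps h \<omega>) i - psum (steps h \<omega>) j\<bar> \<le> 2 * ((C + 1) * L)}"
  let ?O = "{\<omega> \<in> space M. X 0 \<omega> \<noteq> x}"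
  have "Measurable.pred (Pi\<^sub>M UNIV (\<lambda>_. borel)) (\<lambda>s. \<forall>i j. \<bar>psum s i - psum s j\<bar> \<le> 2 * ((C + 1) * L))" by measurable
  from measurable_compose[OF steps_measurable[OF h] this] have N: "?N \<in> events" by (simp add: pred_def)
  have O: "?O \<in> events" by (intro borel_measurable_neq X_measurable borel_measurable_const) simp
  have "prob ?O = 0"
    using start O by (subst prob_eq_0) (auto elim!: eventually_mono)
  \<comment> \<open>Off this null set a creeping outcome starts at \<open>x\<close> and leaves the
    band, so it falls under the second alternative of \<open>creeping_path\<close>.\<close>
  define Q where "Q = ?N \<union> ?O"
  have Q: "Q \<in> events" "prob Q \<le> 0"
    using N O measure_Un_le[OF N O] N0 \<open>prob ?O = 0\<close> unfolding Q_def by (blast, simp only:)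
  define E' where "E' = ?E - Q"
  have E': "E' \<in> events" unfolding E'_def by (rule sets.Diff[OF E Q(1)])
  have "prob ?E \<le> prob (E' \<union> Q)" by (rule finite_measure_mono[OF _ sets.Un[OF E' Q(1)]]) (simp add: E'_def)
  also have "\<dots> \<le> prob E' + prob Q" by (rule measure_Un_le[OF E' Q(1)])
  finally have g: "0 < prob E'" using pos Q(2) by linarith
  define g where "g = prob E'"
  \<comment> \<open>\<open>L / 2^n / 4\<close> is the largest step size that
    \<open>good_hit_imp_reach\<close> admits for this \<open>n\<close>.\<close>
  define G where "G n K = {\<omega> \<in> space M. \<exists>j. good_hit L C (L / 2^n / 4) (Suc n) j (steps (1 / 2^K) \<omega>)}" for n K
  have Gm: "G n K \<in> events" for n K
  proof -
    have "Measurable.pred (Pi\<^sub>M UNIV (\<lambda>_. borel)) (\<lambda>s. \<exists>j. good_hit L C (L / 2^n / 4) (Suc n) j s)"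
      by (intro pred_intros_countable(2) good_hit_measurable_borel)
    from measurable_compose[OF steps_measurable[OF hpos[of K]] this] show ?thesis by (simp add: pred_def G_def)
  qed
  have sub: "E' \<subseteq> (\<Union>k. \<Inter>K\<in>{k..}. G n K)" for n
  proof
    fix \<omega> assume \<omega>: "\<omega> \<in> E'"
    then have w: "\<omega> \<in> space M" "X 0 \<omega> = x" "sigma_time X (ereal a) \<omega> = ruin_time \<gamma> X \<omega>" "\<omega> \<notin> ?N"
      unfolding E'_def Q_def a(1) by blast+
    have f: "cadlag_no_positive_jumps (\<lambda>t. X t \<omega>)" by (rule paths[OF w(1)])
    have "\<not> (\<forall>t\<ge>0. \<bar>X t \<omega> - x\<bar> \<le> (C + 1) * (a - x))"
    proof
      assume *: "\<forall>t\<ge>0. \<bar>X t \<omega> - x\<bar> \<le> (C + 1) * (a - x)"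
      have "\<bar>psum (steps h \<omega>) i - psum (steps h \<omega>) j\<bar> \<le> 2 * ((C + 1) * L)" for i j
        using *[rule_format, of "real i * h"] *[rule_format, of "real j * h"] h
        unfolding steps_def psum_path_steps_0 L_def by simp
      with w show False by blast
    qed
    then obtain s where s: "\<forall>r t. 0 \<le> r \<and> r \<le> t \<and> t < s \<longrightarrow> a - X t \<omega> \<le> (1 + C) * (a - X r \<omega>)"
      "\<forall>e>0. \<exists>r\<ge>0. r < s \<and> a - e < X r \<omega>"
      using creeping_path[OF f w(2) x \<gamma> a(2) C _ w(3)] up by blast
    have "\<exists>K1. \<forall>K\<ge>K1. \<exists>j. good_hit L C (L / 2^n / 4) (Suc n) j (path_steps (\<lambda>t. X t \<omega>) (1 / 2^K))"
      by (rule good_path_imp_good_hit[OF f _ L, where a = a and s = s]) (use s w L in \<open>auto simp: L_def\<close>)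
    then show "\<omega> \<in> (\<Union>k. \<Inter>K\<in>{k..}. G n K)" using w(1) by (auto simp: G_def steps_def)
  qed
  \<comment> \<open>Every good path lies in \<open>G n K\<close> for all large \<open>K\<close>, but
    the threshold depends on the path; continuity of the measure from below gives a common one at
    the price of half the probability.\<close>
  have exk: "\<exists>k. \<forall>K\<ge>k. g / 2 < prob (G n K)" for n
  proof -
    define A where "A k = (\<Inter>K\<in>{k..}. G n K)" for k
    have Am: "A k \<in> events" for k unfolding A_def by (intro sets.countable_INT') (auto simp: Gm)
    have "(\<lambda>k. prob (A k)) \<longlonglongrightarrow> prob (\<Union>k. A k)"
      by (rule finite_Lim_measure_incseq) (use Am in \<open>auto simp: incseq_def A_def\<close>)
    moreover have "g \<le> prob (\<Union>k. A k)"
      unfolding g_def using sub[of n] Am by (intro finite_measure_mono) (auto simp: A_def)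
    then have "g / 2 < prob (\<Union>k. A k)" using g by (simp add: g_def)
    ultimately have "eventually (\<lambda>k. g / 2 < prob (A k)) sequentially" by (rule order_tendstoD)
    then obtain k where k: "g / 2 < prob (A k)" by (auto simp: eventually_sequentially)
    have "prob (A k) \<le> prob (G n K)" if "k \<le> K" for K
      using that Gm by (intro finite_measure_mono) (auto simp: A_def)
    with k show ?thesis by (intro exI[of _ k]) (auto intro: less_le_trans)
  qed
  obtain m :: nat where m: "4 * (C + 1) \<le> real m" using real_arch_simple by blast
  define Y where "Y = (C + 1) * L"
  have Y: "0 < Y" using C L by (simp add: Y_def)
  have reach: "\<exists>k. \<forall>K\<ge>k. (g / 2) ^ m \<le> prob {\<omega> \<in> space M. reach (Y / 2^n) (Y / 2) (steps (1 / 2^K) \<omega>)}" if n: "0 < n" for n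
  proof -
    obtain k where k: "\<And>K. k \<le> K \<Longrightarrow> g / 2 < prob (G n K)" using exk[of n] by blast
    have "(g / 2) ^ m \<le> prob {\<omega> \<in> space M. reach (Y / 2^n) (Y / 2) (steps (1 / 2^K) \<omega>)}" if "k \<le> K" for K
    proof -
      interpret W: iid_steps "law (1 / 2^K)" by (rule iid_steps_law[OF hpos])
      have "prob (G n K) = measure W.S {s. \<exists>j. good_hit L C (L / 2^n / 4) (Suc n) j s}"
        unfolding G_def by (rule steps_prob_0[OF hpos]) measurable
      then have "(g / 2) ^ m \<le> measure W.S {s. \<exists>j. good_hit L C (L / 2^n / 4) (Suc n) j s} ^ m"
        using k[OF that] g by (intro power_mono) (auto simp: g_def)
      also have "\<dots> \<le> W.reach_prob (Y / 2^n) (Y - Y / 2^n)"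
        unfolding Y_def by (rule W.good_hit_imp_reach[OF L C order_refl m])
      also have "\<dots> \<le> W.reach_prob (Y / 2^n) (Y / 2)"
      proof (rule W.reach_prob_mono)
        have "Y / 2^n \<le> Y / 2^1" using Y n by (intro divide_left_mono power_increasing) auto
        then show "Y / 2 \<le> Y - Y / 2^n" by simp
      qed simp
      also have "\<dots> = prob {\<omega> \<in> space M. reach (Y / 2^n) (Y / 2) (steps (1 / 2^K) \<omega>)}"
        unfolding W.reach_prob_def by (rule steps_prob_0[OF hpos, symmetric]) measurable
      finally show ?thesis .
    qed
    then show ?thesis by blast
  qed
  define q where "q = (g / 2) ^ m / 2"
  have q: "0 < q" using g by (simp add: q_def g_def)
  \<comment> \<open>A rise by \<open>Y / 2\<close> within time \<open>1 / 2^e\<close> becomes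
    unlikely as \<open>e\<close> grows. So reaching \<open>Y / 2\<close> before a small fall mostly
    takes longer than \<open>1 / 2^e\<close>, and during that time the walk has not fallen. The
    exception costs less than \<open>q\<close>, which is half of the bound for
    \<open>reach\<close>.\<close>
  define B where "B e = {\<omega> \<in> space M. Y / 2 \<le> running_sup X (1 / 2^e) \<omega> - X 0 \<omega>}" for e :: nat
  have Bm: "B e \<in> events" for e unfolding B_def by measurable
  obtain e where e: "prob (B e) < q"
  proof -
    have pw: "(1::real) / 2^v \<le> 1 / 2^u" if "u \<le> v" for u v :: nat
      using that by (intro divide_left_mono power_increasing) auto
    have dec: "decseq B"
      unfolding decseq_def B_def using path_sup_mono[OF paths _ pw]
      by (auto simp: running_sup_eq) (smt (verit) divide_nonneg_nonneg zero_le_power)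
    have empty: "(\<Inter>e. B e) = {}"
    proof (rule ccontr)
      assume "(\<Inter>e. B e) \<noteq> {}"
      then obtain \<omega> where \<omega>: "\<And>e. \<omega> \<in> B e" by blast
      then have f: "cadlag_no_positive_jumps (\<lambda>t. X t \<omega>)" using paths by (auto simp: B_def)
      have "(\<lambda>e. (1::real) / 2^e) \<longlonglongrightarrow> 0" by (rule LIMSEQ_divide_realpow_zero) simp
      then have "(\<lambda>e. running_sup X (1 / 2^e) \<omega>) \<longlonglongrightarrow> running_sup X 0 \<omega>"
        unfolding running_sup_eq by (intro continuous_on_tendsto_compose[OF path_sup_continuous[OF f]]) auto
      then have "(\<lambda>e. running_sup X (1 / 2^e) \<omega> - X 0 \<omega>) \<longlonglongrightarrow> running_sup X 0 \<omega> - X 0 \<omega>"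
        by (intro tendsto_intros)
      then have "Y / 2 \<le> running_sup X 0 \<omega> - X 0 \<omega>"
        by (rule LIMSEQ_le_const) (use \<omega> in \<open>auto simp: B_def\<close>)
      then show False using path_sup_0[OF f] Y by (simp add: running_sup_eq)
    qed
    have "(\<lambda>e. prob (B e)) \<longlonglongrightarrow> prob (\<Inter>e. B e)"
      by (rule finite_Lim_measure_decseq[OF _ dec]) (use Bm in auto)
    then have "eventually (\<lambda>e. prob (B e) < q) sequentially"
      unfolding empty using q by (intro order_tendstoD(2)) auto
    then show thesis using that by (auto simp: eventually_sequentially)
  qed
  have above: "{\<omega> \<in> space M. \<forall>i\<le>2^K. z \<le> psum (steps (1 / 2^(e + K)) \<omega>) i} \<in> events" for z K
  proof -
    have "Measurable.pred (Pi\<^sub>M UNIV (\<lambda>_. borel)) (\<lambda>s. \<forall>i\<le>2^K. z \<le> psum s i)" by measurable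
    from measurable_compose[OF steps_measurable[OF hpos[of "e + K"]] this] show ?thesis by (simp add: pred_def)
  qed
  have main: "q \<le> prob {\<omega> \<in> space M. \<forall>i\<le>2^K0. - (Y / 2^n) \<le> psum (steps (1 / 2^(e + K0)) \<omega>) i}" (is "_ \<le> prob ?A")
    if n: "0 < n" for n K0
  proof -
    obtain k where k: "\<And>K. k \<le> K \<Longrightarrow> (g / 2) ^ m \<le> prob {\<omega> \<in> space M. reach (Y / 2^n) (Y / 2) (steps (1 / 2^K) \<omega>)}"
      using reach[OF n] by blast
    \<comment> \<open>This grid is fine enough for the bound on \<open>reach\<close>, and it
      contains the grid of mesh \<open>1 / 2^(e + K0)\<close>, whose index \<open>i\<close> becomes
      \<open>i * 2^k\<close>.\<close>
    let ?K = "e + K0 + k"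
    have Am: "?A \<in> events" by (rule above)
    have "{\<omega> \<in> space M. reach (Y / 2^n) (Y / 2) (steps (1 / 2^?K) \<omega>)} \<subseteq> B e \<union> ?A"
    proof safe
      fix \<omega> and i :: nat assume w: "\<omega> \<in> space M" "reach (Y / 2^n) (Y / 2) (steps (1 / 2^?K) \<omega>)" "\<omega> \<notin> B e"
        and i: "i \<le> 2^K0"
      obtain j where j: "Y / 2 \<le> psum (steps (1 / 2^?K) \<omega>) j" "\<forall>i\<le>j. - (Y / 2^n) \<le> psum (steps (1 / 2^?K) \<omega>) i"
        using w(2) by (auto simp: reach_def)
      have "\<not> j \<le> 2^(K0 + k)"
      proof
        assume jle: "j \<le> 2^(K0 + k)"
        have "real j * (1 / 2^?K) \<le> 2^(K0 + k) * (1 / 2^?K)"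
          using of_nat_mono[OF jle, where 'a = real] by (intro mult_right_mono) simp_all
        also have "\<dots> = 1 / 2^e" by (simp add: power_add)
        finally have "X (real j * (1 / 2^?K)) \<omega> \<le> running_sup X (1 / 2^e) \<omega>"
          unfolding running_sup_eq by (intro path_le_sup[OF paths[OF w(1)]]) auto
        then have "\<omega> \<in> B e" using j(1) w(1) by (simp add: B_def steps_def psum_path_steps_0)
        with w show False by simp
      qed
      moreover have "i * 2^k \<le> 2^K0 * 2^k" using i by (intro mult_right_mono) auto
      ultimately have "i * 2^k \<le> j" unfolding power_add by linarith
      then have "- (Y / 2^n) \<le> psum (steps (1 / 2^?K) \<omega>) (i * 2^k)" using j(2) by blast
      also have "\<dots> = psum (steps (1 / 2^(e + K0)) \<omega>) i"
        by (simp add: steps_def psum_path_steps_0 power_add)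
      finally show "- (Y / 2^n) \<le> psum (steps (1 / 2^(e + K0)) \<omega>) i" .
    qed
    then have "prob {\<omega> \<in> space M. reach (Y / 2^n) (Y / 2) (steps (1 / 2^?K) \<omega>)} \<le> prob (B e) + prob ?A"
      using Am Bm by (intro order_trans[OF finite_measure_mono measure_Un_le]) auto
    moreover have "2 * q \<le> prob {\<omega> \<in> space M. reach (Y / 2^n) (Y / 2) (steps (1 / 2^?K) \<omega>)}"
      using k[of ?K] by (simp add: q_def)
    ultimately show ?thesis using e by linarith
  qed
  have "q \<le> prob {\<omega> \<in> space M. \<forall>i\<le>2^K. 0 \<le> psum (steps (1 / 2^(e + K)) \<omega>) i}" for K
  proof -
    define A where "A n = {\<omega> \<in> space M. \<forall>i\<le>2^K. - (Y / 2^Suc n) \<le> psum (steps (1 / 2^(e + K)) \<omega>) i}" for n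
    have Am: "A n \<in> events" for n unfolding A_def by (rule above)
    have "Y / 2^Suc v \<le> Y / 2^Suc u" if "u \<le> v" for u v :: nat
      using that Y by (intro divide_left_mono power_increasing) auto
    then have dec: "decseq A" unfolding decseq_def A_def by fastforce
    have "(\<lambda>n. prob (A n)) \<longlonglongrightarrow> prob (\<Inter>n. A n)"
      by (rule finite_Lim_measure_decseq[OF _ dec]) (use Am in auto)
    then have "q \<le> prob (\<Inter>n. A n)"
    proof (rule LIMSEQ_le_const, intro exI allI impI)
      show "q \<le> prob (A n)" for n unfolding A_def by (rule main) simp
    qed
    also have "(\<Inter>n. A n) = {\<omega> \<in> space M. \<forall>i\<le>2^K. 0 \<le> psum (steps (1 / 2^(e + K)) \<omega>) i}"
    proof -
      have "(\<forall>n. - (Y / 2^Suc n) \<le> z) \<longleftrightarrow> 0 \<le> z" for z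
      proof
        assume *: "\<forall>n. - (Y / 2^Suc n) \<le> z"
        have "(\<lambda>n. - (Y / 2^Suc n)) \<longlonglongrightarrow> - 0"
          by (intro tendsto_minus LIMSEQ_Suc LIMSEQ_divide_realpow_zero) simp
        then have "- 0 \<le> z" by (rule LIMSEQ_le_const2) (use * in auto)
        then show "0 \<le> z" by simp
      next
        assume "0 \<le> z"
        moreover have "0 \<le> Y / 2^Suc n" for n using Y by simp
        ultimately show "\<forall>n. - (Y / 2^Suc n) \<le> z" by (meson neg_le_0_iff_le order_trans)
      qed
      note iff = this
      have "(\<Inter>n. A n) = {\<omega> \<in> space M. \<forall>i\<le>2^K. \<forall>n. - (Y / 2^Suc n) \<le> psum (steps (1 / 2^(e + K)) \<omega>) i}"
        unfolding A_def by blast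
      then show ?thesis by (simp only: iff)
    qed
    finally show ?thesis .
  qed
  then show thesis using that q by blast
qed

lemma steps_shift_distr:
  assumes h: "0 < h"
  shows "distr M (Pi\<^sub>M UNIV (\<lambda>_. borel)) (\<lambda>\<omega>. drop_steps w (steps h \<omega>)) = Pi\<^sub>M UNIV (\<lambda>_. law h)"
proof (rule measure_eqI)
  interpret W: iid_steps "law h" by (rule iid_steps_law[OF h])
  show sets: "sets (distr M (Pi\<^sub>M UNIV (\<lambda>_. borel)) (\<lambda>\<omega>. drop_steps w (steps h \<omega>))) = sets W.S"
    by (simp add: W.sets_S)
  fix A assume "A \<in> sets (distr M (Pi\<^sub>M UNIV (\<lambda>_. borel)) (\<lambda>\<omega>. drop_steps w (steps h \<omega>)))"
  then have A: "A \<in> sets (Pi\<^sub>M UNIV (\<lambda>_. borel))" by simp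
  have m: "(\<lambda>\<omega>. drop_steps w (steps h \<omega>)) \<in> M \<rightarrow>\<^sub>M Pi\<^sub>M UNIV (\<lambda>_. borel)"
    by (rule measurable_compose[OF steps_measurable[OF h] drop_steps_measurable_borel])
  have "emeasure (distr M (Pi\<^sub>M UNIV (\<lambda>_. borel)) (\<lambda>\<omega>. drop_steps w (steps h \<omega>))) A
      = ennreal (prob {\<omega> \<in> space M. drop_steps w (steps h \<omega>) \<in> A})"
    unfolding emeasure_distr[OF m A] emeasure_eq_measure by (intro arg_cong[of _ _ "\<lambda>A. ennreal (prob A)"]) auto
  also have "prob {\<omega> \<in> space M. drop_steps w (steps h \<omega>) \<in> A} = measure W.S {s. s \<in> A}"
    using A by (intro steps_prob[OF h]) simp
  finally show "emeasure (distr M (Pi\<^sub>M UNIV (\<lambda>_. borel)) (\<lambda>\<omega>. drop_steps w (steps h \<omega>))) A = emeasure W.S A"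
    by (simp add: W.P.emeasure_eq_measure)
qed

text \<open>The hypothesis concerns a window of length \<open>1 / 2^e\<close>, so a long interval is
  cut into windows \<open>w\<close>, all with the same law. The bound on the mean of
  \<open>V w R k\<close> is uniform in \<open>k\<close>, and \<open>V\<close> increases with
  \<open>k\<close>; by monotone convergence it stays bounded along almost every path.\<close>

lemma stays_above_imp_bounded_variation:
  assumes q: "0 < q"
    and stay: "\<And>K. prob {\<omega> \<in> space M. \<forall>i\<le>2^K. 0 \<le> psum (steps (1 / 2^(e + K)) \<omega>) i} \<ge> q"
  shows "of_bounded_variation M X"
proof -
  define h where "h k = (1::real) / 2^(e + k)" for k :: nat
  have h: "0 < h k" for k by (simp add: h_def)
  define g where "g R k s = (\<Sum>j<2^k. max 0 (trunc R (psum s (Suc j)) - trunc R (psum s j)))"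
    for R :: real and k :: nat and s :: "nat \<Rightarrow> real"
  define V where "V w R k \<omega> = g R k (drop_steps (w * 2^k) (steps (h k) \<omega>))" for w k :: nat and R :: real and \<omega>
  have gm: "(\<lambda>s. ennreal (g R k s)) \<in> borel_measurable (Pi\<^sub>M UNIV (\<lambda>_. borel))" for R k
    unfolding g_def by measurable
  have sm: "(\<lambda>\<omega>. drop_steps w (steps (h k) \<omega>)) \<in> M \<rightarrow>\<^sub>M Pi\<^sub>M UNIV (\<lambda>_. borel)" for w k
    by (rule measurable_compose[OF steps_measurable[OF h] drop_steps_measurable_borel])
  have Vm: "(\<lambda>\<omega>. ennreal (V w R k \<omega>)) \<in> borel_measurable M" for w R k
    unfolding V_def by (rule measurable_compose[OF sm gm])
  have int: "(\<integral>\<^sup>+\<omega>. ennreal (V w R k \<omega>) \<partial>M) \<le> ennreal (2 * R / q)" if R: "0 \<le> R" for w R k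
  proof -
    interpret W: iid_steps "law (h k)" by (rule iid_steps_law[OF h])
    have "(\<integral>\<^sup>+\<omega>. ennreal (V w R k \<omega>) \<partial>M)
        = (\<integral>\<^sup>+s. ennreal (g R k s) \<partial>distr M (Pi\<^sub>M UNIV (\<lambda>_. borel)) (\<lambda>\<omega>. drop_steps (w * 2^k) (steps (h k) \<omega>)))"
      unfolding V_def by (rule nn_integral_distr[OF sm, symmetric]) (simp add: gm)
    also have "\<dots> = (\<integral>\<^sup>+s. ennreal (g R k s) \<partial>W.S)" by (simp add: steps_shift_distr[OF h])
    also have "\<dots> \<le> ennreal (2 * R / q)"
      unfolding g_def
    proof (rule W.truncated_variation_le[OF R q])
      have "prob {\<omega> \<in> space M. \<forall>i\<le>2^k. 0 \<le> psum (steps (h k) \<omega>) i} = measure W.S {s. \<forall>i\<le>2^k. 0 \<le> psum s i}"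
        by (rule steps_prob_0[OF h]) measurable
      then show "q \<le> measure W.S {s. \<forall>i\<le>2^k. 0 \<le> psum s i}" using stay[of k] by (simp add: h_def)
    qed
    finally show ?thesis .
  qed
  have V_eq: "V w R k \<omega> = (\<Sum>j<2^k. max 0 (trunc R (X (real (w * 2^k + Suc j) * h k) \<omega> - X (real w / 2^e) \<omega>)
      - trunc R (X (real (w * 2^k + j) * h k) \<omega> - X (real w / 2^e) \<omega>)))" for w R k \<omega>
  proof -
    have "real (w * 2^k) * h k = real w / 2^e" by (simp add: h_def power_add)
    then show ?thesis unfolding V_def g_def steps_def psum_path_steps by simp
  qed
  have inc: "V w R k \<omega> \<le> V w R (Suc k) \<omega>" for w R k \<omega>
  proof -
    have "h (Suc k) = h k / 2" "w * 2^Suc k = 2 * (w * 2^k)" "(2::nat)^Suc k = 2 * 2^k" by (simp_all add: h_def)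
    then show ?thesis unfolding V_eq
      using upward_variation_halving[of "\<lambda>t. trunc R (X t \<omega> - X (real w / 2^e) \<omega>)" "w * 2^k" "h k" "2^k"] by (simp only:)
  qed
  have "AE \<omega> in M. (SUP k. ennreal (V w R k \<omega>)) \<noteq> \<infinity>" if R: "0 \<le> R" for w R
  proof (rule nn_integral_PInf_AE)
    show "(\<lambda>\<omega>. SUP k. ennreal (V w R k \<omega>)) \<in> borel_measurable M" using Vm by measurable
    have "(\<integral>\<^sup>+\<omega>. (SUP k. ennreal (V w R k \<omega>)) \<partial>M) = (SUP k. \<integral>\<^sup>+\<omega>. ennreal (V w R k \<omega>) \<partial>M)"
      using inc by (intro nn_integral_monotone_convergence_SUP Vm) (auto intro!: incseq_SucI le_funI ennreal_leI)
    also have "\<dots> \<le> ennreal (2 * R / q)" using int[OF R] by (intro SUP_least)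
    finally show "(\<integral>\<^sup>+\<omega>. (SUP k. ennreal (V w R k \<omega>)) \<partial>M) \<noteq> \<infinity>"
      by (auto simp: top_unique)
  qed
  then have "AE \<omega> in M. (SUP k. ennreal (V w (real R) k \<omega>)) \<noteq> \<infinity>" for w R :: nat by simp
  then have "AE \<omega> in M. \<forall>w R :: nat. (SUP k. ennreal (V w (real R) k \<omega>)) \<noteq> \<infinity>" by (simp add: AE_all_countable)
  then show ?thesis unfolding of_bounded_variation_def
    using AE_space
  proof (eventually_elim, intro allI impI)
    fix \<omega> and a b :: real
    assume fin: "\<forall>w R :: nat. (SUP k. ennreal (V w (real R) k \<omega>)) \<noteq> \<infinity>" and \<omega>: "\<omega> \<in> space M" and ab: "0 \<le> a \<and> a \<le> b"
    have f: "cadlag_no_positive_jumps (\<lambda>t. X t \<omega>)" by (rule paths[OF \<omega>])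
    have Vb: "\<exists>B. \<forall>k. V w (real R) k \<omega> \<le> B" for w R
    proof -
      obtain B where B: "0 \<le> B" "(SUP k. ennreal (V w (real R) k \<omega>)) = ennreal B"
        using fin[rule_format, of w R] by (cases "SUP k. ennreal (V w (real R) k \<omega>)") auto
      have "ennreal (V w (real R) k \<omega>) \<le> ennreal B" for k
        unfolding B(2)[symmetric] by (rule SUP_upper) simp
      then show ?thesis using B(1) by (intro exI[of _ B]) (simp add: ennreal_le_iff)
    qed
    show "bounded_variation_on_Icc a b (\<lambda>t. X t \<omega>)"
    proof (rule grid_variation_imp_bounded_variation[OF f])
      fix T :: nat
      define U where "U K = (\<Sum>i<T * 2^K. max 0 (X (real (Suc i) / 2^K) \<omega> - X (real i / 2^K) \<omega>))" for K
      have Uinc: "incseq U"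
      proof (rule incseq_SucI)
        fix K
        show "U K \<le> U (Suc K)"
          using upward_variation_halving[of "\<lambda>t. X t \<omega>" 0 "1 / 2^K" "T * 2^K"] by (simp add: U_def mult_ac)
      qed
      obtain B where B: "\<And>s. s \<in> {0..real T} \<Longrightarrow> \<bar>X s \<omega>\<bar> \<le> B" using cadlag_bounded[OF f, of "real T"] by blast
      \<comment> \<open>\<open>2 * B\<close> bounds all differences of values of the path up to time
        \<open>T\<close>, so truncation at \<open>R\<close> has no effect here. The level is a
        natural number because only countably many exceptional sets can be removed.\<close>
      obtain R :: nat where R: "2 * B \<le> real R" using real_arch_simple by blast
      have UV: "U (e + k) = (\<Sum>w<T * 2^e. V w (real R) k \<omega>)" for k
      proof -
        let ?d = "\<lambda>i. max 0 (X (real (Suc i) * h k) \<omega> - X (real i * h k) \<omega>)"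
        have "U (e + k) = (\<Sum>i<(T * 2^e) * 2^k. ?d i)"
          unfolding U_def h_def by (simp add: power_add mult_ac)
        also have "\<dots> = (\<Sum>w<T * 2^e. \<Sum>i=w * 2^k..<w * 2^k + 2^k. ?d i)" by (rule sum.nat_group[symmetric])
        also have "\<dots> = (\<Sum>w<T * 2^e. V w (real R) k \<omega>)"
        proof (rule sum.cong[OF refl])
          fix w assume w: "w \<in> {..<T * 2^e}"
          have cl: "trunc (real R) (X (real (w * 2^k + j) * h k) \<omega> - X (real w / 2^e) \<omega>)
              = X (real (w * 2^k + j) * h k) \<omega> - X (real w / 2^e) \<omega>" if j: "j \<le> 2^k" for j
          proof (rule trunc_id)
            have "w * 2^k + j \<le> (T * 2^e) * 2^k"
            proof -
              have "w * 2^k + j \<le> Suc w * 2^k" using j by simp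
              also have "\<dots> \<le> (T * 2^e) * 2^k" using w by (intro mult_right_mono) auto
              finally show ?thesis .
            qed
            from of_nat_mono[OF this, where 'a = real]
            have "real (w * 2^k + j) * h k \<le> real ((T * 2^e) * 2^k) * h k" by (intro mult_right_mono less_imp_le[OF h])
            also have "\<dots> = real T" by (simp add: h_def power_add)
            finally have "\<bar>X (real (w * 2^k + j) * h k) \<omega>\<bar> \<le> B" using h[of k] by (intro B) auto
            moreover have "real w \<le> real T * 2^e" using of_nat_mono[of w "T * 2^e", where 'a = real] w by simp
            then have "real w / 2^e \<le> real T" by (simp add: field_simps)
            then have "\<bar>X (real w / 2^e) \<omega>\<bar> \<le> B" by (intro B) auto
            ultimately show "\<bar>X (real (w * 2^k + j) * h k) \<omega> - X (real w / 2^e) \<omega>\<bar> \<le> real R"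
              using R by linarith
          qed
          have "(\<Sum>i=w * 2^k..<w * 2^k + 2^k. ?d i) = (\<Sum>j<2^k. ?d (w * 2^k + j))"
            using sum.shift_bounds_nat_ivl[of ?d 0 "w * 2^k" "2^k"]
            by (simp only: lessThan_atLeast0 add.commute[of _ "w * 2^k"] add_0_right)
          also have "\<dots> = V w (real R) k \<omega>"
            unfolding V_eq
          proof (rule sum.cong[OF refl])
            fix j :: nat assume "j \<in> {..<2^k}"
            then have "j \<le> 2^k" "Suc j \<le> 2^k" by auto
            from cl[OF this(1)] cl[OF this(2)]
            show "?d (w * 2^k + j) = max 0 (trunc (real R) (X (real (w * 2^k + Suc j) * h k) \<omega> - X (real w / 2^e) \<omega>)
                - trunc (real R) (X (real (w * 2^k + j) * h k) \<omega> - X (real w / 2^e) \<omega>))" by simp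
          qed
          finally show "(\<Sum>i=w * 2^k..<w * 2^k + 2^k. ?d i) = V w (real R) k \<omega>" .
        qed
        finally show ?thesis .
      qed
      obtain D where D: "\<And>w k. V w (real R) k \<omega> \<le> D w" using choice[of "\<lambda>w B. \<forall>k. V w (real R) k \<omega> \<le> B"] Vb by blast
      have "U K \<le> (\<Sum>w<T * 2^e. D w)" for K
      proof -
        have "U K \<le> U (e + K)" using Uinc by (simp add: incseq_def)
        also have "\<dots> \<le> (\<Sum>w<T * 2^e. D w)" unfolding UV by (intro sum_mono D)
        finally show ?thesis .
      qed
      then show "\<exists>C. \<forall>K. (\<Sum>i<T * 2^K. max 0 (X (real (Suc i) / 2^K) \<omega> - X (real i / 2^K) \<omega>)) \<le> C"
        unfolding U_def by blast
    qed (use ab in auto)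
  qed
qed

lemma creeping_imp_bounded_variation:
  assumes "0 < x" "continuous_on {0..} \<gamma>" "\<gamma> ` {0..} \<subseteq> {1<..}" "a_star \<gamma> x < \<infinity>"
    and "0 < measure M {\<omega> \<in> space M. sigma_time X (a_star \<gamma> x) \<omega> = ruin_time \<gamma> X \<omega>}"
  shows "of_bounded_variation M X"
proof -
  obtain e q where "0 < q"
    "\<And>K. prob {\<omega> \<in> space M. \<forall>i\<le>2^K. 0 \<le> psum (steps (1 / 2^(e + K)) \<omega>) i} \<ge> q"
    by (rule creeping_imp_stays_above[OF assms]) blast
  then show ?thesis by (rule stays_above_imp_bounded_variation)
qed

end

section \<open>The drift of a process of bounded variation\<close>

lemma power_diff_le:
  fixes u v :: real
  assumes "0 \<le> v" "v \<le> u" "u \<le> 1"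
  shows "u ^ n - v ^ n \<le> real n * (u - v)"
proof (induction n)
  case (Suc n)
  have "u ^ Suc n - v ^ Suc n = u * (u ^ n - v ^ n) + v ^ n * (u - v)" by (simp add: algebra_simps)
  also have "\<dots> \<le> 1 * (u ^ n - v ^ n) + 1 * (u - v)"
    using assms by (intro add_mono mult_right_mono) (auto simp: power_le_one power_mono)
  finally show ?case using Suc by (simp add: algebra_simps)
qed simp

text \<open>Converts knowledge of the \<open>n\<close>-th power of a one-step quantity into a bound
  on \<open>n\<close> times its distance from 1; in this way limits of powers control sums over all
  steps.\<close>

lemma mult_one_minus_le_ln:
  fixes a :: real
  assumes "0 < a"
  shows "real n * (1 - a) \<le> - ln (a ^ n)"
proof -
  have "1 - a \<le> - ln a" using ln_le_minus_one[OF assms] by simp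
  then have "real n * (1 - a) \<le> real n * (- ln a)" by (intro mult_left_mono) auto
  then show ?thesis using assms by (simp add: ln_realpow)
qed

lemma (in prob_space) integrable_unit_bounded:
  fixes f :: "'a \<Rightarrow> real"
  assumes "f \<in> borel_measurable M" "\<And>x. 0 \<le> f x" "\<And>x. f x \<le> 1"
  shows "integrable M f"
  using assms by (intro integrable_const_bound[where B = 1]) auto

lemma (in prob_space) expectation_le_tail:
  fixes f :: "'a \<Rightarrow> real"
  assumes f[measurable]: "f \<in> borel_measurable M" and b: "\<And>x. 0 \<le> f x" "\<And>x. f x \<le> 1" and e: "0 \<le> e"
  shows "expectation (\<lambda>x. (f x)\<^sup>2) \<le> e * expectation f + prob {x \<in> space M. e < f x}"
proof -
  have int: "integrable M f" "integrable M (\<lambda>x. (f x)\<^sup>2)"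
    using b by (auto intro!: integrable_unit_bounded simp: power_le_one)
  have set: "{x \<in> space M. e < f x} \<in> events" by measurable
  have "expectation (\<lambda>x. (f x)\<^sup>2) \<le> expectation (\<lambda>x. e * f x + indicator {x \<in> space M. e < f x} x)"
  proof (intro integral_mono int)
    show "integrable M (\<lambda>x. e * f x + indicator {x \<in> space M. e < f x} x)"
      using int set by (intro Bochner_Integration.integrable_add integrable_mult_right) (auto simp: less_top[symmetric])
    fix x assume "x \<in> space M"
    then show "(f x)\<^sup>2 \<le> e * f x + indicator {x \<in> space M. e < f x} x"
      using b[of x] e by (cases "e < f x") (auto simp: power2_eq_square mult_right_mono mult_le_one add_increasing)
  qed
  also have "\<dots> = e * expectation f + prob {x \<in> space M. e < f x}"
    using int set by (subst Bochner_Integration.integral_add) (auto simp: less_top[symmetric])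
  finally show ?thesis .
qed

section \<open>The upward variation is deterministic\<close>

context spectrally_negative_levy_process
begin

lemma expectation_step:
  assumes h: "0 < h" and u: "u \<in> borel_measurable borel"
  shows "expectation (\<lambda>\<omega>. u (steps h \<omega> i)) = (expectation (\<lambda>\<omega>. u (X h \<omega> - X 0 \<omega>)) :: real)"
proof -
  have "expectation (\<lambda>\<omega>. u (steps h \<omega> i)) = (LINT y|distr M borel (\<lambda>\<omega>. steps h \<omega> i). u y)"
    using h u by (intro integral_distr[symmetric]) auto
  also have "\<dots> = expectation (\<lambda>\<omega>. u (X h \<omega> - X 0 \<omega>))"
    unfolding step_distr[OF h] law_def using h u by (intro integral_distr) auto
  finally show ?thesis .
qed

lemma expectation_prod_steps:
  fixes u :: "real \<Rightarrow> real"
  assumes h: "0 < h" and u: "u \<in> borel_measurable borel" and b: "\<And>y. 0 \<le> u y" "\<And>y. u y \<le> 1"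
  shows "expectation (\<lambda>\<omega>. \<Prod>i<n. u (steps h \<omega> i)) = expectation (\<lambda>\<omega>. u (X h \<omega> - X 0 \<omega>)) ^ n"
proof -
  have "indep_vars (\<lambda>_. borel) (\<lambda>i \<omega>. steps h \<omega> i) {..<n}"
    by (rule indep_vars_subset[OF steps_indep[OF h]]) simp
  then have "indep_vars (\<lambda>_. borel) (\<lambda>i \<omega>. u (steps h \<omega> i)) {..<n}"
    by (rule indep_vars_compose2) (rule u)
  then have "expectation (\<lambda>\<omega>. \<Prod>i<n. u (steps h \<omega> i)) = (\<Prod>i<n. expectation (\<lambda>\<omega>. u (steps h \<omega> i)))"
    using h u b by (intro indep_vars_lebesgue_integral integrable_unit_bounded)
      (auto intro: measurable_compose[OF step_measurable])
  also have "\<dots> = (\<Prod>i<n. expectation (\<lambda>\<omega>. u (X h \<omega> - X 0 \<omega>)))"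
    by (intro prod.cong refl expectation_step h u)
  finally show ?thesis by simp
qed

lemma all_steps_sets:
  assumes "0 < h" "Measurable.pred borel Q"
  shows "{\<omega> \<in> space M. \<forall>i<n. Q (steps h \<omega> i)} \<in> events"
proof -
  have Qi: "Measurable.pred M (\<lambda>\<omega>. Q (steps h \<omega> i))" for i
    by (rule measurable_compose[OF step_measurable[OF assms(1)] assms(2)])
  have "Measurable.pred M (\<lambda>\<omega>. \<forall>i<n. Q (steps h \<omega> i))"
    by (intro pred_intros_countable(1) pred_intros_imp' Qi)
  then show ?thesis unfolding pred_def .
qed

lemma prob_all_steps:
  assumes h: "0 < h" and Q: "Measurable.pred borel Q"
  shows "prob {\<omega> \<in> space M. \<forall>i<n. Q (steps h \<omega> i)} = prob {\<omega> \<in> space M. Q (X h \<omega> - X 0 \<omega>)} ^ n"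
proof -
  interpret W: iid_steps "law h" by (rule iid_steps_law[OF h])
  have Qi: "Measurable.pred (Pi\<^sub>M UNIV (\<lambda>_. borel)) (\<lambda>s :: nat \<Rightarrow> real. Q (s i))" for i
    by (rule measurable_compose[OF _ Q]) measurable
  have "prob {\<omega> \<in> space M. \<forall>i<n. Q (steps h \<omega> i)} = measure W.S {s. \<forall>i<n. Q (s i)}"
    by (rule steps_prob_0[OF h]) (intro pred_intros_countable(1) pred_intros_imp' Qi)
  also have "\<dots> = measure W.S {s. Q (s 0)} ^ n" by (rule W.prob_all_steps[OF Q])
  also have "measure W.S {s. Q (s 0)} = prob {\<omega> \<in> space M. Q (steps h \<omega> 0)}"
    by (rule steps_prob_0[OF h Qi, symmetric])
  also have "\<dots> = prob {\<omega> \<in> space M. Q (X h \<omega> - X 0 \<omega>)}" by (rule step_prob[OF h Q])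
  finally show ?thesis .
qed

text \<open>The upward variation over \<open>[0,1]\<close> is a sum of independent terms which become uniformly small
  because there are no positive jumps; hence its variance vanishes.\<close>

lemma bounded_variation_imp_slope:
  assumes bv: "of_bounded_variation M X"
  obtains c where "AE \<omega> in M. \<forall>s t. 0 \<le> s \<and> s \<le> t \<longrightarrow> X t \<omega> - X s \<omega> \<le> c * (t - s)"
proof -
  define h where "h k = (1::real) / 2^k" for k :: nat
  have h: "0 < h k" for k by (simp add: h_def)
  define W where "W k \<omega> = (\<Sum>i<2^k. max 0 (steps (h k) \<omega> i))" for k \<omega>
  have Wm[measurable]: "W k \<in> borel_measurable M" for k
    unfolding W_def using h[of k] by measurable
  have W0: "0 \<le> W k \<omega>" for k \<omega> unfolding W_def by (intro sum_nonneg) auto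
  have Winc: "incseq (\<lambda>k. W k \<omega>)" for \<omega>
  proof (rule incseq_SucI)
    fix k
    have "h (Suc k) = h k / 2" "(2::nat)^Suc k = 2 * 2^k" by (simp_all add: h_def)
    then show "W k \<omega> \<le> W (Suc k) \<omega>" unfolding W_def steps_def path_steps_def
      using upward_variation_halving[of "\<lambda>t. X t \<omega>" 0 "h k" "2^k"] by (simp only: mult_0_right add_0)
  qed
  \<comment> \<open>The limit of \<open>W k\<close> is the upward variation over
    \<open>[0,1]\<close>, which might lack moments. Its negative exponential is bounded by 1, and
    the moments of \<open>exp (- W k \<omega>)\<close> factorize over the steps.\<close>
  define Z where "Z \<omega> = lim (\<lambda>k. exp (- W k \<omega>))" for \<omega>
  have Zlim: "(\<lambda>k. exp (- W k \<omega>)) \<longlonglongrightarrow> Z \<omega>" for \<omega>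
  proof -
    have "decseq (\<lambda>k. exp (- W k \<omega>))" using Winc[of \<omega>] by (auto simp: decseq_def incseq_def)
    then have "convergent (\<lambda>k. exp (- W k \<omega>))"
      by (intro Bseq_monoseq_convergent decseq_imp_monoseq BseqI'[of _ 1]) (auto simp: W0)
    then show ?thesis unfolding Z_def by (simp add: convergent_LIMSEQ_iff)
  qed
  have Zm[measurable]: "Z \<in> borel_measurable M"
    by (rule borel_measurable_LIMSEQ_real[OF Zlim]) measurable
  have Z01: "0 \<le> Z \<omega>" "Z \<omega> \<le> 1" for \<omega>
    using LIMSEQ_le_const[OF Zlim] LIMSEQ_le_const2[OF Zlim] by (auto simp: W0)
  have Zle: "Z \<omega> \<le> exp (- W k \<omega>)" for k \<omega>
    by (rule LIMSEQ_le_const2[OF Zlim]) (use Winc[of \<omega>] in \<open>auto simp: incseq_def intro!: exI[of _ k]\<close>)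
  \<comment> \<open>Bounded variation enters here: it keeps \<open>W k\<close> bounded along the
    path, which makes \<open>z\<close> positive and \<open>ln z\<close> meaningful.\<close>
  have Zpos: "AE \<omega> in M. 0 < Z \<omega>"
    using bv unfolding of_bounded_variation_def
  proof eventually_elim
    case (elim \<omega>)
    then obtain B where B: "\<And>n \<tau>. mono_on {..n} \<tau> \<Longrightarrow> \<tau> ` {..n} \<subseteq> {0..1} \<Longrightarrow>
        (\<Sum>i<n. \<bar>X (\<tau> (Suc i)) \<omega> - X (\<tau> i) \<omega>\<bar>) \<le> B"
    proof -
      have "bounded_variation_on_Icc 0 1 (\<lambda>t. X t \<omega>)" using elim by simp
      then show ?thesis using that unfolding bounded_variation_on_Icc_def by blast
    qed
    have "W k \<omega> \<le> B" for k
    proof -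
      have "W k \<omega> \<le> (\<Sum>i<2^k. \<bar>X (real (Suc i) * h k) \<omega> - X (real i * h k) \<omega>\<bar>)"
        unfolding W_def steps_def path_steps_def by (intro sum_mono) auto
      also have "\<dots> \<le> B"
      proof (rule B)
        show "mono_on {..2^k} (\<lambda>i. real i * h k)" using h[of k] by (auto intro!: mono_onI mult_right_mono)
        have "real i * h k \<le> 1" if "i \<le> 2^k" for i
          using of_nat_mono[OF that, where 'a = real] by (simp add: h_def field_simps)
        then show "(\<lambda>i. real i * h k) ` {..2^k} \<subseteq> {0..1}" using less_imp_le[OF h[of k]] by auto
      qed
      finally show ?thesis .
    qed
    then have "exp (- B) \<le> Z \<omega>" by (intro LIMSEQ_le_const[OF Zlim]) auto
    then show ?case using exp_gt_zero[of "-B"] by linarith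
  qed
  have intZ: "integrable M Z" by (rule integrable_unit_bounded) (auto simp: Z01)
  have intZ2: "integrable M (\<lambda>\<omega>. (Z \<omega>)\<^sup>2)"
    by (rule integrable_unit_bounded) (auto simp: Z01 power_le_one)
  define z where "z = expectation Z"
  have z: "0 < z"
  proof -
    have "z \<noteq> 0"
    proof
      assume "z = 0"
      then have "AE \<omega> in M. Z \<omega> = 0" using integral_nonneg_eq_0_iff_AE[OF intZ] Z01 by (auto simp: z_def)
      with Zpos have "AE \<omega> in M. False" by eventually_elim simp
      then show False by simp
    qed
    moreover have "0 \<le> z" unfolding z_def by (intro Bochner_Integration.integral_nonneg Z01)
    ultimately show ?thesis by simp
  qed
  define a where "a l k = expectation (\<lambda>\<omega>. exp (- (l * max 0 (X (h k) \<omega> - X 0 \<omega>))))" for l :: real and k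
  have diffm[measurable]: "(\<lambda>\<omega>. X (h k) \<omega> - X 0 \<omega>) \<in> borel_measurable M" for k
    using h[of k] by (intro borel_measurable_diff X_measurable) auto
  have aW: "expectation (\<lambda>\<omega>. exp (- (l * W k \<omega>))) = a l k ^ 2^k" if l: "0 \<le> l" for l k
  proof -
    have "exp (- (l * W k \<omega>)) = (\<Prod>i<2^k. exp (- (l * max 0 (steps (h k) \<omega> i))))" for \<omega>
      unfolding W_def by (simp add: sum_distrib_left sum_negf[symmetric] exp_sum)
    then show ?thesis unfolding a_def
      using expectation_prod_steps[OF h, of "\<lambda>y. exp (- (l * max 0 y))" k "2^k"] l by simp
  qed
  have lim1: "(\<lambda>k. a 1 k ^ 2^k) \<longlonglongrightarrow> z"
  proof -
    have "(\<lambda>k. expectation (\<lambda>\<omega>. exp (- W k \<omega>))) \<longlonglongrightarrow> expectation Z"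
      by (rule integral_dominated_convergence[where w = "\<lambda>_. 1"]) (auto simp: Zlim W0)
    then show ?thesis using aW[of 1] by (simp add: z_def)
  qed
  have lim2: "(\<lambda>k. a 2 k ^ 2^k) \<longlonglongrightarrow> expectation (\<lambda>\<omega>. (Z \<omega>)\<^sup>2)"
  proof -
    have "(\<lambda>k. exp (- (2 * W k \<omega>))) \<longlonglongrightarrow> (Z \<omega>)\<^sup>2" for \<omega>
      using tendsto_power[OF Zlim[of \<omega>], of 2] by (simp add: exp_double[symmetric])
    then have "(\<lambda>k. expectation (\<lambda>\<omega>. exp (- (2 * W k \<omega>)))) \<longlonglongrightarrow> expectation (\<lambda>\<omega>. (Z \<omega>)\<^sup>2)"
      by (intro integral_dominated_convergence[where w = "\<lambda>_. 1"]) (auto simp: W0)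
    then show ?thesis using aW[of 2] by simp
  qed
  define p where "p e k = prob {\<omega> \<in> space M. e < X (h k) \<omega> - X 0 \<omega>}" for e k
  \<comment> \<open>The probability that all \<open>2^k\<close> steps are at most \<open>e\<close>
    tends to 1 because there are no positive jumps. By independence it equals
    \<open>(1 - p e k) ^ 2^k\<close>, and logarithms give the claim.\<close>
  have pN: "(\<lambda>k. 2^k * p e k) \<longlonglongrightarrow> 0" if e: "0 < e" for e
  proof -
    define A where "A k = {\<omega> \<in> space M. \<forall>i<2^k. steps (h k) \<omega> i \<le> e}" for k
    have Am: "A k \<in> events" for k
      unfolding A_def by (rule all_steps_sets[OF h, of "\<lambda>y. y \<le> e"]) measurable
    have pA: "prob (A k) = (1 - p e k) ^ 2^k" for k
    proof -
      have "prob (A k) = prob {\<omega> \<in> space M. X (h k) \<omega> - X 0 \<omega> \<le> e} ^ 2^k"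
        unfolding A_def by (rule prob_all_steps[OF h, of "\<lambda>y. y \<le> e"]) measurable
      also have "prob {\<omega> \<in> space M. X (h k) \<omega> - X 0 \<omega> \<le> e} = 1 - p e k"
      proof -
        have "{\<omega> \<in> space M. X (h k) \<omega> - X 0 \<omega> \<le> e} = space M - {\<omega> \<in> space M. e < X (h k) \<omega> - X 0 \<omega>}" by auto
        then show ?thesis unfolding p_def using prob_compl[of "{\<omega> \<in> space M. e < X (h k) \<omega> - X 0 \<omega>}"] by simp
      qed
      finally show ?thesis .
    qed
    have "(\<lambda>k. prob (A k)) \<longlonglongrightarrow> 1"
    proof -
      have "(\<lambda>k. expectation (indicat_real (A k))) \<longlonglongrightarrow> expectation (\<lambda>_. 1)"
      proof (rule integral_dominated_convergence[where w = "\<lambda>_. 1"])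
        show "AE \<omega> in M. (\<lambda>k. indicat_real (A k) \<omega>) \<longlonglongrightarrow> 1"
        proof (rule AE_I2)
          fix \<omega> assume \<omega>: "\<omega> \<in> space M"
          obtain d where d: "d > 0" "\<And>s t. 0 \<le> s \<and> s \<le> t \<and> t \<le> 1 \<and> t - s < d \<Longrightarrow> X t \<omega> - X s \<omega> \<le> e"
            using cadlag_small_rise[OF paths[OF \<omega>] e, of 1] by blast
          obtain k0 where k0: "(1/2::real)^k0 < d" using real_arch_pow_inv[OF d(1), of "1/2"] by auto
          have "\<omega> \<in> A k" if k: "k0 \<le> k" for k
          proof -
            have "h k = (1/2)^k" by (simp add: h_def power_one_over)
            also have "\<dots> \<le> (1/2)^k0" using k by (intro power_decreasing) auto
            finally have hd: "h k < d" using k0 by simp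
            have "X (real (Suc i) * h k) \<omega> - X (real i * h k) \<omega> \<le> e" if i: "i < 2^k" for i
            proof (rule d(2), intro conjI)
              have "real (Suc i) \<le> 2^k" using of_nat_mono[of "Suc i" "2^k", where 'a = real] i by simp
              then show "real (Suc i) * h k \<le> 1" by (simp add: h_def field_simps)
              show "real (Suc i) * h k - real i * h k < d" using hd by (simp add: algebra_simps)
              show "real i * h k \<le> real (Suc i) * h k" using h[of k] by (intro mult_right_mono) auto
              show "0 \<le> real i * h k" using h[of k] by simp
            qed
            then show ?thesis using \<omega> by (simp add: A_def steps_def path_steps_def)
          qed
          then have "eventually (\<lambda>k. indicat_real (A k) \<omega> = 1) sequentially"
            by (auto simp: eventually_sequentially intro!: exI[of _ k0])
          then show "(\<lambda>k. indicat_real (A k) \<omega>) \<longlonglongrightarrow> 1" by (rule tendsto_eventually)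
        qed
      qed (use Am in \<open>auto simp: indicator_def\<close>)
      then show ?thesis using Am prob_space by (simp add: Int_absorb1 sets.sets_into_space)
    qed
    then have A1: "(\<lambda>k. (1 - p e k) ^ 2^k) \<longlonglongrightarrow> 1" by (simp add: pA)
    then have "(\<lambda>k. - ln ((1 - p e k) ^ 2^k)) \<longlonglongrightarrow> - ln 1" by (intro tendsto_intros) auto
    then have up: "(\<lambda>k. - ln ((1 - p e k) ^ 2^k)) \<longlonglongrightarrow> 0" by simp
    have "eventually (\<lambda>k. 0 < (1 - p e k) ^ 2^k) sequentially" using A1 by (intro order_tendstoD(1)) auto
    then have ev: "eventually (\<lambda>k. 2^k * p e k \<le> - ln ((1 - p e k) ^ 2^k)) sequentially"
    proof eventually_elim
      case (elim k)
      have "p e k \<noteq> 1" using elim by (auto simp: power_0_left)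
      moreover have "p e k \<le> 1" by (simp add: p_def)
      ultimately show ?case using mult_one_minus_le_ln[of "1 - p e k" "2^k"] by simp
    qed
    have nn: "eventually (\<lambda>k. 0 \<le> 2^k * p e k) sequentially" by (simp add: p_def)
    show ?thesis by (rule tendsto_sandwich[OF nn ev tendsto_const up])
  qed
  \<comment> \<open>The variance of \<open>exp (- W k \<omega>)\<close> is a difference of powers
    with exponent \<open>2^k\<close>, hence at most \<open>2^k\<close> times the one-step variance.
    The latter is at most the second moment of \<open>f = 1 - exp (- Y)\<close>, hence at most
    \<open>e * (1 - a 1 k) + p e k\<close>. After multiplication by \<open>2^k\<close> the first
    term is controlled by \<open>e * (- ln z)\<close> in the limit, and the second vanishes by
    \<open>pN\<close>.\<close>
  have key: "expectation (\<lambda>\<omega>. (Z \<omega>)\<^sup>2) - z\<^sup>2 \<le> e * (- ln z)" if e: "0 < e" for e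
  proof -
    have step: "a 2 k ^ 2^k - (a 1 k ^ 2^k)\<^sup>2 \<le> e * (- ln (a 1 k ^ 2^k)) + 2^k * p e k" if pos: "0 < a 1 k ^ 2^k" for k
    proof -
      define Y where "Y \<omega> = max 0 (X (h k) \<omega> - X 0 \<omega>)" for \<omega>
      define f where "f \<omega> = 1 - exp (- Y \<omega>)" for \<omega>
      have Y[measurable]: "Y \<in> borel_measurable M" unfolding Y_def by measurable
      have fm[measurable]: "f \<in> borel_measurable M" unfolding f_def by measurable
      have Y0: "0 \<le> Y \<omega>" for \<omega> by (simp add: Y_def)
      have f01: "0 \<le> f \<omega>" "f \<omega> \<le> 1" for \<omega> using Y0 by (auto simp: f_def)
      have i1: "integrable M (\<lambda>\<omega>. exp (- Y \<omega>))" by (rule integrable_unit_bounded) (auto simp: Y0)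
      have i2: "integrable M (\<lambda>\<omega>. exp (- (2 * Y \<omega>)))" by (rule integrable_unit_bounded) (auto simp: Y0)
      have a1: "a 1 k = expectation (\<lambda>\<omega>. exp (- Y \<omega>))" and a2: "a 2 k = expectation (\<lambda>\<omega>. exp (- (2 * Y \<omega>)))"
        by (simp_all add: a_def Y_def)
      have a01: "0 \<le> a 1 k" "a 1 k \<le> 1" "0 \<le> a 2 k" "a 2 k \<le> 1"
        unfolding a1 a2 using Y0 by (auto intro!: Bochner_Integration.integral_nonneg integral_le_const i1 i2)
      have apos: "0 < a 1 k" using pos a01(1) by (cases "a 1 k = 0") (auto simp: power_0_left)
      have Ef: "expectation f = 1 - a 1 k"
        unfolding f_def a1 using i1 prob_space by (subst Bochner_Integration.integral_diff) auto
      have Ef2: "expectation (\<lambda>\<omega>. (f \<omega>)\<^sup>2) = 1 - 2 * a 1 k + a 2 k"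
      proof -
        have "(f \<omega>)\<^sup>2 = 1 - 2 * exp (- Y \<omega>) + exp (- (2 * Y \<omega>))" for \<omega>
          unfolding f_def power2_diff by (simp add: exp_double[of "- Y \<omega>", symmetric])
        then show ?thesis unfolding a1 a2 using i1 i2 prob_space by simp
      qed
      have "a 2 k - (a 1 k)\<^sup>2 \<le> 1 - 2 * a 1 k + a 2 k"
        using zero_le_power2[of "1 - a 1 k"] by (simp add: power2_diff)
      also have "\<dots> \<le> e * (1 - a 1 k) + prob {\<omega> \<in> space M. e < f \<omega>}"
        using expectation_le_tail[OF fm f01, of e] e unfolding Ef Ef2 by simp
      also have "prob {\<omega> \<in> space M. e < f \<omega>} \<le> p e k"
        unfolding p_def
      proof (intro finite_measure_mono subsetI)
        fix \<omega> assume "\<omega> \<in> {\<omega> \<in> space M. e < f \<omega>}"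
        moreover have "f \<omega> \<le> Y \<omega>" unfolding f_def using exp_ge_add_one_self[of "- Y \<omega>"] by simp
        ultimately show "\<omega> \<in> {\<omega> \<in> space M. e < X (h k) \<omega> - X 0 \<omega>}" using e by (auto simp: Y_def max_def split: if_splits)
      qed measurable
      finally have v: "a 2 k - (a 1 k)\<^sup>2 \<le> e * (1 - a 1 k) + p e k" by simp
      have "0 \<le> expectation (\<lambda>\<omega>. (exp (- Y \<omega>) - a 1 k)\<^sup>2)" by (intro Bochner_Integration.integral_nonneg) simp
      also have "\<dots> = a 2 k - (a 1 k)\<^sup>2"
      proof -
        have "(exp (- Y \<omega>) - a 1 k)\<^sup>2 = exp (- (2 * Y \<omega>)) - 2 * a 1 k * exp (- Y \<omega>) + (a 1 k)\<^sup>2" for \<omega>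
          unfolding power2_diff by (simp add: exp_double[of "- Y \<omega>", symmetric])
        then show ?thesis using i1 i2 prob_space by (simp add: a1[symmetric] a2[symmetric] power2_eq_square)
      qed
      finally have ge: "(a 1 k)\<^sup>2 \<le> a 2 k" by simp
      have "a 2 k ^ 2^k - (a 1 k ^ 2^k)\<^sup>2 = a 2 k ^ 2^k - ((a 1 k)\<^sup>2) ^ 2^k"
        by (simp add: power_mult[symmetric] mult.commute)
      also have "\<dots> \<le> real (2^k) * (a 2 k - (a 1 k)\<^sup>2)"
        by (rule power_diff_le) (use ge a01 in auto)
      also have "\<dots> \<le> real (2^k) * (e * (1 - a 1 k) + p e k)" by (intro mult_left_mono v) simp
      also have "\<dots> = e * (real (2^k) * (1 - a 1 k)) + 2^k * p e k" by (simp add: algebra_simps)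
      also have "\<dots> \<le> e * (- ln (a 1 k ^ 2^k)) + 2^k * p e k"
        using e by (intro add_right_mono mult_left_mono mult_one_minus_le_ln apos) auto
      finally show ?thesis .
    qed
    have "eventually (\<lambda>k. 0 < a 1 k ^ 2^k) sequentially" using lim1 z by (intro order_tendstoD(1))
    then have ev: "eventually (\<lambda>k. a 2 k ^ 2^k - (a 1 k ^ 2^k)\<^sup>2 \<le> e * (- ln (a 1 k ^ 2^k)) + 2^k * p e k) sequentially"
      by eventually_elim (rule step)
    have "(\<lambda>k. e * (- ln (a 1 k ^ 2^k)) + 2^k * p e k) \<longlonglongrightarrow> e * (- ln z) + 0"
      using z by (intro tendsto_add tendsto_mult tendsto_const tendsto_minus tendsto_ln lim1 pN e) auto
    moreover have "(\<lambda>k. a 2 k ^ 2^k - (a 1 k ^ 2^k)\<^sup>2) \<longlonglongrightarrow> expectation (\<lambda>\<omega>. (Z \<omega>)\<^sup>2) - z\<^sup>2"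
      by (intro tendsto_diff tendsto_power lim1 lim2)
    ultimately show ?thesis using tendsto_le[OF sequentially_bot _ _ ev] by simp
  qed
  have "expectation (\<lambda>\<omega>. (Z \<omega>)\<^sup>2) - z\<^sup>2 \<le> 0"
  proof (rule field_le_epsilon)
    fix e :: real assume e: "0 < e"
    have z1: "0 \<le> - ln z"
    proof -
      have "z \<le> 1" unfolding z_def using intZ Z01 by (intro integral_le_const) auto
      then show ?thesis using z by simp
    qed
    have "expectation (\<lambda>\<omega>. (Z \<omega>)\<^sup>2) - z\<^sup>2 \<le> (e / (1 - ln z)) * (- ln z)" using e z1 by (intro key) auto
    also have "\<dots> = e * ((- ln z) / (1 - ln z))" by simp
    also have "\<dots> \<le> e * 1" using e z1 by (intro mult_left_mono) (auto simp: field_simps)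
    finally show "expectation (\<lambda>\<omega>. (Z \<omega>)\<^sup>2) - z\<^sup>2 \<le> 0 + e" by simp
  qed
  moreover have var: "expectation (\<lambda>\<omega>. (Z \<omega> - z)\<^sup>2) = expectation (\<lambda>\<omega>. (Z \<omega>)\<^sup>2) - z\<^sup>2"
    using variance_eq[OF intZ intZ2] by (simp add: z_def)
  moreover have nn: "0 \<le> expectation (\<lambda>\<omega>. (Z \<omega> - z)\<^sup>2)" by (intro Bochner_Integration.integral_nonneg) simp
  ultimately have "expectation (\<lambda>\<omega>. (Z \<omega> - z)\<^sup>2) = 0" by linarith
  moreover have "integrable M (\<lambda>\<omega>. (Z \<omega> - z)\<^sup>2)"
    using intZ intZ2 by (simp add: power2_diff)
  ultimately have "AE \<omega> in M. (Z \<omega> - z)\<^sup>2 = 0"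
    using integral_nonneg_eq_0_iff_AE[of M "\<lambda>\<omega>. (Z \<omega> - z)\<^sup>2"] by simp
  then have Zz: "AE \<omega> in M. Z \<omega> = z" by simp
  define c where "c = - ln z"
  have Wc: "AE \<omega> in M. W k \<omega> \<le> c" for k
    using Zz
  proof eventually_elim
    case (elim \<omega>)
    then have "z \<le> exp (- W k \<omega>)" using Zle[of \<omega> k] by simp
    then have "ln z \<le> - W k \<omega>" using z by (metis exp_gt_zero ln_exp ln_le_cancel_iff)
    then show ?case by (simp add: c_def)
  qed
  have c0: "0 \<le> c"
  proof (rule ccontr)
    assume neg: "\<not> 0 \<le> c"
    have "AE \<omega> in M. False" using Wc[of 0]
    proof eventually_elim
      case (elim \<omega>)
      then show ?case using W0[of 0 \<omega>] neg by linarith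
    qed
    then show False by simp
  qed
  have "prob {\<omega> \<in> space M. c * (1 / 2^k) < X (1 / 2^k) \<omega> - X 0 \<omega>} = 0" for k
  proof -
    \<comment> \<open>If one step exceeded \<open>c * h k\<close> with positive probability, then by
      independence so would all \<open>2^k\<close> steps at once, and \<open>W k\<close> would
      exceed \<open>c\<close>.\<close>
    let ?A = "{\<omega> \<in> space M. \<forall>i<2^k. c * h k < steps (h k) \<omega> i}"
    have "prob ?A = prob {\<omega> \<in> space M. c * h k < X (h k) \<omega> - X 0 \<omega>} ^ 2^k"
      by (rule prob_all_steps[OF h, of "\<lambda>y. c * h k < y"]) measurable
    moreover have "prob ?A = 0"
    proof -
      have "AE \<omega> in M. \<omega> \<notin> ?A"
        using Wc[of k]
      proof eventually_elim
        case (elim \<omega>)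
        show ?case
        proof
          assume "\<omega> \<in> ?A"
          then have "(\<Sum>i<(2::nat)^k. c * h k) < W k \<omega>"
            unfolding W_def by (intro sum_strict_mono) (auto simp: lessThan_empty_iff less_max_iff_disj)
          then show False using elim by (simp add: h_def)
        qed
      qed
      moreover have "?A \<in> events"
        by (rule all_steps_sets[OF h, of "\<lambda>y. c * h k < y"]) measurable
      ultimately show ?thesis by (simp only: prob_eq_0)
    qed
    ultimately show ?thesis by (simp add: h_def)
  qed
  then have "AE \<omega> in M. \<forall>s t. 0 \<le> s \<and> s \<le> t \<longrightarrow> X t \<omega> - X s \<omega> \<le> c * (t - s)"
    by (rule AE_slope[OF zero_less_one])
  then show thesis by (rule that)
qed

section \<open>The least slope and the excess below it\<close>

definition slope_bound :: "real \<Rightarrow> bool" where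
  "slope_bound c \<longleftrightarrow> (AE \<omega> in M. \<forall>s t. 0 \<le> s \<and> s \<le> t \<longrightarrow> X t \<omega> - X s \<omega> \<le> c * (t - s))"

text \<open>Slope bounds are positive because the paths are not decreasing, so the infimum exists.
  It is attained: the bounds \<open>d + 1 / Suc n\<close> hold simultaneously almost surely and pass
  to the limit.\<close>

lemma least_slope:
  assumes "of_bounded_variation M X"
  obtains d where "0 < d" "slope_bound d" "\<And>c. slope_bound c \<Longrightarrow> d \<le> c"
proof -
  let ?A = "{c. slope_bound c}"
  obtain c0 where c0: "c0 \<in> ?A" using bounded_variation_imp_slope[OF assms] unfolding slope_bound_def by blast
  have pos: "0 < c" if "slope_bound c" for c using that unfolding slope_bound_def by (rule not_AE_antimono)
  then have bdd: "bdd_below ?A" by (intro bdd_belowI[of _ 0]) (auto intro: less_imp_le)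
  define d where "d = Inf ?A"
  have "slope_bound (d + 1 / Suc n)" for n
  proof -
    have "\<exists>c\<in>?A. c < d + 1 / Suc n"
      unfolding d_def using c0 bdd by (intro cInf_lessD) auto
    then obtain c where c: "slope_bound c" "c < d + 1 / Suc n" by auto
    show ?thesis using c(1) unfolding slope_bound_def
    proof eventually_elim
      case (elim \<omega>)
      show ?case
      proof (intro allI impI)
        fix s t :: real assume st: "0 \<le> s \<and> s \<le> t"
        then have "X t \<omega> - X s \<omega> \<le> c * (t - s)" using elim by blast
        also have "\<dots> \<le> (d + 1 / Suc n) * (t - s)" using c st by (intro mult_right_mono) auto
        finally show "X t \<omega> - X s \<omega> \<le> (d + 1 / Suc n) * (t - s)" .
      qed
    qed
  qed
  then have "AE \<omega> in M. \<forall>n. \<forall>s t. 0 \<le> s \<and> s \<le> t \<longrightarrow> X t \<omega> - X s \<omega> \<le> (d + 1 / Suc n) * (t - s)"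
    unfolding slope_bound_def by (simp add: AE_all_countable)
  then have d: "slope_bound d" unfolding slope_bound_def
  proof eventually_elim
    case (elim \<omega>)
    show ?case
    proof (intro allI impI)
      fix s t :: real assume "0 \<le> s \<and> s \<le> t"
      then have le: "X t \<omega> - X s \<omega> \<le> (d + 1 / Suc n) * (t - s)" for n using elim by blast
      have "(\<lambda>n. (d + 1 / Suc n) * (t - s)) \<longlonglongrightarrow> (d + 0) * (t - s)"
        by (intro tendsto_mult tendsto_add tendsto_const LIMSEQ_Suc[OF lim_1_over_n])
      then have "X t \<omega> - X s \<omega> \<le> (d + 0) * (t - s)" by (rule LIMSEQ_le_const) (use le in auto)
      then show "X t \<omega> - X s \<omega> \<le> d * (t - s)" by simp
    qed
  qed
  show thesis
  proof (rule that[OF pos[OF d] d])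
    fix c assume "slope_bound c"
    then show "d \<le> c" unfolding d_def using bdd by (intro cInf_lower) auto
  qed
qed

end

context spectrally_negative_levy_process
begin

text \<open>With \<open>D t = d * t - (X t - X 0)\<close> and \<open>Z k = exp (- 2^k * D (t0 / 2^k))\<close>, the identity
  \<open>E (Z k)\<^sup>2 = (E (Z (k + 1)))\<^sup>2\<close> makes the variances of the \<open>Z k\<close> telescope.  The
  limit of \<open>E (Z k)\<close> is 1, since otherwise \<open>d\<close> would not be the least slope.\<close>

lemma small_downward_excess:
  assumes d: "slope_bound d" "\<And>c. slope_bound c \<Longrightarrow> d \<le> c" and t0: "0 < t0" and \<delta>: "0 < \<delta>"
  defines "p \<equiv> \<lambda>k. prob {\<omega> \<in> space M. \<delta> * (t0 / 2^k) < d * (t0 / 2^k) - (X (t0 / 2^k) \<omega> - X 0 \<omega>)}"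
  shows "summable p" and "p k < 1"
proof -
  define h where "h k = t0 / 2^k" for k :: nat
  have h: "0 < h k" for k using t0 by (simp add: h_def)
  \<comment> \<open>The slope bound holds only almost surely; the positive part makes
    \<open>exp (- (l * Dp t \<omega>))\<close> at most 1 for every outcome.\<close>
  define Dp where "Dp t \<omega> = max 0 (d * t - (X t \<omega> - X 0 \<omega>))" for t \<omega>
  have Dm[measurable]: "Dp t \<in> borel_measurable M" if "0 < t" for t
    unfolding Dp_def using that by (intro borel_measurable_max borel_measurable_diff borel_measurable_const X_measurable) auto
  have D0: "0 \<le> Dp t \<omega>" for t \<omega> by (simp add: Dp_def)
  define \<zeta> where "\<zeta> l t = expectation (\<lambda>\<omega>. exp (- (l * Dp t \<omega>)))" for l t
  have em: "(\<lambda>\<omega>. exp (- (l * Dp t \<omega>))) \<in> borel_measurable M" if "0 < t" for l t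
    using Dm[OF that] by measurable
  have int: "integrable M (\<lambda>\<omega>. exp (- (l * Dp t \<omega>)))" if "0 \<le> l" "0 < t" for l t
    using that D0 em[OF that(2)] by (intro integrable_unit_bounded) auto
  \<comment> \<open>Almost surely the excess over \<open>n\<close> steps is the sum of the one-step
    excesses, which are independent with the same law.\<close>
  have mult: "\<zeta> l (real n * t) = \<zeta> l t ^ n" if l: "0 \<le> l" and t: "0 < t" and n: "0 < n" for l t n
  proof -
    have um: "(\<lambda>y. exp (- (l * max 0 (d * t - y)))) \<in> borel_measurable borel" by measurable
    have nt: "0 < real n * t" using t n by simp
    have "\<zeta> l (real n * t) = expectation (\<lambda>\<omega>. \<Prod>i<n. exp (- (l * max 0 (d * t - steps t \<omega> i))))"
      unfolding \<zeta>_def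
    proof (rule integral_cong_AE)
      show "(\<lambda>\<omega>. \<Prod>i<n. exp (- (l * max 0 (d * t - steps t \<omega> i)))) \<in> borel_measurable M"
        by (intro borel_measurable_prod measurable_compose[OF step_measurable[OF t] um])
      show "AE \<omega> in M. exp (- (l * Dp (real n * t) \<omega>)) = (\<Prod>i<n. exp (- (l * max 0 (d * t - steps t \<omega> i))))"
        using d(1) unfolding slope_bound_def
      proof eventually_elim
        case (elim \<omega>)
        have st: "max 0 (d * t - steps t \<omega> i) = d * t - steps t \<omega> i" for i
        proof -
          have "real i * t \<le> real (Suc i) * t" using t by (intro mult_right_mono) auto
          then have "X (real (Suc i) * t) \<omega> - X (real i * t) \<omega> \<le> d * (real (Suc i) * t - real i * t)"
            using elim t by simp
          also have "\<dots> = d * t" by (simp add: algebra_simps)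
          finally show ?thesis by (simp add: steps_def path_steps_def)
        qed
        have "(\<Sum>i<n. max 0 (d * t - steps t \<omega> i)) = real n * (d * t) - psum (steps t \<omega>) n"
          unfolding st by (simp add: sum_subtractf psum_def)
        also have "\<dots> = d * (real n * t) - (X (real n * t) \<omega> - X 0 \<omega>)"
          by (simp add: steps_def psum_path_steps_0 mult_ac)
        also have "\<dots> = Dp (real n * t) \<omega>"
        proof -
          have "X (real n * t) \<omega> - X 0 \<omega> \<le> d * (real n * t - 0)" using elim[rule_format, of 0 "real n * t"] less_imp_le[OF nt] by simp
          then show ?thesis by (simp add: Dp_def)
        qed
        finally have "Dp (real n * t) \<omega> = (\<Sum>i<n. max 0 (d * t - steps t \<omega> i))" ..
        then show ?case by (simp add: exp_sum[symmetric] sum_distrib_left sum_negf)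
      qed
    qed (rule em[OF nt])
    also have "\<dots> = \<zeta> l t ^ n"
      unfolding \<zeta>_def Dp_def using l by (intro expectation_prod_steps t um) auto
    finally show ?thesis .
  qed
  define z where "z k = \<zeta> (2^k) (h k)" for k
  define Z where "Z k \<omega> = exp (- (2^k * Dp (h k) \<omega>))" for k \<omega>
  have Zm[measurable]: "Z k \<in> borel_measurable M" for k unfolding Z_def by (rule em[OF h])
  have zE: "z k = expectation (Z k)" for k by (simp add: z_def \<zeta>_def Z_def[abs_def])
  have Z01: "0 < Z k \<omega>" "Z k \<omega> \<le> 1" for k \<omega> using D0 by (auto simp: Z_def)
  have intZ: "integrable M (Z k)" for k using Z01 by (intro integrable_unit_bounded) (auto intro: less_imp_le)
  have intZ2: "integrable M (\<lambda>\<omega>. (Z k \<omega>)\<^sup>2)" for k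
    using power_le_one[OF less_imp_le[OF Z01(1)] Z01(2)] by (intro integrable_unit_bounded) auto
  \<comment> \<open>Squaring doubles the factor \<open>2^k\<close> in the exponent, and the excess
    over \<open>h k\<close> splits into two independent excesses over
    \<open>h (Suc k)\<close>.\<close>
  have EZ2: "expectation (\<lambda>\<omega>. (Z k \<omega>)\<^sup>2) = (z (Suc k))\<^sup>2" for k
  proof -
    have "(Z k \<omega>)\<^sup>2 = exp (- (2^Suc k * Dp (h k) \<omega>))" for \<omega>
      unfolding Z_def by (simp add: exp_double[symmetric] mult_ac)
    then have "expectation (\<lambda>\<omega>. (Z k \<omega>)\<^sup>2) = \<zeta> (2^Suc k) (h k)" by (simp add: \<zeta>_def)
    also have "h k = real 2 * h (Suc k)" by (simp add: h_def)
    also have "\<zeta> (2^Suc k) (real 2 * h (Suc k)) = \<zeta> (2^Suc k) (h (Suc k)) ^ 2" by (rule mult[OF _ h]) auto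
    finally show ?thesis by (simp add: z_def)
  qed
  have var: "variance (Z k) = (z (Suc k))\<^sup>2 - (z k)\<^sup>2" for k
    using variance_eq[OF intZ intZ2] EZ2 zE by simp
  have z0: "0 \<le> z k" for k unfolding zE using Z01 by (intro Bochner_Integration.integral_nonneg) (auto intro: less_imp_le)
  have zpos: "0 < z k" for k
  proof -
    have "z k \<noteq> 0"
    proof
      assume "z k = 0"
      then have "AE \<omega> in M. Z k \<omega> = 0"
        using integral_nonneg_eq_0_iff_AE[OF intZ[of k]] Z01 by (auto simp: zE intro: less_imp_le)
      then have "AE \<omega> in M. False"
      proof eventually_elim
        case (elim \<omega>)
        then show ?case using Z01(1)[of k \<omega>] by simp
      qed
      then show False by simp
    qed
    then show ?thesis using z0[of k] by simp
  qed
  have z1: "z k \<le> 1" for k unfolding zE using Z01 intZ by (intro integral_le_const) auto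
  have zinc: "incseq z"
  proof (rule incseq_SucI)
    fix k
    have "0 \<le> variance (Z k)" by (intro Bochner_Integration.integral_nonneg) simp
    then have "(z k)\<^sup>2 \<le> (z (Suc k))\<^sup>2" unfolding var by simp
    then show "z k \<le> z (Suc k)" using z0 by (rule power2_le_imp_le)
  qed
  obtain zl where zl: "z \<longlonglongrightarrow> zl" "\<And>k. z k \<le> zl"
    using incseq_convergent[OF zinc, of 1] z1 by auto
  have zl1: "zl \<le> 1" by (rule LIMSEQ_le_const2[OF zl(1)]) (use z1 in auto)
  have zlpos: "0 < zl" using zpos[of 0] zl(2)[of 0] by linarith
  have "zl = 1"
  proof (rule ccontr)
    assume "zl \<noteq> 1"
    \<comment> \<open>If \<open>zl < 1\<close>, then \<open>\<zeta> (2^k) (h j)\<close> is at most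
      \<open>exp (- (2 * (2^k * b)))\<close> with \<open>b = \<nu> / 2 * h j\<close>. By an
      exponential Markov inequality an increment beyond slope \<open>d - \<nu> / 2\<close>, whose
      excess is at most \<open>b\<close>, has probability at most \<open>exp (- (2^k * b))\<close>
      for every \<open>k \<ge> j\<close>, hence 0. So \<open>d - \<nu> / 2\<close> would be a
      smaller slope bound.\<close>
    define \<nu> where "\<nu> = - ln zl / t0"
    have \<nu>: "0 < \<nu>" using ln_less_zero[of zl] \<open>zl \<noteq> 1\<close> zl1 zlpos t0 by (simp add: \<nu>_def divide_neg_pos)
    have "prob {\<omega> \<in> space M. (d - \<nu> / 2) * (t0 / 2^j) < X (t0 / 2^j) \<omega> - X 0 \<omega>} = 0" (is "prob ?A = 0") for j
    proof -
      define b where "b = \<nu> / 2 * h j"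
      have b: "0 < b" using \<nu> h[of j] by (simp add: b_def)
      have Am: "?A \<in> events" using h[of j] unfolding h_def by (intro borel_measurable_less borel_measurable_const borel_measurable_diff X_measurable) auto
      have bound: "prob ?A \<le> (1 / b) / 2^k" if k: "j \<le> k" for k
      proof -
        obtain m where m: "k = j + m" using k le_Suc_ex by blast
        have hj: "h j = real (2^m) * h k"
          by (simp add: h_def m power_add)
        have z_le: "\<zeta> (2^k) (h j) \<le> exp (- (2 * (2^k * b)))"
        proof -
          have "\<zeta> (2^k) (h j) = z k ^ 2^m" unfolding hj z_def by (rule mult[OF _ h]) auto
          also have "\<dots> \<le> zl ^ 2^m" by (intro power_mono zl z0)
          also have "\<dots> = exp (real (2^m) * ln zl)" using zlpos by (simp add: exp_of_nat_mult del: of_nat_power)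
          also have "real (2^m) * ln zl = - (2 * (2^k * b))"
            using t0 by (simp add: b_def \<nu>_def h_def m power_add)
          finally show ?thesis .
        qed
        define A where "A = ?A"
        have A: "A \<in> events" unfolding A_def by (rule Am)
        have "exp (- (2^k * b)) * prob A = expectation (\<lambda>\<omega>. exp (- (2^k * b)) * indicator A \<omega>)"
          using A by simp
        also have "\<dots> \<le> expectation (\<lambda>\<omega>. exp (- (2^k * Dp (h j) \<omega>)))"
        proof (rule integral_mono)
          show "integrable M (\<lambda>\<omega>. exp (- (2^k * b)) * indicator A \<omega> :: real)"
            using A by (intro integrable_mult_right) (auto simp: less_top[symmetric])
          show "integrable M (\<lambda>\<omega>. exp (- (2^k * Dp (h j) \<omega>)))" by (rule int[OF _ h]) simp
          fix \<omega>
          have "Dp (h j) \<omega> \<le> b" if "\<omega> \<in> A"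
          proof -
            have "(d - \<nu> / 2) * h j < X (h j) \<omega> - X 0 \<omega>" using that by (simp add: A_def h_def)
            then show ?thesis using b unfolding Dp_def b_def left_diff_distrib by (simp add: max_def)
          qed
          then show "exp (- (2^k * b)) * indicator A \<omega> \<le> exp (- (2^k * Dp (h j) \<omega>))"
            by (cases "\<omega> \<in> A") auto
        qed
        also have "\<dots> \<le> exp (- (2 * (2^k * b)))" using z_le by (simp add: \<zeta>_def)
        also have "\<dots> = exp (- (2^k * b)) * exp (- (2^k * b))" by (simp add: exp_add[symmetric])
        finally have "prob ?A \<le> exp (- (2^k * b))" unfolding A_def[symmetric] by simp
        also have "\<dots> = 1 / exp (2^k * b)" by (simp add: exp_minus field_simps)
        also have "\<dots> \<le> 1 / (2^k * b)"
        proof (rule divide_left_mono)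
          show "2^k * b \<le> exp (2^k * b)" using exp_ge_add_one_self[of "2^k * b"] by linarith
        qed (use b in auto)
        finally show ?thesis using b by (simp add: field_simps)
      qed
      have "(\<lambda>k. (1 / b) / 2^k) \<longlonglongrightarrow> 0" by (rule LIMSEQ_divide_realpow_zero) simp
      then have "prob ?A \<le> 0" by (rule LIMSEQ_le_const) (use bound in blast)
      then show ?thesis by (simp add: measure_le_0_iff)
    qed
    then have "slope_bound (d - \<nu> / 2)" unfolding slope_bound_def by (rule AE_slope[OF t0])
    then have "d \<le> d - \<nu> / 2" by (rule d(2))
    then show False using \<nu> by simp
  qed
  then have zlim: "z \<longlonglongrightarrow> 1" using zl by simp
  \<comment> \<open>On the event measured by \<open>p k\<close> the variable \<open>Z k\<close> lies
    below \<open>\<alpha>\<close>, while its mean eventually exceeds \<open>\<beta>\<close>, a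
    number chosen between \<open>\<alpha>\<close> and 1. Chebyshev's inequality then bounds
    \<open>p k\<close> by a multiple of the variance.\<close>
  define \<alpha> where "\<alpha> = exp (- (\<delta> * t0))"
  define \<beta> where "\<beta> = exp (- (\<delta> * t0 / 2))"
  have \<alpha>\<beta>: "\<alpha> < \<beta>" "\<beta> < 1" using \<delta> t0 by (simp_all add: \<alpha>_def \<beta>_def)
  have ple: "p k \<le> ((z (Suc k))\<^sup>2 - (z k)\<^sup>2) / (\<beta> - \<alpha>)\<^sup>2" if zk: "\<beta> < z k" for k
  proof -
    have "p k \<le> prob {\<omega> \<in> space M. \<beta> - \<alpha> \<le> \<bar>Z k \<omega> - expectation (Z k)\<bar>}"
      unfolding p_def
    proof (intro finite_measure_mono subsetI)
      fix \<omega> assume \<omega>: "\<omega> \<in> {\<omega> \<in> space M. \<delta> * (t0 / 2^k) < d * (t0 / 2^k) - (X (t0 / 2^k) \<omega> - X 0 \<omega>)}"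
      then have "\<delta> * h k < Dp (h k) \<omega>" by (auto simp: Dp_def h_def)
      then have "2^k * (\<delta> * h k) < 2^k * Dp (h k) \<omega>" by simp
      then have "\<delta> * t0 < 2^k * Dp (h k) \<omega>" by (simp add: h_def)
      then have "Z k \<omega> < \<alpha>" by (simp add: Z_def \<alpha>_def)
      then show "\<omega> \<in> {\<omega> \<in> space M. \<beta> - \<alpha> \<le> \<bar>Z k \<omega> - expectation (Z k)\<bar>}"
        using \<omega> zk by (simp add: zE)
    qed measurable
    also have "\<dots> \<le> variance (Z k) / (\<beta> - \<alpha>)\<^sup>2"
      using \<alpha>\<beta> by (intro Chebyshev_inequality intZ2) auto
    finally show ?thesis unfolding var .
  qed
  show sum: "summable p"
  proof (rule summable_comparison_test_ev)
    have "eventually (\<lambda>k. \<beta> < z k) sequentially" using zlim \<alpha>\<beta> by (intro order_tendstoD(1))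
    then show "eventually (\<lambda>k. norm (p k) \<le> ((z (Suc k))\<^sup>2 - (z k)\<^sup>2) / (\<beta> - \<alpha>)\<^sup>2) sequentially"
      by eventually_elim (use ple in \<open>auto simp: p_def\<close>)
    have "(\<lambda>k. (z k)\<^sup>2) \<longlonglongrightarrow> 1\<^sup>2" by (intro tendsto_power zlim)
    then show "summable (\<lambda>k. ((z (Suc k))\<^sup>2 - (z k)\<^sup>2) / (\<beta> - \<alpha>)\<^sup>2)"
      by (intro summable_divide telescope_summable)
  qed
  have "p \<longlonglongrightarrow> 0" by (rule summable_LIMSEQ_zero[OF sum])
  then have "eventually (\<lambda>k. p k < 1) sequentially" by (intro order_tendstoD(2)) auto
  then obtain N where N: "\<And>k. N \<le> k \<Longrightarrow> p k < 1" by (auto simp: eventually_sequentially)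
  have compl: "prob {\<omega> \<in> space M. d * h k - (X (h k) \<omega> - X 0 \<omega>) \<le> \<delta> * h k} = 1 - p k" for k
  proof -
    have m: "{\<omega> \<in> space M. \<delta> * h k < d * h k - (X (h k) \<omega> - X 0 \<omega>)} \<in> events"
      using h[of k] by (intro borel_measurable_less borel_measurable_const borel_measurable_diff X_measurable) auto
    have "{\<omega> \<in> space M. d * h k - (X (h k) \<omega> - X 0 \<omega>) \<le> \<delta> * h k}
        = space M - {\<omega> \<in> space M. \<delta> * h k < d * h k - (X (h k) \<omega> - X 0 \<omega>)}" by auto
    then show ?thesis unfolding p_def using prob_compl[OF m] by (simp add: h_def)
  qed
  show "p k < 1"
  proof -
    \<comment> \<open>Summability gives \<open>p K < 1\<close> for large \<open>K\<close> only. Cut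
      \<open>h k\<close> into \<open>2^N\<close> steps of such a small length: if no step has a
      large excess, neither has their sum, and by independence this happens with positive
      probability.\<close>
    define K where "K = N + k"
    let ?n = "2^N :: nat"
    have hk: "h k = real ?n * h K" using t0 by (simp add: h_def K_def power_add)
    have "(1 - p K) ^ ?n = prob {\<omega> \<in> space M. \<forall>i<?n. d * h K - steps (h K) \<omega> i \<le> \<delta> * h K}"
      unfolding compl[symmetric] by (rule prob_all_steps[OF h, of "\<lambda>y. d * h K - y \<le> \<delta> * h K", symmetric]) measurable
    also have "\<dots> \<le> prob {\<omega> \<in> space M. d * h k - (X (h k) \<omega> - X 0 \<omega>) \<le> \<delta> * h k}"
    proof (intro finite_measure_mono subsetI)
      fix \<omega> assume \<omega>: "\<omega> \<in> {\<omega> \<in> space M. \<forall>i<?n. d * h K - steps (h K) \<omega> i \<le> \<delta> * h K}"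
      then have "(\<Sum>i<?n. d * h K - steps (h K) \<omega> i) \<le> (\<Sum>i<?n. \<delta> * h K)" by (intro sum_mono) auto
      moreover have "(\<Sum>i<?n. d * h K - steps (h K) \<omega> i) = d * h k - (X (h k) \<omega> - X 0 \<omega>)"
      proof -
        have "(\<Sum>i<?n. d * h K - steps (h K) \<omega> i) = (\<Sum>i<?n. d * h K) - psum (steps (h K) \<omega>) ?n"
          by (simp only: sum_subtractf psum_def)
        then show ?thesis unfolding hk by (simp add: steps_def psum_path_steps_0 mult_ac)
      qed
      moreover have "(\<Sum>i<?n. \<delta> * h K) = \<delta> * h k" unfolding hk by simp
      ultimately have "d * h k - (X (h k) \<omega> - X 0 \<omega>) \<le> \<delta> * h k" by (simp only:)
      then show "\<omega> \<in> {\<omega> \<in> space M. d * h k - (X (h k) \<omega> - X 0 \<omega>) \<le> \<delta> * h k}" using \<omega> by simp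
    next
      show "{\<omega> \<in> space M. d * h k - (X (h k) \<omega> - X 0 \<omega>) \<le> \<delta> * h k} \<in> events"
        using h[of k] by (intro borel_measurable_le borel_measurable_const borel_measurable_diff X_measurable) auto
    qed
    also have "\<dots> = 1 - p k" by (rule compl)
    finally have "(1 - p K) ^ ?n \<le> 1 - p k" .
    moreover have "0 < (1 - p K) ^ ?n" using N[of K] by (simp add: K_def)
    ultimately show ?thesis by linarith
  qed
qed

text \<open>Needed because a path resting at the level \<open>a\<close> after reaching it would
  delay ruin. A vanishing increment over time \<open>t\<close> has excess
  \<open>d * t > d / 2 * t\<close>, and the probability of such an excess tends to 0 along the
  dyadic times; so after each dyadic time some small dyadic increment is nonzero.\<close>

lemma AE_not_locally_constant:
  assumes d: "slope_bound d" "\<And>c. slope_bound c \<Longrightarrow> d \<le> c" "0 < d"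
  shows "AE \<omega> in M. \<forall>s\<ge>0. \<forall>e>0. \<forall>a. \<exists>t. s < t \<and> t < s + e \<and> X t \<omega> \<noteq> a"
proof -
  have pos: "0 < (1::real) / 2^k" for k :: nat by simp
  define p where "p k = prob {\<omega> \<in> space M. d / 2 * (1 / 2^k) < d * (1 / 2^k) - (X (1 / 2^k) \<omega> - X 0 \<omega>)}" for k :: nat
  have "summable p" unfolding p_def using d by (intro small_downward_excess(1)) auto
  then have p: "p \<longlonglongrightarrow> 0" by (rule summable_LIMSEQ_zero)
  have "AE \<omega> in M. \<not> (\<forall>k. steps (1 / 2^(K + k)) \<omega> (i * 2^k) = 0)" for K i
  proof -
    let ?A = "\<lambda>k. {\<omega> \<in> space M. steps (1 / 2^(K + k)) \<omega> (i * 2^k) = 0}"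
    have Am: "?A k \<in> events" for k
      by (intro borel_measurable_eq step_measurable[OF pos] borel_measurable_const)
    have le: "prob (\<Inter>k. ?A k) \<le> p (K + k)" for k
    proof -
      have "prob (\<Inter>k. ?A k) \<le> prob (?A k)" by (rule finite_measure_mono[OF _ Am]) blast
      also have "\<dots> = prob {\<omega> \<in> space M. X (1 / 2^(K + k)) \<omega> - X 0 \<omega> = 0}"
        by (rule step_prob[OF pos, of "\<lambda>y. y = 0"]) measurable
      also have "\<dots> \<le> p (K + k)"
        unfolding p_def
      proof (intro finite_measure_mono subsetI)
        show "{\<omega> \<in> space M. d / 2 * (1 / 2^(K + k)) < d * (1 / 2^(K + k)) - (X (1 / 2^(K + k)) \<omega> - X 0 \<omega>)} \<in> events"
          by (intro borel_measurable_less borel_measurable_const borel_measurable_diff X_measurable) auto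
        fix \<omega> assume \<omega>: "\<omega> \<in> {\<omega> \<in> space M. X (1 / 2^(K + k)) \<omega> - X 0 \<omega> = 0}"
        have "d / 2 * (1 / 2^(K + k)) < d * (1 / 2^(K + k))" using d(3) by (intro mult_strict_right_mono) auto
        then show "\<omega> \<in> {\<omega> \<in> space M. d / 2 * (1 / 2^(K + k)) < d * (1 / 2^(K + k)) - (X (1 / 2^(K + k)) \<omega> - X 0 \<omega>)}"
          using \<omega> by simp
      qed
      finally show ?thesis .
    qed
    have "(\<lambda>k. p (k + K)) \<longlonglongrightarrow> 0" by (rule LIMSEQ_ignore_initial_segment[OF p])
    then have "prob (\<Inter>k. ?A k) \<le> 0" by (rule LIMSEQ_le_const) (use le in \<open>auto simp: add.commute\<close>)
    then have "prob (\<Inter>k. ?A k) = 0" by (simp add: measure_le_0_iff)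
    moreover have "(\<Inter>k. ?A k) \<in> events" using Am by blast
    ultimately have "AE \<omega> in M. \<omega> \<notin> (\<Inter>k. ?A k)" by (simp only: prob_eq_0)
    then show ?thesis using AE_space by eventually_elim blast
  qed
  then have "AE \<omega> in M. \<forall>K i. \<not> (\<forall>k. steps (1 / 2^(K + k)) \<omega> (i * 2^k) = 0)" by (simp only: AE_all_countable simp_thms)
  then show ?thesis
  proof (eventually_elim, intro allI impI)
    fix \<omega> and s e a :: real
    assume \<omega>: "\<forall>K i. \<not> (\<forall>k. steps (1 / 2^(K + k)) \<omega> (i * 2^k) = 0)" and s: "0 \<le> s" and e: "0 < e"
    \<comment> \<open>A mesh below \<open>e / 3\<close> leaves room for a grid point from
      \<open>s + e / 3\<close> on and for one further step before \<open>s + e\<close>.\<close>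
    obtain K where K: "(1/2::real)^K < e / 3" using real_arch_pow_inv[of "e/3" "1/2"] e by auto
    have K': "(1::real) / 2^K < e / 3" using K by (simp add: power_one_over)
    define i where "i = nat \<lceil>(s + e/3) * 2^K / 1\<rceil>"
    have i: "s + e/3 \<le> real i * (1 / 2^K)" "real i * (1 / 2^K) < s + e/3 + 1 / 2^K"
      unfolding i_def using s e by (intro grid_above(1,2)[of "s + e/3" 1]; simp)+
    obtain k where k: "steps (1 / 2^(K + k)) \<omega> (i * 2^k) \<noteq> 0" using \<omega> by blast
    let ?h = "1 / 2^(K + k) :: real"
    have t1: "real (i * 2^k) * ?h = real i * (1 / 2^K)" by (simp add: power_add)
    have "?h \<le> 1 / 2^K" by (intro divide_left_mono power_increasing) auto
    moreover have t2: "real (Suc (i * 2^k)) * ?h = real i * (1 / 2^K) + ?h" unfolding t1[symmetric] by (simp add: algebra_simps)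
    ultimately have in2: "s < real (Suc (i * 2^k)) * ?h" "real (Suc (i * 2^k)) * ?h < s + e"
      using i K' e pos[of "K + k"] by linarith+
    have in1: "s < real (i * 2^k) * ?h" "real (i * 2^k) * ?h < s + e"
      unfolding t1 using i K' e by linarith+
    have "X (real (Suc (i * 2^k)) * ?h) \<omega> \<noteq> X (real (i * 2^k) * ?h) \<omega>"
      using k by (simp add: steps_def path_steps_def)
    then have "X (real (Suc (i * 2^k)) * ?h) \<omega> \<noteq> a \<or> X (real (i * 2^k) * ?h) \<omega> \<noteq> a" by auto
    then show "\<exists>t. s < t \<and> t < s + e \<and> X t \<omega> \<noteq> a" using in1 in2 by blast
  qed
qed

end

section \<open>Bounded variation forces creeping\<close>

text \<open>\<open>scheme d g \<delta> n r s\<close>: for \<open>n\<close> stages with time units \<open>2^n * g, \<dots>, 2 * g\<close>, a walk with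
  steps \<open>s\<close> on the grid of mesh \<open>g\<close> stays close to the line of slope \<open>d\<close>.  The remaining distance
  in units of \<open>d\<close> times the current time unit is \<open>r\<close>; a stage runs for \<open>m\<close> units, where
  \<open>m + 2 \<le> r < m + 3\<close>, and loses \<open>e\<close> units compared with the line.\<close>

primrec scheme :: "real \<Rightarrow> real \<Rightarrow> real \<Rightarrow> nat \<Rightarrow> real \<Rightarrow> (nat \<Rightarrow> real) \<Rightarrow> bool" where
  "scheme d g \<delta> 0 r s \<longleftrightarrow> True"
| "scheme d g \<delta> (Suc n) r s \<longleftrightarrow> (\<exists>m. real m + 2 \<le> r \<and> r < real m + 3 \<and>
     0 \<le> real m - psum s (m * 2^Suc n) / (d * (2^Suc n * g)) \<and>
     real m - psum s (m * 2^Suc n) / (d * (2^Suc n * g)) \<le> \<delta> \<and>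
     scheme d g \<delta> n (2 * (r - psum s (m * 2^Suc n) / (d * (2^Suc n * g)))) (drop_steps (m * 2^Suc n) s))"

text \<open>Measurability has to be joint in \<open>r\<close> and \<open>s\<close>, since each stage
  starts with a value of \<open>r\<close> computed from the earlier steps.\<close>

lemma scheme_measurable [measurable]:
  "Measurable.pred (borel \<Otimes>\<^sub>M Pi\<^sub>M UNIV (\<lambda>_. borel)) (\<lambda>(r, s). scheme d g \<delta> n r s)"
proof (induction n)
  case (Suc n)
  let ?P = "borel \<Otimes>\<^sub>M Pi\<^sub>M UNIV (\<lambda>_. borel) :: (real \<times> (nat \<Rightarrow> real)) measure"
  have p: "(\<lambda>x. psum (snd x) k) \<in> borel_measurable ?P" for k
    by (rule measurable_compose[OF measurable_snd psum_measurable_borel])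
  have f: "fst \<in> borel_measurable ?P" by (rule measurable_fst)
  have S: "Measurable.pred ?P (\<lambda>x. scheme d g \<delta> n (2 * (fst x - psum (snd x) k / c)) (drop_steps k (snd x)))" for k c
  proof -
    have "(\<lambda>x. (2 * (fst x - psum (snd x) k / c), drop_steps k (snd x))) \<in> ?P \<rightarrow>\<^sub>M ?P"
      by (intro measurable_Pair borel_measurable_times borel_measurable_diff borel_measurable_divide
          borel_measurable_const p f measurable_compose[OF measurable_snd drop_steps_measurable_borel])
    from measurable_compose[OF this Suc.IH] show ?thesis by (simp only: prod.case)
  qed
  have A: "Measurable.pred ?P (\<lambda>x. real m + 2 \<le> fst x)" "Measurable.pred ?P (\<lambda>x. fst x < real m + 3)" for m :: nat
    unfolding pred_def by (intro borel_measurable_le borel_measurable_less borel_measurable_const f)+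
  have B: "Measurable.pred ?P (\<lambda>x. 0 \<le> real m - psum (snd x) k / c)"
     "Measurable.pred ?P (\<lambda>x. real m - psum (snd x) k / c \<le> \<delta>)" for m k c
    unfolding pred_def by (intro borel_measurable_le borel_measurable_diff borel_measurable_divide borel_measurable_const p)+
  have "Measurable.pred ?P (\<lambda>x. scheme d g \<delta> (Suc n) (fst x) (snd x))"
    unfolding scheme.simps by (intro pred_intros_countable(2) pred_intros_logic(3) A B S)
  then show ?case unfolding case_prod_beta' .
qed simp

context iid_steps
begin

text \<open>The interval \<open>[4, 7)\<close> is invariant: \<open>r - m\<close> lies in
  \<open>[2, 3)\<close>, the loss adds at most \<open>1/2\<close>, and halving the unit doubles the
  result. Hence \<open>m\<close> is 2, 3 or 4. The excess below the line never decreases, so a small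
  excess over 5 units forces a small one over \<open>m\<close> units. This sufficient event depends
  on the stage but not on the past, so the probabilities multiply.\<close>

lemma scheme_prob_ge:
  assumes d: "0 < d" and g: "0 < g" and \<delta>: "\<delta> \<le> 1/2" and steps: "measure S {s. d * g < s 0} = 0"
    and r: "4 \<le> r" "r < 7"
  shows "(\<Prod>j<n. measure S {s. d * (5 * (2^Suc j * g)) - psum s (5 * 2^Suc j) \<le> \<delta> * (d * (2^Suc j * g))})
    \<le> measure S {s. scheme d g \<delta> n r s}"
  using r
proof (induction n arbitrary: r)
  case 0
  then show ?case using P.prob_space by simp
next
  case (Suc n)
  define U where "U = d * (2^Suc n * g)"
  have U: "0 < U" using d g by (simp add: U_def)
  let ?q = "\<lambda>j. measure S {s. d * (5 * (2^Suc j * g)) - psum s (5 * 2^Suc j) \<le> \<delta> * (d * (2^Suc j * g))}"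
  define m where "m = nat \<lfloor>r\<rfloor> - 2"
  have m: "real m + 2 \<le> r" "r < real m + 3" "2 \<le> m" "m \<le> 4"
  proof -
    have fl: "4 \<le> \<lfloor>r\<rfloor>" "\<lfloor>r\<rfloor> \<le> 6" using Suc.prems by linarith+
    then have "int m = \<lfloor>r\<rfloor> - 2" unfolding m_def by arith
    then have "real m = of_int \<lfloor>r\<rfloor> - 2" "2 \<le> m" "m \<le> 4" using fl by linarith+
    then show "real m + 2 \<le> r" "r < real m + 3" "2 \<le> m" "m \<le> 4" by linarith+
  qed
  define M where "M = m * 2^Suc n"
  define A where "A s \<longleftrightarrow> 0 \<le> real m - psum s M / U \<and> real m - psum s M / U \<le> \<delta>" for s
  define B where "B s s' \<longleftrightarrow> scheme d g \<delta> n (2 * (r - psum s M / U)) s'" for s s'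
  have Am: "Measurable.pred S A" unfolding A_def[abs_def] by measurable
  have Bm: "Measurable.pred (S \<Otimes>\<^sub>M S) (\<lambda>(s, s'). B s s')"
  proof -
    have "(\<lambda>x. (2 * (r - psum (fst x) M / U), snd x)) \<in> S \<Otimes>\<^sub>M S \<rightarrow>\<^sub>M borel \<Otimes>\<^sub>M Pi\<^sub>M UNIV (\<lambda>_. borel)"
      by measurable
    from measurable_compose[OF this scheme_measurable[of d g \<delta> n]] show ?thesis
      unfolding B_def by (simp only: prod.case case_prod_beta' fst_conv snd_conv)
  qed
  have "(\<Prod>j<Suc n. ?q j) = ?q n * (\<Prod>j<n. ?q j)" by simp
  also have "\<dots> \<le> measure S {s. A s} * (\<Prod>j<n. ?q j)"
  proof (intro mult_right_mono prod_nonneg)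
    have AE_step: "AE s in S. s i \<le> d * g" for i
    proof -
      have "measure S {s. d * g < s i} = measure S {s. d * g < s 0}"
        using prob_shift[of "\<lambda>s. d * g < s 0" i] by (simp add: drop_steps_def)
      then have 0: "measure S {s. d * g < s i} = 0" using steps by simp
      have "{s. d * g < s i} \<in> sets S" by (rule Collect_sets) measurable
      then have "AE s in S. s \<notin> {s. d * g < s i}" using 0 by (simp only: P.prob_eq_0)
      then show ?thesis by eventually_elim auto
    qed
    have AE_steps: "AE s in S. \<forall>i. s i \<le> d * g" using AE_step by (simp add: AE_all_countable)
    show "?q n \<le> measure S {s. A s}"
    proof (rule P.finite_measure_mono_AE)
      show "{s. A s} \<in> sets S" by (rule Collect_sets[OF Am])
      show "AE s in S. s \<in> {s. d * (5 * (2^Suc n * g)) - psum s (5 * 2^Suc n) \<le> \<delta> * (d * (2^Suc n * g))} \<longrightarrow> s \<in> {s. A s}"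
        using AE_steps
      proof (eventually_elim, intro impI)
        fix s assume st: "\<forall>i. s i \<le> d * g"
          and s: "s \<in> {s. d * (5 * (2^Suc n * g)) - psum s (5 * 2^Suc n) \<le> \<delta> * (d * (2^Suc n * g))}"
        have psum_le: "psum s k \<le> real k * (d * g)" if "\<forall>i. s i \<le> d * g" for s :: "nat \<Rightarrow> real" and k
          unfolding psum_def using sum_mono[of "{..<k}" s "\<lambda>_. d * g"] that by simp
        have "psum s (5 * 2^Suc n) = psum s M + psum (drop_steps M s) (5 * 2^Suc n - M)"
          using psum_add[of s M "5 * 2^Suc n - M"] m by (simp add: M_def)
        moreover have "psum (drop_steps M s) (5 * 2^Suc n - M) \<le> real (5 * 2^Suc n - M) * (d * g)"
          using st by (intro psum_le) (auto simp: drop_steps_def)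
        moreover have "real (5 * 2^Suc n - M) = 5 * 2^Suc n - real m * 2^Suc n"
          using m unfolding M_def by (subst of_nat_diff) auto
        ultimately have "psum s (5 * 2^Suc n) \<le> psum s M + (5 * 2^Suc n - real m * 2^Suc n) * (d * g)" by simp
        also have "\<dots> = psum s M + 5 * U - real m * U" by (simp add: U_def algebra_simps)
        finally have "5 * U - \<delta> * U \<le> psum s M + 5 * U - real m * U"
          using s by (simp add: U_def mult.left_commute)
        then have "real m * U - psum s M \<le> \<delta> * U" by simp
        then have 1: "real m - psum s M / U \<le> \<delta>" using U by (simp add: field_simps)
        have "psum s M \<le> real M * (d * g)" using st by (rule psum_le)
        also have "\<dots> = real m * U" by (simp add: M_def U_def mult_ac)
        finally have "0 \<le> real m - psum s M / U" using U by (simp add: field_simps)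
        with 1 show "s \<in> {s. A s}" by (simp add: A_def)
      qed
    qed
  qed simp
  also have "\<dots> \<le> measure S {s. A s \<and> B s (drop_steps M s)}"
  proof (rule prob_split_ge[OF Am Bm])
    show "A (comb_seq M s s') \<longleftrightarrow> A s" for s s' by (simp add: A_def psum_comb_seq)
    show "B (comb_seq M s s') s'' \<longleftrightarrow> B s s''" for s s' s'' by (simp add: B_def psum_comb_seq)
    show "0 \<le> (\<Prod>j<n. ?q j)" by (intro prod_nonneg) simp
    have key: "4 \<le> 2 * (r - y) \<and> 2 * (r - y) < 7" if "0 \<le> real m - y" "real m - y \<le> 1/2" for y
      using that m(1,2) by argo
    fix s assume "A s"
    then have "0 \<le> real m - psum s M / U" and le: "real m - psum s M / U \<le> \<delta>" by (simp_all only: A_def)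
    moreover have "real m - psum s M / U \<le> 1/2" by (rule order_trans[OF le \<delta>])
    ultimately
    show "(\<Prod>j<n. ?q j) \<le> measure S {s'. B s s'}"
      unfolding B_def using key[of "psum s M / U"] by (intro Suc.IH) blast+
  qed
  also have "\<dots> \<le> measure S {s. scheme d g \<delta> (Suc n) r s}"
  proof (rule P.finite_measure_mono)
    show "{s. A s \<and> B s (drop_steps M s)} \<subseteq> {s. scheme d g \<delta> (Suc n) r s}"
      using m unfolding A_def B_def M_def U_def scheme.simps by blast
    have "(\<lambda>s. (r, s)) \<in> S \<rightarrow>\<^sub>M borel \<Otimes>\<^sub>M Pi\<^sub>M UNIV (\<lambda>_. borel)" by measurable
    from measurable_compose[OF this scheme_measurable[of d g \<delta> "Suc n"]]
    show "{s. scheme d g \<delta> (Suc n) r s} \<in> sets S" by (intro Collect_sets) (simp only: prod.case)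
  qed
  finally show ?case .
qed

end

text \<open>The stage times do not depend on the grid, so that the schemes on different grids describe
  initial segments of one and the same sequence of stages.\<close>

primrec stage_time :: "(real \<Rightarrow> real) \<Rightarrow> real \<Rightarrow> real \<Rightarrow> real \<Rightarrow> nat \<Rightarrow> real" where
  "stage_time f a d h 0 = 0"
| "stage_time f a d h (Suc k) = stage_time f a d h k
     + real (nat \<lfloor>(a - f (stage_time f a d h k)) / (d * (h / 2^k))\<rfloor> - 2) * (h / 2^k)"

text \<open>The bounds \<open>m + 2 \<le> r\<close> and \<open>r < m + 3\<close> determine
  \<open>m\<close> as the floor of \<open>r\<close> minus 2, the choice made in
  \<open>stage_time\<close>. The induction runs over the remaining stages, \<open>i\<close> being
  the grid index at which stage \<open>k\<close> starts.\<close>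

lemma scheme_imp_stages:
  assumes d: "0 < d" and h: "0 < h"
    and g: "g = h / 2^(k + n)" and i: "real i * g = stage_time f a d h k"
    and sch: "scheme d g \<delta> n ((a - f (stage_time f a d h k)) / (d * (h / 2^k))) (drop_steps i (path_steps f g))"
    and j: "k \<le> j" "j < k + n"
  defines "v \<equiv> stage_time f a d h"
  shows "\<exists>m. real m + 2 \<le> (a - f (v j)) / (d * (h / 2^j)) \<and> (a - f (v j)) / (d * (h / 2^j)) < real m + 3 \<and>
     v (Suc j) = v j + real m * (h / 2^j) \<and>
     0 \<le> real m - (f (v (Suc j)) - f (v j)) / (d * (h / 2^j)) \<and>
     real m - (f (v (Suc j)) - f (v j)) / (d * (h / 2^j)) \<le> \<delta>"
  using g i sch j
proof (induction n arbitrary: k i)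
  case (Suc n)
  have u: "2^Suc n * g = h / 2^k" unfolding Suc.prems(1) by (simp add: power_add)
  let ?r = "(a - f (v k)) / (d * (h / 2^k))"
  obtain m where m: "real m + 2 \<le> ?r" "?r < real m + 3"
    and e: "0 \<le> real m - psum (drop_steps i (path_steps f g)) (m * 2^Suc n) / (d * (h / 2^k))"
      "real m - psum (drop_steps i (path_steps f g)) (m * 2^Suc n) / (d * (h / 2^k)) \<le> \<delta>"
    and sch: "scheme d g \<delta> n (2 * (?r - psum (drop_steps i (path_steps f g)) (m * 2^Suc n) / (d * (h / 2^k))))
        (drop_steps (m * 2^Suc n) (drop_steps i (path_steps f g)))"
    using Suc.prems(3) unfolding scheme.simps u v_def by blast
  have "\<lfloor>?r\<rfloor> = int m + 2" using m by (intro floor_unique) auto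
  then have vS: "v (Suc k) = v k + real m * (h / 2^k)" by (simp add: v_def)
  have t: "real (i + m * 2^Suc n) * g = v (Suc k)"
  proof -
    have "real (i + m * 2^Suc n) * g = real i * g + real m * (2^Suc n * g)" by (simp add: algebra_simps)
    also have "\<dots> = v k + real m * (h / 2^k)" unfolding u Suc.prems(2) v_def ..
    finally show ?thesis unfolding vS .
  qed
  have ps: "psum (drop_steps i (path_steps f g)) (m * 2^Suc n) = f (v (Suc k)) - f (v k)"
    unfolding psum_path_steps t using Suc.prems(2) by (simp add: v_def)
  show ?case
  proof (cases "j = k")
    case True
    then show ?thesis using m vS e unfolding ps by blast
  next
    case False
    have nz: "d * (h / 2^k) \<noteq> 0" using d h by simp
    have "2 * (?r - (f (v (Suc k)) - f (v k)) / (d * (h / 2^k))) = 2 * ((a - f (v (Suc k))) / (d * (h / 2^k)))"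
    proof -
      have eq: "a - f (v (Suc k)) = (a - f (v k)) - (f (v (Suc k)) - f (v k))" by simp
      show ?thesis by (subst eq) (simp only: diff_divide_distrib)
    qed
    also have "\<dots> = (a - f (v (Suc k))) / (d * (h / 2^Suc k))" by simp
    finally have "scheme d g \<delta> n ((a - f (stage_time f a d h (Suc k))) / (d * (h / 2^Suc k)))
        (drop_steps (i + m * 2^Suc n) (path_steps f g))"
      using sch unfolding ps drop_steps_shift v_def by (simp only: add.commute)
    then show ?thesis
      using Suc.prems False t[unfolded v_def] by (intro Suc.IH[of "Suc k" "i + m * 2^Suc n"]) auto
  qed
qed simp

text \<open>During stage \<open>j\<close> the distance to \<open>a\<close> is at least
  \<open>2 * (d * H j)\<close>, while the excess \<open>w\<close> accumulated from this stage on is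
  at most the geometric sum \<open>2 * \<delta> * (d * H j)\<close>. So the fall after any point is
  at most \<open>\<delta>\<close> times the distance from that point to \<open>a\<close>.\<close>

lemma stages_imp_good_path:
  assumes f0: "f 0 = a - 4 * (d * h)" and d: "0 < d" and h: "0 < h"
    and slope: "\<And>s t. 0 \<le> s \<Longrightarrow> s \<le> t \<Longrightarrow> f t - f s \<le> d * (t - s)"
    and \<delta>: "0 < \<delta>" "\<delta> \<le> 1/2" "\<delta> \<le> c"
  defines "v \<equiv> stage_time f a d h"
  assumes stages: "\<And>j. \<exists>m. real m + 2 \<le> (a - f (v j)) / (d * (h / 2^j)) \<and> (a - f (v j)) / (d * (h / 2^j)) < real m + 3 \<and>
     v (Suc j) = v j + real m * (h / 2^j) \<and>
     0 \<le> real m - (f (v (Suc j)) - f (v j)) / (d * (h / 2^j)) \<and>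
     real m - (f (v (Suc j)) - f (v j)) / (d * (h / 2^j)) \<le> \<delta>"
  shows "\<exists>s>0. (\<forall>r t. 0 \<le> r \<and> r \<le> t \<and> t < s \<longrightarrow> f r < a \<and> a - f t \<le> (1 + c) * (a - f r)) \<and>
       (\<forall>e>0. \<exists>r\<ge>0. r < s \<and> a - e < f r)"
proof -
  define H where "H k = h / 2^k" for k :: nat
  have H: "0 < H k" for k using h by (simp add: H_def)
  have HS: "H k = 2 * H (Suc k)" for k by (simp add: H_def)
  have dH: "0 < d * H k" for k using d H by simp
  define r where "r k = (a - f (v k)) / (d * H k)" for k
  obtain m where m: "\<And>k. real (m k) + 2 \<le> r k" "\<And>k. r k < real (m k) + 3"
      "\<And>k. v (Suc k) = v k + real (m k) * H k"
      "\<And>k. 0 \<le> real (m k) - (f (v (Suc k)) - f (v k)) / (d * H k)"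
      "\<And>k. real (m k) - (f (v (Suc k)) - f (v k)) / (d * H k) \<le> \<delta>"
    using stages unfolding r_def H_def by metis
  define w where "w t = d * t - f t" for t
  have wmono: "w s \<le> w t" if "0 \<le> s" "s \<le> t" for s t
    using slope[OF that] by (simp add: w_def algebra_simps)
  have wS: "0 \<le> w (v (Suc k)) - w (v k)" "w (v (Suc k)) - w (v k) \<le> \<delta> * (d * H k)" for k
  proof -
    have eq: "real (m k) - (f (v (Suc k)) - f (v k)) / (d * H k) = (w (v (Suc k)) - w (v k)) / (d * H k)"
      using dH[of k] d H[of k] unfolding w_def m(3) by (simp add: field_simps)
    show "0 \<le> w (v (Suc k)) - w (v k)" using m(4)[of k] dH[of k] unfolding eq by (simp add: zero_le_divide_iff)
    show "w (v (Suc k)) - w (v k) \<le> \<delta> * (d * H k)" using m(5)[of k] dH[of k] unfolding eq by (simp add: pos_divide_le_eq)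
  qed
  have R: "a - f (v k) = r k * (d * H k)" for k
  proof -
    have "d * H k \<noteq> 0" using dH[of k] by (metis less_irrefl)
    then show ?thesis unfolding r_def by (metis nonzero_divide_eq_eq)
  qed
  have RS: "a - f (v (Suc k)) = (r k - real (m k)) * (d * H k) + (w (v (Suc k)) - w (v k))" for k
    using R[of k] unfolding w_def m(3) by (simp add: algebra_simps)
  have v0: "v 0 = 0" by (simp add: v_def)
  have r0: "r 0 = 4" unfolding r_def v0 f0 using d h by (simp add: H_def)
  have rb: "4 \<le> r k \<and> r k < 7" for k
  proof (induction k)
    case (Suc k)
    define D where "D = d * H k"
    define q where "q = 2 * (r k - real (m k))"
    define y where "y = w (v (Suc k)) - w (v k)"
    have D: "0 < D" unfolding D_def by (rule dH)
    have q: "4 \<le> q" "q < 6" using m(1,2)[of k] by (simp_all add: q_def)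
    have "r (Suc k) * (d * H (Suc k)) = (r k - real (m k)) * (d * H k) + y"
      using RS[of k] R[of "Suc k"] by (simp add: y_def)
    then have eq: "r (Suc k) * D = q * D + 2 * y"
      using HS[of k] by (simp add: D_def q_def algebra_simps)
    have y: "0 \<le> y" "y \<le> \<delta> * D" using wS[of k] by (simp_all only: y_def D_def)
    have "4 * D \<le> q * D" using q D by (intro mult_right_mono) auto
    then have 1: "4 * D \<le> r (Suc k) * D" using eq y by linarith
    have "\<delta> * D \<le> 1/2 * D" using \<delta> D by (intro mult_right_mono) auto
    moreover have "q * D < 6 * D" using q D by (intro mult_strict_right_mono) auto
    ultimately have "r (Suc k) * D < 7 * D" using eq y by linarith
    with 1 show ?case using D by (simp add: mult_le_cancel_right mult_less_cancel_right)
  qed (simp add: r0)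
  have mb: "2 \<le> m k" "m k \<le> 4" for k
  proof -
    have "1 < real (m k)" "real (m k) < 5" using m(1,2)[of k] rb[of k] by linarith+
    then show "2 \<le> m k" "m k \<le> 4" by simp_all
  qed
  have vlt: "v k < v (Suc k)" for k using mb(1)[of k] H[of k] unfolding m(3) by (simp add: zero_less_mult_iff)
  have vinc: "incseq v" using vlt by (intro incseq_SucI less_imp_le)
  have vb: "v k \<le> 8 * (h - H k)" for k
  proof (induction k)
    case (Suc k)
    have "real (m k) * H k \<le> 4 * H k" using mb(2)[of k] H[of k] by (intro mult_right_mono) auto
    moreover have "H (Suc k) = H k / 2" using HS[of k] by simp
    ultimately show ?case using Suc unfolding m(3) by simp
  qed (simp add: v0 H_def)
  have "v k \<le> 8 * h" for k using vb[of k] H[of k] by simp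
  then obtain s where s: "v \<longlonglongrightarrow> s" "\<And>k. v k \<le> s" using incseq_convergent[OF vinc] by blast
  have vs: "v k < s" for k using vlt[of k] s(2)[of "Suc k"] by linarith
  have vge: "0 \<le> v k" for k using vinc v0 by (metis incseq_def le0)
  have stage: "\<exists>k. v k \<le> t \<and> t < v (Suc k)" if t: "0 \<le> t" "t < s" for t
  proof -
    have "eventually (\<lambda>k. t < v k) sequentially" using s(1) t by (intro order_tendstoD(1))
    then obtain K where K: "t < v K" by (auto simp: eventually_sequentially)
    define l where "l = (LEAST k. t < v k)"
    have l: "t < v l" unfolding l_def by (rule LeastI[of _ K]) (rule K)
    have "l \<noteq> 0" using l t v0 by (cases "l = 0") auto
    then obtain k where k: "l = Suc k" by (cases l) auto
    have "\<not> t < v k" using not_less_Least[of k "\<lambda>k. t < v k"] k unfolding l_def by simp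
    then show ?thesis using l k by (intro exI[of _ k]) auto
  qed
  \<comment> \<open>The distance at the end of the stage is \<open>(r j - m j) * (d * H j)\<close>
    plus the excess of the whole stage; going back to \<open>u\<close> removes at most that
    excess.\<close>
  have low: "2 * (d * H j) \<le> a - f u" if u: "v j \<le> u" "u < v (Suc j)" for u j
  proof -
    have "w (v (Suc j)) - w u \<le> w (v (Suc j)) - w (v j)" using wmono[of "v j" u] u vge[of j] by simp
    moreover have "0 \<le> d * (v (Suc j) - u)" using d u by simp
    moreover have "a - f u = (a - f (v (Suc j))) + d * (v (Suc j) - u) - (w (v (Suc j)) - w u)"
      by (simp add: w_def algebra_simps)
    moreover have "2 * (d * H j) \<le> (r j - real (m j)) * (d * H j)"
      using m(1)[of j] dH[of j] by (intro mult_right_mono) auto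
    ultimately show ?thesis using RS[of j] by linarith
  qed
  have wsum: "w (v (j + l)) - w (v j) \<le> 2 * \<delta> * (d * (H j - H (j + l)))" for j l
  proof (induction l)
    case (Suc l)
    have "2 * \<delta> * (d * (H j - H (j + Suc l))) = 2 * \<delta> * (d * (H j - H (j + l))) + 2 * \<delta> * (d * (H (j + l) - H (Suc (j + l))))"
      by (simp add: algebra_simps)
    also have "2 * \<delta> * (d * (H (j + l) - H (Suc (j + l)))) = \<delta> * (d * H (j + l))"
      using HS[of "j + l"] by simp
    finally show ?case using Suc wS(2)[of "j + l"] by simp
  qed simp
  have "f u < a \<and> a - f t \<le> (1 + c) * (a - f u)" if ut: "0 \<le> u" "u \<le> t" "t < s" for u t
  proof -
    obtain j where j: "v j \<le> u" "u < v (Suc j)" using stage[of u] ut by auto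
    obtain k where k: "v k \<le> t" "t < v (Suc k)" using stage[of t] ut by auto
    have "j < Suc k"
    proof (rule ccontr)
      assume "\<not> j < Suc k"
      then have "v (Suc k) \<le> v j" using vinc by (simp add: incseq_def)
      then show False using j k ut by linarith
    qed
    then obtain l where l: "Suc k = j + l" using le_Suc_ex[of j "Suc k"] by auto
    have R2: "2 * (d * H j) \<le> a - f u" by (rule low[OF j])
    have "w t - w u \<le> w (v (j + l)) - w (v j)"
      using wmono[of t "v (Suc k)"] wmono[of "v j" u] j k ut vge[of j] unfolding l by simp
    also have "\<dots> \<le> 2 * \<delta> * (d * (H j - H (j + l)))" by (rule wsum)
    also have "\<dots> \<le> 2 * \<delta> * (d * H j)" using \<delta> d H[of "j + l"] by (intro mult_left_mono) auto
    also have "\<dots> = \<delta> * (2 * (d * H j))" by simp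
    also have "\<dots> \<le> \<delta> * (a - f u)" using R2 \<delta> by (intro mult_left_mono) auto
    also have "\<dots> \<le> c * (a - f u)" using R2 \<delta> dH[of j] by (intro mult_right_mono) auto
    finally have "w t - w u \<le> c * (a - f u)" .
    moreover have "a - f t = (a - f u) - d * (t - u) + (w t - w u)" by (simp add: w_def algebra_simps)
    moreover have "0 \<le> d * (t - u)" using d ut by simp
    moreover have "(1 + c) * (a - f u) = (a - f u) + c * (a - f u)" by (simp add: algebra_simps)
    ultimately have "a - f t \<le> (1 + c) * (a - f u)" by linarith
    moreover have "f u < a" using R2 dH[of j] by linarith
    ultimately show ?thesis by simp
  qed
  moreover have "\<exists>u\<ge>0. u < s \<and> a - e < f u" if e: "0 < e" for e
  proof -
    have "H \<longlonglongrightarrow> 0" unfolding H_def by (rule LIMSEQ_divide_realpow_zero) simp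
    then have "(\<lambda>k. 7 * (d * H k)) \<longlonglongrightarrow> 7 * (d * 0)" by (intro tendsto_mult tendsto_const)
    then have "eventually (\<lambda>k. 7 * (d * H k) < e) sequentially" using e by (intro order_tendstoD(2)) auto
    then obtain k where k: "7 * (d * H k) < e" by (auto simp: eventually_sequentially)
    have "a - f (v k) < 7 * (d * H k)" unfolding R using rb[of k] dH[of k] by (intro mult_strict_right_mono) auto
    then show ?thesis using k vge[of k] vs[of k] by (intro exI[of _ "v k"]) auto
  qed
  moreover have "0 < s" using vs[of 0] v0 by simp
  ultimately show ?thesis by blast
qed

text \<open>Before \<open>s\<close> the drawdown is at most \<open>c * (a - g t)\<close>, and the
  lower bound on \<open>gamma_bar\<close> excludes ruin. At \<open>s\<close> the supremum reaches
  \<open>a\<close>. Afterwards \<open>gamma_bar\<close> is at most 0, so the path is ruined as soon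
  as the supremum exceeds \<open>a\<close> or \<open>X\<close> differs from \<open>a\<close>, and
  \<open>nc\<close> supplies such times arbitrarily soon.\<close>

lemma good_path_creeps:
  assumes f: "cadlag_no_positive_jumps (\<lambda>t. X t \<omega>)" and X0: "X 0 \<omega> = x" and x: "0 < x"
    and \<gamma>: "continuous_on {0..} \<gamma>" and c: "0 < c"
    and low: "\<And>y. x \<le> y \<Longrightarrow> y \<le> a \<Longrightarrow> c * (a - y) \<le> gamma_bar \<gamma> x y"
    and neg: "\<And>y. a \<le> y \<Longrightarrow> gamma_bar \<gamma> x y \<le> 0" "\<And>y. a < y \<Longrightarrow> gamma_bar \<gamma> x y < 0"
    and s: "0 < s"
    and good: "\<And>r t. 0 \<le> r \<Longrightarrow> r \<le> t \<Longrightarrow> t < s \<Longrightarrow> X r \<omega> < a \<and> a - X t \<omega> \<le> (1 + c) * (a - X r \<omega>)"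
    and app: "\<And>e. 0 < e \<Longrightarrow> \<exists>r\<ge>0. r < s \<and> a - e < X r \<omega>"
    and nc: "\<And>e. 0 < e \<Longrightarrow> \<exists>t. s < t \<and> t < s + e \<and> X t \<omega> \<noteq> a"
  shows "sigma_time X (ereal a) \<omega> = ruin_time \<gamma> X \<omega>"
proof -
  define g where "g = path_sup (\<lambda>t. X t \<omega>)"
  have S: "running_sup X t \<omega> = g t" for t by (simp add: g_def running_sup_eq)
  have g0: "g 0 = x" using path_sup_0[OF f] X0 by (simp add: g_def)
  have gc: "continuous_on {0..} g" unfolding g_def by (rule path_sup_continuous[OF f])
  have gmono: "g s \<le> g t" if "0 \<le> s" "s \<le> t" for s t
    unfolding g_def using path_sup_mono[OF f] that by simp
  have Xg: "X r \<omega> \<le> g t" if "0 \<le> r" "r \<le> t" for r t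
    unfolding g_def using path_le_sup[OF f] that by simp
  have gle: "g t \<le> y \<longleftrightarrow> (\<forall>r\<in>{0..t}. X r \<omega> \<le> y)" if "0 \<le> t" for t y
    unfolding g_def by (rule path_sup_le_iff[OF f that])
  have pert: "perturbed \<gamma> X t \<omega> = gamma_bar \<gamma> x (g t) - (g t - X t \<omega>)" if "0 \<le> t" for t
    using perturbed_eq[of X \<omega> x \<gamma> t] f x X0 \<gamma> that by (simp add: S)
  have before: "g t < a \<and> a - X t \<omega> \<le> (1 + c) * (a - g t)" if t: "0 \<le> t" "t < s" for t
  proof -
    \<comment> \<open>Solved for \<open>X r \<omega>\<close>, the bound \<open>good\<close> has a
      right-hand side free of \<open>r\<close> and passes to the supremum. It also gives the strict
      \<open>g t < a\<close>, which does not follow from \<open>X r \<omega> < a\<close>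
      alone.\<close>
    have "g t \<le> a - (a - X t \<omega>) / (1 + c)"
      unfolding gle[OF t(1)]
    proof
      fix r assume "r \<in> {0..t}"
      then have "a - X t \<omega> \<le> (1 + c) * (a - X r \<omega>)" using good[of r t] t by auto
      then show "X r \<omega> \<le> a - (a - X t \<omega>) / (1 + c)" using c by (simp add: field_simps)
    qed
    then have le: "(a - X t \<omega>) / (1 + c) \<le> a - g t" by simp
    then have "a - X t \<omega> \<le> (1 + c) * (a - g t)" using c by (simp add: field_simps)
    moreover have "0 < (a - X t \<omega>) / (1 + c)" using good[of t t] t c by simp
    ultimately show ?thesis using le by linarith
  qed
  have gs: "g s = a"
  proof (rule order.antisym)
    have "g (s - s / Suc n) \<le> a" for n
      using before[of "s - s / Suc n"] s by (simp add: field_simps)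
    moreover have "(\<lambda>n. g (s - s / Suc n)) \<longlonglongrightarrow> g s"
    proof (rule continuous_on_tendsto_compose[OF gc])
      have "(\<lambda>n. s - s * (1 / Suc n)) \<longlonglongrightarrow> s - s * 0"
        by (intro tendsto_diff tendsto_mult tendsto_const LIMSEQ_Suc[OF lim_1_over_n])
      then show "(\<lambda>n. s - s / Suc n) \<longlonglongrightarrow> s" by simp
      show "\<forall>\<^sub>F n in sequentially. s - s / real (Suc n) \<in> {0..}"
        using s by (intro always_eventually) (auto simp: field_simps)
    qed (use s in simp)
    ultimately show "g s \<le> a" by (intro LIMSEQ_le_const2) auto
    show "a \<le> g s"
    proof (rule field_le_epsilon)
      fix e :: real assume "0 < e"
      then obtain r where "0 \<le> r" "r < s" "a - e < X r \<omega>" using app by blast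
      then show "a \<le> g s + e" using Xg[of r s] by simp
    qed
  qed
  have "sigma_time X (ereal a) \<omega> = ereal s"
    unfolding sigma_time_def S
  proof (rule order.antisym)
    show "Inf (ereal ` {t. 0 < t \<and> ereal (g t) = ereal a}) \<le> ereal s" using gs s by (intro Inf_lower) auto
    show "ereal s \<le> Inf (ereal ` {t. 0 < t \<and> ereal (g t) = ereal a})"
    proof (rule Inf_greatest)
      fix y assume "y \<in> ereal ` {t. 0 < t \<and> ereal (g t) = ereal a}"
      then obtain t where t: "y = ereal t" "0 < t" "g t = a" by auto
      have "\<not> t < s" using before[of t] t by auto
      then show "ereal s \<le> y" by (simp add: t)
    qed
  qed
  moreover have "ruin_time \<gamma> X \<omega> = ereal s"
    unfolding ruin_time_def
  proof (rule order.antisym)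
    show "ereal s \<le> Inf (ereal ` {t. 0 < t \<and> perturbed \<gamma> X t \<omega> < 0})"
    proof (rule Inf_greatest)
      fix y assume "y \<in> ereal ` {t. 0 < t \<and> perturbed \<gamma> X t \<omega> < 0}"
      then obtain t where y: "y = ereal t" and t: "0 < t" "perturbed \<gamma> X t \<omega> < 0" by auto
      have "\<not> t < s"
      proof
        assume "t < s"
        then have b: "g t < a" "a - X t \<omega> \<le> (1 + c) * (a - g t)" using before[of t] t by auto
        have "c * (a - g t) \<le> gamma_bar \<gamma> x (g t)" using b gmono[of 0 t] g0 t by (intro low) auto
        then have "0 \<le> perturbed \<gamma> X t \<omega>" using b pert[of t] t by (simp add: algebra_simps)
        with t show False by simp
      qed
      then show "ereal s \<le> y" by (simp add: y)
    qed
    show "Inf (ereal ` {t. 0 < t \<and> perturbed \<gamma> X t \<omega> < 0}) \<le> ereal s"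
    proof (rule ereal_le_epsilon2)
      fix e :: real assume "0 < e"
      then obtain t where t: "s < t" "t < s + e" "X t \<omega> \<noteq> a" using nc by blast
      have ag: "a \<le> g t" using gmono[of s t] gs s t by simp
      have Xt: "X t \<omega> \<le> g t" using Xg[of t t] s t by simp
      have "perturbed \<gamma> X t \<omega> < 0"
      proof (cases "a < g t")
        case True
        then show ?thesis using neg(2)[of "g t"] pert[of t] Xt s t by simp
      next
        case False
        then have "g t = a" using ag by simp
        then show ?thesis using neg(1)[of a] pert[of t] Xt s t by simp
      qed
      then have "Inf (ereal ` {t. 0 < t \<and> perturbed \<gamma> X t \<omega> < 0}) \<le> ereal t" using s t by (intro Inf_lower) auto
      also have "\<dots> \<le> ereal s + ereal e" using t by simp
      finally show "Inf (ereal ` {t. 0 < t \<and> perturbed \<gamma> X t \<omega> < 0}) \<le> ereal s + ereal e" .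
    qed
  qed
  ultimately show ?thesis by simp
qed

text \<open>Split where the tail of the sum is below \<open>1/2\<close>: from there on the product
  is at least one minus the sum, and the finitely many earlier factors are positive.\<close>

lemma prod_one_minus_bounded_below:
  fixes p :: "nat \<Rightarrow> real"
  assumes p: "\<And>k. 0 \<le> p k" "\<And>k. p k < 1" and sum: "summable p"
  obtains \<kappa> where "0 < \<kappa>" "\<And>n. \<kappa> \<le> (\<Prod>k<n. 1 - p k)"
proof -
  have pos: "0 < (\<Prod>k<n. 1 - p k)" for n using p by (intro prod_pos) auto
  obtain N where N: "\<And>n. (\<Sum>k=N..<n. p k) < 1/2"
  proof -
    obtain N where "\<And>m n. N \<le> m \<Longrightarrow> norm (sum p {m..<n}) < 1/2"
      using sum unfolding summable_Cauchy by (metis half_gt_zero zero_less_one)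
    then have "sum p {N..<n} < 1/2" for n using abs_ge_self le_less_trans unfolding real_norm_def by blast
    then show thesis by (rule that)
  qed
  have tail: "1/2 \<le> (\<Prod>k=N..<N + m. 1 - p k)" for m
  proof -
    have "1 - (\<Sum>k=N..<N + m. p k) \<le> (\<Prod>k=N..<N + m. 1 - p k)"
    proof (induction m)
      case (Suc m)
      have "(\<Prod>k=N..<N + m. 1 - p k) \<le> 1" using p by (intro prod_le_1) (auto intro: less_imp_le)
      then have "p (N + m) * (\<Prod>k=N..<N + m. 1 - p k) \<le> p (N + m) * 1" using p by (intro mult_left_mono) auto
      then show ?case using Suc by (simp add: algebra_simps)
    qed simp
    then show ?thesis using N[of "N + m"] by linarith
  qed
  define \<kappa> where "\<kappa> = (\<Prod>k<N. 1 - p k) / 2"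
  have "\<kappa> \<le> (\<Prod>k<n. 1 - p k)" for n
  proof (cases "N \<le> n")
    case True
    then have "(\<Prod>k<n. 1 - p k) = (\<Prod>k<N. 1 - p k) * (\<Prod>k=N..<N + (n - N). 1 - p k)"
      by (simp add: lessThan_atLeast0 prod.atLeastLessThan_concat)
    moreover have "(\<Prod>k<N. 1 - p k) * (1/2) \<le> (\<Prod>k<N. 1 - p k) * (\<Prod>k=N..<N + (n - N). 1 - p k)"
      by (intro mult_left_mono tail less_imp_le[OF pos])
    ultimately show ?thesis by (simp add: \<kappa>_def)
  next
    case False
    then have e: "(\<Prod>k<N. 1 - p k) = (\<Prod>k<n. 1 - p k) * (\<Prod>k=n..<N. 1 - p k)"
      by (simp add: lessThan_atLeast0 prod.atLeastLessThan_concat)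
    have "(\<Prod>k=n..<N. 1 - p k) \<le> 1" using p by (intro prod_le_1) (auto intro: less_imp_le)
    then have "(\<Prod>k<n. 1 - p k) * (\<Prod>k=n..<N. 1 - p k) \<le> (\<Prod>k<n. 1 - p k) * 1"
      by (intro mult_left_mono less_imp_le[OF pos])
    then have "(\<Prod>k<N. 1 - p k) \<le> (\<Prod>k<n. 1 - p k)" unfolding e by (simp only: mult_1_right)
    moreover have "\<kappa> \<le> (\<Prod>k<N. 1 - p k)" using pos[of N] by (simp add: \<kappa>_def)
    ultimately show ?thesis by simp
  qed
  moreover have "0 < \<kappa>" using pos by (simp add: \<kappa>_def)
  ultimately show thesis using that by blast
qed

section \<open>The probability of passing through all stages\<close>

context spectrally_negative_levy_process
begin

lemma bounded_variation_imp_creeping: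
  assumes x: "0 < x" and \<gamma>: "continuous_on {0..} \<gamma>" and \<gamma>1: "\<gamma> ` {0..} \<subseteq> {1<..}"
    and fin: "a_star \<gamma> x < \<infinity>" and bv: "of_bounded_variation M X"
  shows "0 < measure M {\<omega> \<in> space M. sigma_time X (a_star \<gamma> x) \<omega> = ruin_time \<gamma> X \<omega>}"
proof -
  obtain a c C where a: "a_star \<gamma> x = ereal a" "x < a" and cC: "0 < c" "c \<le> C"
    and bounds: "\<And>s. x \<le> s \<Longrightarrow> s \<le> a \<Longrightarrow> c * (a - s) \<le> gamma_bar \<gamma> x s \<and> gamma_bar \<gamma> x s \<le> C * (a - s)"
    and neg: "\<And>s. a \<le> s \<Longrightarrow> gamma_bar \<gamma> x s \<le> 0" "\<And>s. a < s \<Longrightarrow> gamma_bar \<gamma> x s < 0"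
    by (rule gamma_bar_props[OF x \<gamma> \<gamma>1 fin]) blast
  obtain d where d: "0 < d" "slope_bound d" "\<And>c. slope_bound c \<Longrightarrow> d \<le> c"
    using least_slope[OF bv] by blast
  \<comment> \<open>The initial distance \<open>a - x\<close> is then 4 units \<open>d * h\<close>,
    the lower end of the invariant interval for \<open>r\<close>.\<close>
  define h where "h = (a - x) / (4 * d)"
  have h: "0 < h" using a(2) d(1) by (simp add: h_def)
  have "4 * (d * h) = a - x" using d(1) unfolding h_def by simp
  then have ax: "x = a - 4 * (d * h)" by simp
  define \<delta> where "\<delta> = min c (1/2)"
  have \<delta>: "0 < \<delta>" "\<delta> \<le> 1/2" "\<delta> \<le> c" using cC by (auto simp: \<delta>_def)
  define H where "H k = h / 2^k" for k :: nat
  have H: "0 < H k" for k using h by (simp add: H_def)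
  \<comment> \<open>An excess rate of \<open>\<delta> * d / 5\<close> over the time
    \<open>5 * h / 2^k\<close> amounts to \<open>\<delta>\<close> units
    \<open>d * (h / 2^k)\<close>, the loss that a stage may have.\<close>
  define p where "p k = prob {\<omega> \<in> space M. \<delta> * d / 5 * (5 * h / 2^k) < d * (5 * h / 2^k) - (X (5 * h / 2^k) \<omega> - X 0 \<omega>)}" for k :: nat
  have p: "summable p" "p k < 1" for k
    unfolding p_def using small_downward_excess[OF d(2,3), of "5 * h" "\<delta> * d / 5"] h \<delta> d(1) by auto
  obtain \<kappa> where \<kappa>: "0 < \<kappa>" "\<And>n. \<kappa> \<le> (\<Prod>k<n. 1 - p k)"
    by (rule prod_one_minus_bounded_below[OF _ p(2,1)]) (auto simp: p_def)
  \<comment> \<open>On the mesh \<open>H n\<close> the \<open>n\<close> stages have the time units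
    \<open>H 0\<close> down to \<open>H (n - 1)\<close>, so every grid begins with the same coarse
    stages.\<close>
  define E where "E n = {\<omega> \<in> space M. scheme d (H n) \<delta> n 4 (steps (H n) \<omega>)}" for n
  have sm: "Measurable.pred (Pi\<^sub>M UNIV (\<lambda>_. borel)) (scheme d g \<delta> n 4)" for g n
  proof -
    have "(\<lambda>s. (4, s)) \<in> Pi\<^sub>M UNIV (\<lambda>_. borel) \<rightarrow>\<^sub>M borel \<Otimes>\<^sub>M Pi\<^sub>M UNIV (\<lambda>_. borel :: real measure)" by measurable
    from measurable_compose[OF this scheme_measurable[of d g \<delta> n]] show ?thesis by (simp only: prod.case)
  qed
  have Em: "E n \<in> events" for n
  proof -
    have "Measurable.pred M (\<lambda>\<omega>. scheme d (H n) \<delta> n 4 (steps (H n) \<omega>))"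
      by (rule measurable_compose[OF steps_measurable[OF H] sm])
    then show ?thesis unfolding E_def pred_def .
  qed
  have EP: "\<kappa> \<le> prob (E n)" for n
  proof -
    interpret W: iid_steps "law (H n)" by (rule iid_steps_law[OF H])
    let ?q = "\<lambda>j. measure W.S {s. d * (5 * (2^Suc j * H n)) - psum s (5 * 2^Suc j) \<le> \<delta> * (d * (2^Suc j * H n))}"
    \<comment> \<open>\<open>?q\<close> counts the stages from the finest unit, \<open>p\<close>
      from the coarsest one.\<close>
    have q: "?q j = 1 - p (n - Suc j)" if j: "j < n" for j
    proof -
      obtain l where l: "n = Suc j + l" using j less_iff_Suc_add by auto
      have t: "2^Suc j * H n = H l" by (simp add: H_def l power_add)
      have t5: "5 * H l = 5 * h / 2^l" by (simp add: H_def)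
      have "?q j = prob {\<omega> \<in> space M. d * (5 * H l) - psum (steps (H n) \<omega>) (5 * 2^Suc j) \<le> \<delta> * (d * H l)}"
        unfolding t by (rule steps_prob_0[OF H, symmetric]) measurable
      also have "{\<omega> \<in> space M. d * (5 * H l) - psum (steps (H n) \<omega>) (5 * 2^Suc j) \<le> \<delta> * (d * H l)}
          = space M - {\<omega> \<in> space M. \<delta> * d / 5 * (5 * h / 2^l) < d * (5 * h / 2^l) - (X (5 * h / 2^l) \<omega> - X 0 \<omega>)}"
      proof -
        have r: "real (5 * 2^Suc j) * H n = 5 * h / 2^l" unfolding t5[symmetric] t[symmetric] by simp
        have ps: "psum (steps (H n) \<omega>) (5 * 2^Suc j) = X (5 * h / 2^l) \<omega> - X 0 \<omega>" for \<omega>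
          unfolding steps_def psum_path_steps_0 r ..
        have e: "\<delta> * (d * H l) = \<delta> * d / 5 * (5 * h / 2^l)" by (simp add: H_def)
        show ?thesis unfolding ps e t5 by auto
      qed
      also have "prob \<dots> = 1 - p l"
        unfolding p_def
      proof (rule prob_compl)
        show "{\<omega> \<in> space M. \<delta> * d / 5 * (5 * h / 2^l) < d * (5 * h / 2^l) - (X (5 * h / 2^l) \<omega> - X 0 \<omega>)} \<in> events"
          using h by (intro borel_measurable_less borel_measurable_const borel_measurable_diff X_measurable) auto
      qed
      finally show ?thesis by (simp add: l)
    qed
    have "measure W.S {s. d * H n < s 0} = prob {\<omega> \<in> space M. d * H n < steps (H n) \<omega> 0}"
      by (rule steps_prob_0[OF H, symmetric]) measurable
    also have "\<dots> = 0"
    proof -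
      have "AE \<omega> in M. \<omega> \<notin> {\<omega> \<in> space M. d * H n < steps (H n) \<omega> 0}"
        using d(2) unfolding slope_bound_def
      proof eventually_elim
        case (elim \<omega>)
        have "X (H n) \<omega> - X 0 \<omega> \<le> d * (H n - 0)" using elim[rule_format, of 0 "H n"] less_imp_le[OF H[of n]] by simp
        then show ?case by (simp add: steps_def path_steps_def)
      qed
      moreover have "{\<omega> \<in> space M. d * H n < steps (H n) \<omega> 0} \<in> events"
        by (intro borel_measurable_less borel_measurable_const step_measurable[OF H])
      ultimately show ?thesis by (simp only: prob_eq_0)
    qed
    finally have s0: "measure W.S {s. d * H n < s 0} = 0" .
    have "\<kappa> \<le> (\<Prod>k<n. 1 - p k)" by (rule \<kappa>)
    also have "\<dots> = (\<Prod>j<n. 1 - p (n - Suc j))" by (rule prod.nat_diff_reindex[symmetric])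
    also have "\<dots> = (\<Prod>j<n. ?q j)" by (intro prod.cong refl) (simp only: q lessThan_iff)
    also have "\<dots> \<le> measure W.S {s. scheme d (H n) \<delta> n 4 s}"
      by (rule W.scheme_prob_ge[OF d(1) H \<delta>(2) s0]) auto
    also have "\<dots> = prob (E n)" unfolding E_def by (rule steps_prob_0[OF H sm, symmetric])
    finally show ?thesis .
  qed
  \<comment> \<open>The intersection of the \<open>B N\<close> consists of the outcomes in
    infinitely many \<open>E n\<close>. As the stage times are the same for all grids, such an
    outcome completes every stage, and the bound \<open>\<kappa>\<close>, uniform in
    \<open>n\<close>, carries over to the intersection.\<close>
  define B where "B N = (\<Union>n\<in>{N..}. E n)" for N
  have Bm: "B N \<in> events" for N unfolding B_def using Em by (intro sets.countable_UN') auto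
  have Bdec: "decseq B" unfolding decseq_def B_def by (intro allI impI UN_mono) auto
  have "(\<lambda>N. prob (B N)) \<longlonglongrightarrow> prob (\<Inter>N. B N)"
    by (rule finite_Lim_measure_decseq[OF _ Bdec]) (use Bm in blast)
  moreover have "\<kappa> \<le> prob (B N)" for N
  proof -
    have "\<kappa> \<le> prob (E N)" by (rule EP)
    also have "\<dots> \<le> prob (B N)" by (rule finite_measure_mono[OF _ Bm]) (auto simp: B_def)
    finally show ?thesis .
  qed
  ultimately have "\<kappa> \<le> prob (\<Inter>N. B N)" by (intro LIMSEQ_le_const) auto
  then have pos: "0 < prob (\<Inter>N. B N)" using \<kappa> by linarith
  have AE_nc: "AE \<omega> in M. \<forall>s\<ge>0. \<forall>e>0. \<forall>a. \<exists>t. s < t \<and> t < s + e \<and> X t \<omega> \<noteq> a"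
    using d by (intro AE_not_locally_constant)
  let ?E = "{\<omega> \<in> space M. sigma_time X (a_star \<gamma> x) \<omega> = ruin_time \<gamma> X \<omega>}"
  have "prob (\<Inter>N. B N) \<le> prob ?E"
  proof (rule finite_measure_mono_AE)
    show "?E \<in> events" by (rule creeping_event_measurable[OF x \<gamma> \<gamma>1 fin])
    show "AE \<omega> in M. \<omega> \<in> (\<Inter>N. B N) \<longrightarrow> \<omega> \<in> ?E"
      using d(2)[unfolded slope_bound_def] AE_nc start AE_space
    proof (eventually_elim, intro impI)
      fix \<omega>
      assume slope: "\<forall>s t. 0 \<le> s \<and> s \<le> t \<longrightarrow> X t \<omega> - X s \<omega> \<le> d * (t - s)"
        and nc: "\<forall>s\<ge>0. \<forall>e>0. \<forall>a. \<exists>t. s < t \<and> t < s + e \<and> X t \<omega> \<noteq> a"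
        and X0: "X 0 \<omega> = x" and \<omega>: "\<omega> \<in> space M" and inB: "\<omega> \<in> (\<Inter>N. B N)"
      let ?f = "\<lambda>t. X t \<omega>"
      define v where "v = stage_time ?f a d h"
      have "\<exists>m. real m + 2 \<le> (a - ?f (v j)) / (d * (h / 2^j)) \<and> (a - ?f (v j)) / (d * (h / 2^j)) < real m + 3 \<and>
         v (Suc j) = v j + real m * (h / 2^j) \<and>
         0 \<le> real m - (?f (v (Suc j)) - ?f (v j)) / (d * (h / 2^j)) \<and>
         real m - (?f (v (Suc j)) - ?f (v j)) / (d * (h / 2^j)) \<le> \<delta>" for j
      proof -
        have "\<omega> \<in> B (Suc j)" using inB by blast
        then obtain n where n: "Suc j \<le> n" "\<omega> \<in> E n" by (auto simp: B_def)
        have r: "(a - ?f (stage_time ?f a d h 0)) / (d * (h / 2^0)) = 4"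
          using X0 ax d(1) h by simp
        show ?thesis
          unfolding v_def
        proof (rule scheme_imp_stages[OF d(1) h, where k = 0 and n = n and i = 0 and g = "H n"])
          show "scheme d (H n) \<delta> n ((a - ?f (stage_time ?f a d h 0)) / (d * (h / 2^0))) (drop_steps 0 (path_steps ?f (H n)))"
            unfolding r using n(2) by (simp only: E_def steps_def drop_steps_0 mem_Collect_eq)
        qed (use n in \<open>auto simp: H_def\<close>)
      qed
      then have "\<exists>s>0. (\<forall>r t. 0 \<le> r \<and> r \<le> t \<and> t < s \<longrightarrow> ?f r < a \<and> a - ?f t \<le> (1 + c) * (a - ?f r)) \<and>
         (\<forall>e>0. \<exists>r\<ge>0. r < s \<and> a - e < ?f r)"
        using slope X0 ax \<delta> unfolding v_def
        by (intro stages_imp_good_path[of ?f a d h \<delta> c] d(1) h) auto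
      then obtain s where s: "0 < s"
        "\<And>r t. 0 \<le> r \<Longrightarrow> r \<le> t \<Longrightarrow> t < s \<Longrightarrow> ?f r < a \<and> a - ?f t \<le> (1 + c) * (a - ?f r)"
        "\<And>e. 0 < e \<Longrightarrow> \<exists>r\<ge>0. r < s \<and> a - e < ?f r" by blast
      have "sigma_time X (ereal a) \<omega> = ruin_time \<gamma> X \<omega>"
      proof (rule good_path_creeps[of X \<omega> x \<gamma> c a s])
        show "cadlag_no_positive_jumps (\<lambda>t. X t \<omega>)" by (rule paths[OF \<omega>])
        show "\<And>y. x \<le> y \<Longrightarrow> y \<le> a \<Longrightarrow> c * (a - y) \<le> gamma_bar \<gamma> x y" using bounds by blast
        show "\<exists>t>s. t < s + e \<and> X t \<omega> \<noteq> a" if "0 < e" for e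
          using nc[rule_format, of s e a] s(1) that by auto
      qed (use X0 x \<gamma> cC(1) neg s in blast)+
      then show "\<omega> \<in> ?E" using \<omega> by (simp only: a(1) mem_Collect_eq)
    qed
  qed
  then show ?thesis using pos by linarith
qed

end

theorem corollary3p3:
  fixes M :: "'w measure" and F :: "real \<Rightarrow> 'w measure"
    and X :: "real \<Rightarrow> 'w \<Rightarrow> real" and \<gamma> :: "real \<Rightarrow> real" and x :: real
  assumes "spectrally_negative_levy_process M F X x"
    and "0 < x"
    and "continuous_on {0..} \<gamma>"
    and "\<gamma> ` {0..} \<subseteq> {1<..}"
    and "a_star \<gamma> x < \<infinity>"
  shows "type_II_creeping M \<gamma> X x \<longleftrightarrow> of_bounded_variation M X"
proof -
  interpret spectrally_negative_levy_process M F X x by (rule assms(1))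
  show ?thesis
    unfolding type_II_creeping_def
    using creeping_imp_bounded_variation[OF assms(2-5)] bounded_variation_imp_creeping[OF assms(2-5)] assms(5)
    by blast
qed

end
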